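(* Let $H$ be a Hopf algebra over a field $k$, let $\tau,\omega$ be algebra automorphisms of $H$ such that $\tau\omega=\omega\tau$, and put $\sigma=\tau\omega$. Let $c\in Z_\sigma(H)$ be a $\sigma$-central element and let $\xi\in k^*$. Then the generalized ambiskew polynomial algebra $A(H,E,F,\tau,\omega,c,\xi)$ has a Hopf algebra structure extending that of $H$ and such that $$\Delta(E)=E\otimes 1+g\otimes E,\qquad \Delta(F)=F\otimes 1+h\otimes F$$ for some group-like elements $g,h\in G(H)$ if and only if (with these $g,h\in G(H)$) the following hold: \begin{itemize} \item there are characters $\alpha,\beta$ of $H$ with $\alpha*\beta=\beta*\alpha$ such that for all $r\in H$ $$\tau(r)=\alpha(r_{(1)})r_{(2)},\qquad \omega(r)=\beta(r_{(1)})r_{(2)},$$ $$\alpha(r_{(1)})r_{(2)}=(g\, r_{(1)}g^{-1})\,\alpha(r_{(2)}),\qquad \beta(r_{(1)})r_{(2)}=(h\, r_{(1)}h^{-1})\,\beta(r_{(2)});$$ \item the group-like elements $g,h$ are central in the group $G(H)$, and $\alpha(h)=\beta(g)^{-1}=\xi$; \item the $\sigma$-central element $c$ is $(gh,1)$-skew primitive, i.e. $\Delta(c)=c\otimes 1+gh\otimes c$. \end{itemize}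
   Context: All algebras and tensor products are over a field $k$. For an algebra $R$ and an algebra automorphism $\sigma$ of $R$, $Z_\sigma(R)=\{x\in R: xr=\sigma(r)x \text{ for all } r\in R\}$; its elements are called $\sigma$-central. Given an algebra $R$, commuting algebra automorphisms $\tau,\omega$ of $R$, $\sigma=\tau\omega$, an element $c\in Z_\sigma(R)$ and $\xi\in k^*$, the generalized ambiskew polynomial algebra $A(R,X,Y,\tau,\omega,c,\xi)$ is the quotient of the free product $R*k\langle X,Y\rangle$ by the relations $Xr=\tau(r)X$, $Yr=\omega(r)Y$ (for all $r\in R$) and $XY-\xi YX=c$. In $A(H,E,F,\tau,\omega,c,\xi)$ the variables are named $E,F$ in place of $X,Y$. A character of $H$ is an algebra map $H\to k$; $*$ is the convolution product; $G(H)$ is the group of group-like elements of $H$; $\Delta(r)=r_{(1)}\otimes r_{(2)}$ is Sweedler notation. *)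

theory Defs
  imports "HOL-Algebra.QuotRing" "HOL-Algebra.Module"
begin

section \<open>Associative unital algebras over a field\<close>

text \<open>The library locale \<^locale>\<open>algebra\<close> is restricted to commutative algebras, so the
  noncommutative notion is introduced here on the same records.\<close>

locale assoc_algebra = module K A + K?: field K + A?: ring A
  for K (structure) and A (structure) +
  assumes smult_mult_left:
      "\<lbrakk>a \<in> carrier K; x \<in> carrier A; y \<in> carrier A\<rbrakk>
        \<Longrightarrow> (a \<odot>\<^bsub>A\<^esub> x) \<otimes>\<^bsub>A\<^esub> y = a \<odot>\<^bsub>A\<^esub> (x \<otimes>\<^bsub>A\<^esub> y)"
    and smult_mult_right:
      "\<lbrakk>a \<in> carrier K; x \<in> carrier A; y \<in> carrier A\<rbrakk>
        \<Longrightarrow> x \<otimes>\<^bsub>A\<^esub> (a \<odot>\<^bsub>A\<^esub> y) = a \<odot>\<^bsub>A\<^esub> (x \<otimes>\<^bsub>A\<^esub> y)"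

definition linear_hom ::
  "('k, 'r) ring_scheme \<Rightarrow> ('k, 'a, 'm) module_scheme \<Rightarrow> ('k, 'b, 'n) module_scheme \<Rightarrow> ('a \<Rightarrow> 'b) set" where
  "linear_hom K A B = {f \<in> carrier A \<rightarrow> carrier B.
     (\<forall>x\<in>carrier A. \<forall>y\<in>carrier A. f (x \<oplus>\<^bsub>A\<^esub> y) = f x \<oplus>\<^bsub>B\<^esub> f y) \<and>
     (\<forall>a\<in>carrier K. \<forall>x\<in>carrier A. f (a \<odot>\<^bsub>A\<^esub> x) = a \<odot>\<^bsub>B\<^esub> f x)}"

definition algebra_hom ::
  "('k, 'r) ring_scheme \<Rightarrow> ('k, 'a, 'm) module_scheme \<Rightarrow> ('k, 'b, 'n) module_scheme \<Rightarrow> ('a \<Rightarrow> 'b) set" where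
  "algebra_hom K A B = ring_hom A B \<inter> linear_hom K A B"

definition algebra_aut ::
  "('k, 'r) ring_scheme \<Rightarrow> ('k, 'a, 'm) module_scheme \<Rightarrow> ('a \<Rightarrow> 'a) set" where
  "algebra_aut K A = {f \<in> algebra_hom K A A. bij_betw f (carrier A) (carrier A)}"

definition ground_algebra :: "('k, 'r) ring_scheme \<Rightarrow> ('k, 'k) module" where
  "ground_algebra K = \<lparr>carrier = carrier K, mult = mult K, one = \<one>\<^bsub>K\<^esub>,
     zero = \<zero>\<^bsub>K\<^esub>, add = add K, smult = mult K\<rparr>"

definition quotient_algebra :: "('k, 'a, 'm) module_scheme \<Rightarrow> 'a set \<Rightarrow> ('k, 'a set) module" where
  "quotient_algebra A I = \<lparr>carrier = carrier (A Quot I), mult = mult (A Quot I),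
     one = \<one>\<^bsub>A Quot I\<^esub>, zero = \<zero>\<^bsub>A Quot I\<^esub>, add = add (A Quot I),
     smult = (\<lambda>a U. \<Union>x\<in>U. I +>\<^bsub>A\<^esub> (a \<odot>\<^bsub>A\<^esub> x))\<rparr>"

definition linear_span ::
  "('k, 'r) ring_scheme \<Rightarrow> ('k, 'a, 'm) module_scheme \<Rightarrow> 'a set \<Rightarrow> 'a set" where
  "linear_span K A S = \<Inter>{N. submodule N K A \<and> S \<subseteq> N}"


section \<open>Monoid algebras and free algebras\<close>

text \<open>Elements are the finitely supported functions on the monoid; the product is convolution.
  Functions vanish off the carrier, so that equality of elements is equality of functions.\<close>

definition monoid_algebra ::
  "('k, 'r) ring_scheme \<Rightarrow> ('x, 'm) monoid_scheme \<Rightarrow> ('k, 'x \<Rightarrow> 'k) module" where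
  "monoid_algebra K M =
    \<lparr>carrier = {f. finite {x. f x \<noteq> \<zero>\<^bsub>K\<^esub>} \<and> {x. f x \<noteq> \<zero>\<^bsub>K\<^esub>} \<subseteq> carrier M \<and> range f \<subseteq> carrier K},
     mult = (\<lambda>f g z. finsum K (\<lambda>(x, y). f x \<otimes>\<^bsub>K\<^esub> g y)
        {(x, y). f x \<noteq> \<zero>\<^bsub>K\<^esub> \<and> g y \<noteq> \<zero>\<^bsub>K\<^esub> \<and> x \<otimes>\<^bsub>M\<^esub> y = z}),
     one = (\<lambda>x. if x = \<one>\<^bsub>M\<^esub> then \<one>\<^bsub>K\<^esub> else \<zero>\<^bsub>K\<^esub>),
     zero = (\<lambda>x. \<zero>\<^bsub>K\<^esub>),
     add = (\<lambda>f g x. f x \<oplus>\<^bsub>K\<^esub> g x),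
     smult = (\<lambda>a f x. a \<otimes>\<^bsub>K\<^esub> f x)\<rparr>"

definition basis_elem :: "('k, 'r) ring_scheme \<Rightarrow> 'x \<Rightarrow> 'x \<Rightarrow> 'k" where
  "basis_elem K x = (\<lambda>y. if y = x then \<one>\<^bsub>K\<^esub> else \<zero>\<^bsub>K\<^esub>)"

definition linear_extension ::
  "('k, 'r) ring_scheme \<Rightarrow> ('k, 'a, 'm) module_scheme \<Rightarrow> ('x \<Rightarrow> 'a) \<Rightarrow> ('x \<Rightarrow> 'k) \<Rightarrow> 'a" where
  "linear_extension K M \<phi> f = finsum M (\<lambda>x. f x \<odot>\<^bsub>M\<^esub> \<phi> x) {x. f x \<noteq> \<zero>\<^bsub>K\<^esub>}"

definition free_algebra :: "('k, 'r) ring_scheme \<Rightarrow> 'x set \<Rightarrow> ('k, 'x list \<Rightarrow> 'k) module" where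
  "free_algebra K X = monoid_algebra K \<lparr>carrier = lists X, mult = (@), one = []\<rparr>"

definition free_gen :: "('k, 'r) ring_scheme \<Rightarrow> 'x \<Rightarrow> 'x list \<Rightarrow> 'k" where
  "free_gen K x = basis_elem K [x]"


section \<open>Tensor products\<close>

text \<open>The underlying vector space of \<open>A \<otimes> B\<close> is the free vector space on
  \<open>carrier A \<times> carrier B\<close> modulo the span of the bilinearity relations. The free vector space is
  taken as the monoid algebra of the product of the multiplicative monoids, so that the quotient
  carries the product \<open>(a \<otimes> b)(a' \<otimes> b') = aa' \<otimes> bb'\<close>.\<close>

definition bilinear_relations ::
  "('k, 'r) ring_scheme \<Rightarrow> ('k, 'a, 'm) module_scheme \<Rightarrow> ('k, 'b, 'n) module_scheme
    \<Rightarrow> ('a \<times> 'b \<Rightarrow> 'k) set" where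
  "bilinear_relations K A B = (let F = monoid_algebra K (A \<times>\<times> B); d = basis_elem K in
     {d (x \<oplus>\<^bsub>A\<^esub> x', y) \<ominus>\<^bsub>F\<^esub> (d (x, y) \<oplus>\<^bsub>F\<^esub> d (x', y)) | x x' y.
        x \<in> carrier A \<and> x' \<in> carrier A \<and> y \<in> carrier B} \<union>
     {d (x, y \<oplus>\<^bsub>B\<^esub> y') \<ominus>\<^bsub>F\<^esub> (d (x, y) \<oplus>\<^bsub>F\<^esub> d (x, y')) | x y y'.
        x \<in> carrier A \<and> y \<in> carrier B \<and> y' \<in> carrier B} \<union>
     {d (a \<odot>\<^bsub>A\<^esub> x, y) \<ominus>\<^bsub>F\<^esub> (a \<odot>\<^bsub>F\<^esub> d (x, y)) | a x y.
        a \<in> carrier K \<and> x \<in> carrier A \<and> y \<in> carrier B} \<union>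
     {d (x, a \<odot>\<^bsub>B\<^esub> y) \<ominus>\<^bsub>F\<^esub> (a \<odot>\<^bsub>F\<^esub> d (x, y)) | a x y.
        a \<in> carrier K \<and> x \<in> carrier A \<and> y \<in> carrier B})"

definition tensor_kernel ::
  "('k, 'r) ring_scheme \<Rightarrow> ('k, 'a, 'm) module_scheme \<Rightarrow> ('k, 'b, 'n) module_scheme
    \<Rightarrow> ('a \<times> 'b \<Rightarrow> 'k) set" where
  "tensor_kernel K A B = linear_span K (monoid_algebra K (A \<times>\<times> B)) (bilinear_relations K A B)"

definition tensor_algebra ::
  "('k, 'r) ring_scheme \<Rightarrow> ('k, 'a, 'm) module_scheme \<Rightarrow> ('k, 'b, 'n) module_scheme
    \<Rightarrow> ('k, ('a \<times> 'b \<Rightarrow> 'k) set) module" where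
  "tensor_algebra K A B = quotient_algebra (monoid_algebra K (A \<times>\<times> B)) (tensor_kernel K A B)"

definition tensor ::
  "('k, 'r) ring_scheme \<Rightarrow> ('k, 'a, 'm) module_scheme \<Rightarrow> ('k, 'b, 'n) module_scheme
    \<Rightarrow> 'a \<Rightarrow> 'b \<Rightarrow> ('a \<times> 'b \<Rightarrow> 'k) set" where
  "tensor K A B x y = tensor_kernel K A B +>\<^bsub>monoid_algebra K (A \<times>\<times> B)\<^esub> basis_elem K (x, y)"

text \<open>\<open>tensor_lift K M \<phi>\<close> is the linear map out of \<open>A \<otimes> B\<close> induced by a bilinear map \<open>\<phi>\<close> into \<open>M\<close>;
  it is only meaningful for bilinear \<open>\<phi>\<close>, where the linear extension of \<open>\<phi>\<close> is constant on cosets.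
  In Sweedler notation, \<open>tensor_lift K M \<phi> (\<Delta> r)\<close> is \<open>\<phi>(r\<^sub>(\<^sub>1\<^sub>), r\<^sub>(\<^sub>2\<^sub>))\<close>.\<close>

definition tensor_lift ::
  "('k, 'r) ring_scheme \<Rightarrow> ('k, 'c, 'm) module_scheme \<Rightarrow> ('a \<Rightarrow> 'b \<Rightarrow> 'c)
    \<Rightarrow> ('a \<times> 'b \<Rightarrow> 'k) set \<Rightarrow> 'c" where
  "tensor_lift K M \<phi> U = the_elem (linear_extension K M (case_prod \<phi>) ` U)"

definition tensor_map ::
  "('k, 'r) ring_scheme \<Rightarrow> ('k, 'c, 'm) module_scheme \<Rightarrow> ('k, 'd, 'n) module_scheme
    \<Rightarrow> ('a \<Rightarrow> 'c) \<Rightarrow> ('b \<Rightarrow> 'd) \<Rightarrow> ('a \<times> 'b \<Rightarrow> 'k) set \<Rightarrow> ('c \<times> 'd \<Rightarrow> 'k) set" where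
  "tensor_map K C D f g = tensor_lift K (tensor_algebra K C D) (\<lambda>x y. tensor K C D (f x) (g y))"

text \<open>The canonical isomorphism \<open>(A \<otimes> A) \<otimes> A \<rightarrow> A \<otimes> (A \<otimes> A)\<close>.\<close>

definition tensor_assoc ::
  "('k, 'r) ring_scheme \<Rightarrow> ('k, 'a, 'm) module_scheme
    \<Rightarrow> (('a \<times> 'a \<Rightarrow> 'k) set \<times> 'a \<Rightarrow> 'k) set \<Rightarrow> ('a \<times> ('a \<times> 'a \<Rightarrow> 'k) set \<Rightarrow> 'k) set" where
  "tensor_assoc K A = (let AA = tensor_algebra K A A; T = tensor_algebra K A AA in
     tensor_lift K T (\<lambda>u z. tensor_lift K T (\<lambda>x y. tensor K A AA x (tensor K A A y z)) u))"


section \<open>Hopf algebras\<close>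

locale hopf_algebra = assoc_algebra K H
  for K (structure) and H (structure) and \<Delta> and \<epsilon> and S +
  assumes comult_hom: "\<Delta> \<in> algebra_hom K H (tensor_algebra K H H)"
    and counit_hom: "\<epsilon> \<in> algebra_hom K H (ground_algebra K)"
    and antipode_linear: "S \<in> linear_hom K H H"
    and coassoc: "r \<in> carrier H \<Longrightarrow>
      tensor_assoc K H (tensor_map K (tensor_algebra K H H) H \<Delta> (\<lambda>x. x) (\<Delta> r)) =
      tensor_map K H (tensor_algebra K H H) (\<lambda>x. x) \<Delta> (\<Delta> r)"
    and counit_left: "r \<in> carrier H \<Longrightarrow> tensor_lift K H (\<lambda>x y. \<epsilon> x \<odot>\<^bsub>H\<^esub> y) (\<Delta> r) = r"
    and counit_right: "r \<in> carrier H \<Longrightarrow> tensor_lift K H (\<lambda>x y. \<epsilon> y \<odot>\<^bsub>H\<^esub> x) (\<Delta> r) = r"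
    and antipode_left: "r \<in> carrier H \<Longrightarrow>
      tensor_lift K H (\<lambda>x y. S x \<otimes>\<^bsub>H\<^esub> y) (\<Delta> r) = \<epsilon> r \<odot>\<^bsub>H\<^esub> \<one>\<^bsub>H\<^esub>"
    and antipode_right: "r \<in> carrier H \<Longrightarrow>
      tensor_lift K H (\<lambda>x y. x \<otimes>\<^bsub>H\<^esub> S y) (\<Delta> r) = \<epsilon> r \<odot>\<^bsub>H\<^esub> \<one>\<^bsub>H\<^esub>"

text \<open>The group law on the group-likes is the product of \<open>H\<close>.\<close>

definition grouplikes ::
  "('k, 'r) ring_scheme \<Rightarrow> ('k, 'h, 'm) module_scheme \<Rightarrow> ('h \<Rightarrow> ('h \<times> 'h \<Rightarrow> 'k) set) \<Rightarrow> 'h set" where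
  "grouplikes K H \<Delta> = {g \<in> carrier H. g \<noteq> \<zero>\<^bsub>H\<^esub> \<and> \<Delta> g = tensor K H H g g}"

definition grouplike_center ::
  "('k, 'r) ring_scheme \<Rightarrow> ('k, 'h, 'm) module_scheme \<Rightarrow> ('h \<Rightarrow> ('h \<times> 'h \<Rightarrow> 'k) set) \<Rightarrow> 'h set" where
  "grouplike_center K H \<Delta> =
     {g \<in> grouplikes K H \<Delta>. \<forall>x\<in>grouplikes K H \<Delta>. g \<otimes>\<^bsub>H\<^esub> x = x \<otimes>\<^bsub>H\<^esub> g}"

text \<open>\<open>x\<close> is \<open>(a, b)\<close>-skew primitive.\<close>

definition skew_primitive ::
  "('k, 'r) ring_scheme \<Rightarrow> ('k, 'h, 'm) module_scheme \<Rightarrow> ('h \<Rightarrow> ('h \<times> 'h \<Rightarrow> 'k) set)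
    \<Rightarrow> 'h \<Rightarrow> 'h \<Rightarrow> 'h \<Rightarrow> bool" where
  "skew_primitive K H \<Delta> a b x \<longleftrightarrow>
     \<Delta> x = tensor K H H x b \<oplus>\<^bsub>tensor_algebra K H H\<^esub> tensor K H H a x"

definition characters :: "('k, 'r) ring_scheme \<Rightarrow> ('k, 'h, 'm) module_scheme \<Rightarrow> ('h \<Rightarrow> 'k) set" where
  "characters K H = algebra_hom K H (ground_algebra K)"

definition convolution ::
  "('k, 'r) ring_scheme \<Rightarrow> ('h \<Rightarrow> ('h \<times> 'h \<Rightarrow> 'k) set) \<Rightarrow> ('h \<Rightarrow> 'k) \<Rightarrow> ('h \<Rightarrow> 'k) \<Rightarrow> 'h \<Rightarrow> 'k" where
  "convolution K \<Delta> \<alpha> \<beta> r = tensor_lift K (ground_algebra K) (\<lambda>x y. \<alpha> x \<otimes>\<^bsub>K\<^esub> \<beta> y) (\<Delta> r)"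

definition extends_hopf ::
  "('k, 'r) ring_scheme \<Rightarrow> ('k, 'h, 'm) module_scheme \<Rightarrow> ('h \<Rightarrow> ('h \<times> 'h \<Rightarrow> 'k) set) \<Rightarrow> ('h \<Rightarrow> 'k) \<Rightarrow> ('h \<Rightarrow> 'h)
    \<Rightarrow> ('k, 'a, 'n) module_scheme \<Rightarrow> ('h \<Rightarrow> 'a)
    \<Rightarrow> ('a \<Rightarrow> ('a \<times> 'a \<Rightarrow> 'k) set) \<Rightarrow> ('a \<Rightarrow> 'k) \<Rightarrow> ('a \<Rightarrow> 'a) \<Rightarrow> bool" where
  "extends_hopf K H \<Delta> \<epsilon> S A \<iota> \<Delta>' \<epsilon>' S' \<longleftrightarrow>
     (\<forall>r\<in>carrier H. \<Delta>' (\<iota> r) = tensor_map K A A \<iota> \<iota> (\<Delta> r) \<and> \<epsilon>' (\<iota> r) = \<epsilon> r \<and> S' (\<iota> r) = \<iota> (S r))"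


section \<open>Generalized ambiskew polynomial algebras\<close>

text \<open>The relations in \<open>F\<close> that turn \<open>j : B \<rightarrow> F\<close> into an algebra homomorphism.\<close>

definition hom_relations ::
  "('k, 'r) ring_scheme \<Rightarrow> ('k, 'b, 'm) module_scheme \<Rightarrow> ('k, 'f, 'n) module_scheme \<Rightarrow> ('b \<Rightarrow> 'f) \<Rightarrow> 'f set" where
  "hom_relations K B F j =
     {j (x \<oplus>\<^bsub>B\<^esub> y) \<ominus>\<^bsub>F\<^esub> (j x \<oplus>\<^bsub>F\<^esub> j y) | x y. x \<in> carrier B \<and> y \<in> carrier B} \<union>
     {j (a \<odot>\<^bsub>B\<^esub> x) \<ominus>\<^bsub>F\<^esub> (a \<odot>\<^bsub>F\<^esub> j x) | a x. a \<in> carrier K \<and> x \<in> carrier B} \<union>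
     {j (x \<otimes>\<^bsub>B\<^esub> y) \<ominus>\<^bsub>F\<^esub> (j x \<otimes>\<^bsub>F\<^esub> j y) | x y. x \<in> carrier B \<and> y \<in> carrier B} \<union>
     {j \<one>\<^bsub>B\<^esub> \<ominus>\<^bsub>F\<^esub> \<one>\<^bsub>F\<^esub>}"

text \<open>The free product (coproduct of unital algebras) of \<open>A\<close> and \<open>B\<close>: the free algebra on the
  disjoint union of the two carriers, modulo the relations of \<open>A\<close> and of \<open>B\<close>.\<close>

definition free_product_ideal ::
  "('k, 'r) ring_scheme \<Rightarrow> ('k, 'a, 'm) module_scheme \<Rightarrow> ('k, 'b, 'n) module_scheme
    \<Rightarrow> (('a + 'b) list \<Rightarrow> 'k) set" where
  "free_product_ideal K A B = (let F = free_algebra K (carrier A <+> carrier B) in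
     genideal F (hom_relations K A F (\<lambda>x. free_gen K (Inl x)) \<union>
                 hom_relations K B F (\<lambda>y. free_gen K (Inr y))))"

definition free_product ::
  "('k, 'r) ring_scheme \<Rightarrow> ('k, 'a, 'm) module_scheme \<Rightarrow> ('k, 'b, 'n) module_scheme
    \<Rightarrow> ('k, (('a + 'b) list \<Rightarrow> 'k) set) module" where
  "free_product K A B =
     quotient_algebra (free_algebra K (carrier A <+> carrier B)) (free_product_ideal K A B)"

definition free_product_inl ::
  "('k, 'r) ring_scheme \<Rightarrow> ('k, 'a, 'm) module_scheme \<Rightarrow> ('k, 'b, 'n) module_scheme
    \<Rightarrow> 'a \<Rightarrow> (('a + 'b) list \<Rightarrow> 'k) set" where
  "free_product_inl K A B x =
     free_product_ideal K A B +>\<^bsub>free_algebra K (carrier A <+> carrier B)\<^esub> free_gen K (Inl x)"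

definition free_product_inr ::
  "('k, 'r) ring_scheme \<Rightarrow> ('k, 'a, 'm) module_scheme \<Rightarrow> ('k, 'b, 'n) module_scheme
    \<Rightarrow> 'b \<Rightarrow> (('a + 'b) list \<Rightarrow> 'k) set" where
  "free_product_inr K A B y =
     free_product_ideal K A B +>\<^bsub>free_algebra K (carrier A <+> carrier B)\<^esub> free_gen K (Inr y)"

datatype variable = VarX | VarY

type_synonym ('k, 'a) adjoin_xy = "(('a + (variable list \<Rightarrow> 'k)) list \<Rightarrow> 'k) set"

definition adjoin_xy ::
  "('k, 'r) ring_scheme \<Rightarrow> ('k, 'a, 'm) module_scheme \<Rightarrow> ('k, ('k, 'a) adjoin_xy) module" where
  "adjoin_xy K R = free_product K R (free_algebra K {VarX, VarY})"

definition ambiskew_ideal ::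
  "('k, 'r) ring_scheme \<Rightarrow> ('k, 'a, 'm) module_scheme \<Rightarrow> ('a \<Rightarrow> 'a) \<Rightarrow> ('a \<Rightarrow> 'a) \<Rightarrow> 'a \<Rightarrow> 'k
    \<Rightarrow> ('k, 'a) adjoin_xy set" where
  "ambiskew_ideal K R \<tau> \<omega> c \<xi> =
    (let P = adjoin_xy K R;
         i = free_product_inl K R (free_algebra K {VarX, VarY});
         x = free_product_inr K R (free_algebra K {VarX, VarY}) (free_gen K VarX);
         y = free_product_inr K R (free_algebra K {VarX, VarY}) (free_gen K VarY)
     in genideal P
       ({x \<otimes>\<^bsub>P\<^esub> i r \<ominus>\<^bsub>P\<^esub> (i (\<tau> r) \<otimes>\<^bsub>P\<^esub> x) | r. r \<in> carrier R} \<union>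
        {y \<otimes>\<^bsub>P\<^esub> i r \<ominus>\<^bsub>P\<^esub> (i (\<omega> r) \<otimes>\<^bsub>P\<^esub> y) | r. r \<in> carrier R} \<union>
        {(x \<otimes>\<^bsub>P\<^esub> y \<ominus>\<^bsub>P\<^esub> (\<xi> \<odot>\<^bsub>P\<^esub> (y \<otimes>\<^bsub>P\<^esub> x))) \<ominus>\<^bsub>P\<^esub> i c}))"

definition ambiskew ::
  "('k, 'r) ring_scheme \<Rightarrow> ('k, 'a, 'm) module_scheme \<Rightarrow> ('a \<Rightarrow> 'a) \<Rightarrow> ('a \<Rightarrow> 'a) \<Rightarrow> 'a \<Rightarrow> 'k
    \<Rightarrow> ('k, ('k, 'a) adjoin_xy set) module" where
  "ambiskew K R \<tau> \<omega> c \<xi> = quotient_algebra (adjoin_xy K R) (ambiskew_ideal K R \<tau> \<omega> c \<xi>)"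

definition ambiskew_coeff ::
  "('k, 'r) ring_scheme \<Rightarrow> ('k, 'a, 'm) module_scheme \<Rightarrow> ('a \<Rightarrow> 'a) \<Rightarrow> ('a \<Rightarrow> 'a) \<Rightarrow> 'a \<Rightarrow> 'k
    \<Rightarrow> 'a \<Rightarrow> ('k, 'a) adjoin_xy set" where
  "ambiskew_coeff K R \<tau> \<omega> c \<xi> r =
     ambiskew_ideal K R \<tau> \<omega> c \<xi> +>\<^bsub>adjoin_xy K R\<^esub> free_product_inl K R (free_algebra K {VarX, VarY}) r"

definition ambiskew_var ::
  "('k, 'r) ring_scheme \<Rightarrow> ('k, 'a, 'm) module_scheme \<Rightarrow> ('a \<Rightarrow> 'a) \<Rightarrow> ('a \<Rightarrow> 'a) \<Rightarrow> 'a \<Rightarrow> 'k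
    \<Rightarrow> variable \<Rightarrow> ('k, 'a) adjoin_xy set" where
  "ambiskew_var K R \<tau> \<omega> c \<xi> v =
     ambiskew_ideal K R \<tau> \<omega> c \<xi> +>\<^bsub>adjoin_xy K R\<^esub>
       free_product_inr K R (free_algebra K {VarX, VarY}) (free_gen K v)"

definition sigma_center :: "('a, 'm) ring_scheme \<Rightarrow> ('a \<Rightarrow> 'a) \<Rightarrow> 'a set" where
  "sigma_center R \<sigma> = {x \<in> carrier R. \<forall>r\<in>carrier R. x \<otimes>\<^bsub>R\<^esub> r = \<sigma> r \<otimes>\<^bsub>R\<^esub> x}"

end

(* If A = A(H,E,F,tau,omega,c,xi) is a Hopf algebra of the given form, then applying Delta to
   E r = tau(r) E, F r = omega(r) F and EF - xi FE = c gives identities in A (x) A whose components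
   can be separated, since the coefficients of 1, E and F are linear functionals of A. These functionals
   come from two Verma-type modules A/AF and A/AE rather than from a PBW basis. The components say that
   Delta(tau(r)) = tau(r1) (x) r2 = g r1 g^-1 (x) tau(r2), and likewise for omega and h; applying the
   counit on either side shows that tau and omega are winding maps for the characters eps o tau and
   eps o omega. The last relation yields xi = alpha(h) = beta(g)^-1 and Delta(c).

   Conversely Delta, eps and S are defined on A by the universal property, with eps(E) = 0 and
   S(E) = -g^-1 E as a homomorphism to the opposite algebra. The only relation that is not a direct
   computation is the one for S, which needs tau(S(tau(r))) = g S(r) g^-1. Coassociativity and the
   counit laws are equalities of algebra homomorphisms, hence need checking on generators only; the set
   where the antipode law holds is a subalgebra. *)
theory Submission
  imports Defs
begin

section \<open>Linear maps and algebra homomorphisms\<close>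

text \<open>The algebra \<open>A\<close> is given by generators and relations only. Without a normal
  form even the injectivity of \<open>H\<close> into \<open>A\<close> is unclear, and an identity in
  A \<otimes> A cannot be split into components. The universal property yields nothing but maps out
  of \<open>A\<close>, so coefficient functionals have to come from a representation:
  \<open>A\<close> acts on series in one variable over \<open>H\<close>, the other variable acting
  by a recursion that the third relation dictates. The value on the cyclic vector 1 shows the
  coefficients of 1 and of one variable only; hence two representations, exchanged by swapping E
  with F and \<xi> with its inverse. The antipode identity comes from convolution: a winding map
  \<alpha> * id is convolution invertible since \<alpha> and id are, so both sides may be compared
  after convolving with it. The antipode law passes to products because S reverses them: the sum for
  one factor stands inside the sum for the other and, being a scalar, moves out. Tensors are cosets
  of formal sums, so a Sweedler sum is the value of an induced linear map, and equalities of such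
  maps are checked on pure tensors.\<close>

lemma (in abelian_group) minus_zero_iff:
  "x \<in> carrier G \<Longrightarrow> y \<in> carrier G \<Longrightarrow> x \<ominus> y = \<zero> \<longleftrightarrow> x = y"
  using add.inv_solve_right[of \<zero> x y] by (auto simp: minus_eq)

text \<open>Shaped for \<Delta>(E)\<Delta>(F) - \<xi>\<Delta>(F)\<Delta>(E): \<open>b\<close> and
  \<open>c\<close> are the mixed terms Eh \<otimes> F and gF \<otimes> E, which the two products
  contain in opposite order, so that only the outer terms survive.\<close>

lemma (in abelian_group) minus_cross:
  assumes "a \<in> carrier G" "b \<in> carrier G" "c \<in> carrier G" "d \<in> carrier G" "a' \<in> carrier G" "d' \<in> carrier G"
  shows "a \<oplus> b \<oplus> (c \<oplus> d) \<ominus> (a' \<oplus> c \<oplus> (b \<oplus> d')) = (a \<ominus> a') \<oplus> (d \<ominus> d')"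
proof -
  have cancel: "x \<ominus> y \<oplus> y = x" if "x \<in> carrier G" "y \<in> carrier G" for x y
    using that by (simp add: minus_eq a_assoc l_neg)
  define p q where "p = a \<ominus> a'" and "q = d \<ominus> d'"
  have pq: "p \<in> carrier G" "q \<in> carrier G" using assms by (simp_all add: p_def q_def)
  have eq: "p \<oplus> a' = a" "q \<oplus> d' = d" using assms cancel by (simp_all add: p_def q_def)
  have "(p \<oplus> q) \<oplus> (a' \<oplus> c \<oplus> (b \<oplus> d')) = (p \<oplus> a') \<oplus> b \<oplus> (c \<oplus> (q \<oplus> d'))"
    using assms pq by (simp add: a_ac)
  then have *: "a \<oplus> b \<oplus> (c \<oplus> d) = (p \<oplus> q) \<oplus> (a' \<oplus> c \<oplus> (b \<oplus> d'))" unfolding eq by simp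
  have r: "x \<oplus> y \<ominus> y = x" if "x \<in> carrier G" "y \<in> carrier G" for x y
    using that by (simp add: minus_eq a_assoc r_neg)
  show ?thesis
    unfolding * p_def[symmetric] q_def[symmetric] by (rule r) (use assms pq in simp_all)
qed

lemma linear_homI:
  assumes "\<And>x. x \<in> carrier A \<Longrightarrow> f x \<in> carrier B"
    and "\<And>x y. x \<in> carrier A \<Longrightarrow> y \<in> carrier A \<Longrightarrow> f (x \<oplus>\<^bsub>A\<^esub> y) = f x \<oplus>\<^bsub>B\<^esub> f y"
    and "\<And>a x. a \<in> carrier K \<Longrightarrow> x \<in> carrier A \<Longrightarrow> f (a \<odot>\<^bsub>A\<^esub> x) = a \<odot>\<^bsub>B\<^esub> f x"
  shows "f \<in> linear_hom K A B"
  using assms by (auto simp: linear_hom_def)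

lemma linear_homD:
  assumes "f \<in> linear_hom K A B"
  shows linear_hom_closed: "x \<in> carrier A \<Longrightarrow> f x \<in> carrier B"
    and linear_hom_add: "x \<in> carrier A \<Longrightarrow> y \<in> carrier A \<Longrightarrow> f (x \<oplus>\<^bsub>A\<^esub> y) = f x \<oplus>\<^bsub>B\<^esub> f y"
    and linear_hom_smult: "a \<in> carrier K \<Longrightarrow> x \<in> carrier A \<Longrightarrow> f (a \<odot>\<^bsub>A\<^esub> x) = a \<odot>\<^bsub>B\<^esub> f x"
  using assms by (auto simp: linear_hom_def)

lemma linear_hom_zero:
  assumes "f \<in> linear_hom K A B" "module K A" "module K B"
  shows "f \<zero>\<^bsub>A\<^esub> = \<zero>\<^bsub>B\<^esub>"
proof -
  interpret A: module K A by fact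
  interpret B: module K B by fact
  have "f \<zero>\<^bsub>A\<^esub> = f (\<zero>\<^bsub>K\<^esub> \<odot>\<^bsub>A\<^esub> \<zero>\<^bsub>A\<^esub>)" by simp
  also have "\<dots> = \<zero>\<^bsub>K\<^esub> \<odot>\<^bsub>B\<^esub> f \<zero>\<^bsub>A\<^esub>" by (rule linear_hom_smult[OF assms(1)]) auto
  also have "\<dots> = \<zero>\<^bsub>B\<^esub>" using linear_hom_closed[OF assms(1), of "\<zero>\<^bsub>A\<^esub>"] by simp
  finally show ?thesis .
qed

lemma linear_hom_a_inv:
  assumes "f \<in> linear_hom K A B" "module K A" "module K B" "x \<in> carrier A"
  shows "f (\<ominus>\<^bsub>A\<^esub> x) = \<ominus>\<^bsub>B\<^esub> f x"
proof -
  interpret A: module K A by fact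
  interpret B: module K B by fact
  have "f (\<ominus>\<^bsub>A\<^esub> x) \<oplus>\<^bsub>B\<^esub> f x = f (\<ominus>\<^bsub>A\<^esub> x \<oplus>\<^bsub>A\<^esub> x)"
    using linear_hom_add[OF assms(1)] assms(4) by simp
  also have "\<dots> = \<zero>\<^bsub>B\<^esub>"
    using linear_hom_zero[OF assms(1-3)] assms(4) by (simp add: A.M.l_neg)
  finally show ?thesis
    using linear_hom_closed[OF assms(1)] assms(4) by (simp add: B.M.minus_equality)
qed

lemma linear_hom_minus:
  assumes "f \<in> linear_hom K A B" "module K A" "module K B" "x \<in> carrier A" "y \<in> carrier A"
  shows "f (x \<ominus>\<^bsub>A\<^esub> y) = f x \<ominus>\<^bsub>B\<^esub> f y"
proof -
  interpret A: module K A by fact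
  show ?thesis
    unfolding a_minus_def
    using linear_hom_add[OF assms(1,4)] linear_hom_a_inv[OF assms(1-3,5)] assms(5) by simp
qed

lemma linear_hom_cong:
  assumes "module K A" "f \<in> linear_hom K A B" "\<And>x. x \<in> carrier A \<Longrightarrow> f x = g x"
  shows "g \<in> linear_hom K A B"
proof -
  interpret A: module K A by fact
  show ?thesis
    using linear_homD[OF assms(2)] by (intro linear_homI) (auto simp flip: assms(3))
qed

lemma linear_hom_compose:
  "f \<in> linear_hom K A B \<Longrightarrow> g \<in> linear_hom K B C \<Longrightarrow> (\<lambda>x. g (f x)) \<in> linear_hom K A C"
  by (auto simp: linear_hom_def Pi_iff)

lemma linear_hom_id: "(\<lambda>x. x) \<in> linear_hom K A A"
  by (auto simp: linear_hom_def)

lemma (in module) linear_hom_add_fun: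
  assumes "f \<in> linear_hom R A M" "g \<in> linear_hom R A M"
  shows "(\<lambda>x. f x \<oplus>\<^bsub>M\<^esub> g x) \<in> linear_hom R A M"
  using linear_homD[OF assms(1)] linear_homD[OF assms(2)]
  by (intro linear_homI) (auto simp: M.a_ac smult_r_distr)

lemma (in module) linear_hom_smult_fun:
  assumes "a \<in> carrier R" "f \<in> linear_hom R A M"
  shows "(\<lambda>x. a \<odot>\<^bsub>M\<^esub> f x) \<in> linear_hom R A M"
  using linear_homD[OF assms(2)] assms(1)
  by (intro linear_homI) (auto simp: smult_r_distr smult_assoc1[symmetric] R.m_comm)

lemma (in module) linear_hom_zero_fun: "(\<lambda>x. \<zero>\<^bsub>M\<^esub>) \<in> linear_hom R A M"
  by (intro linear_homI) auto

lemma (in module) submodule_kernel: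
  assumes "f \<in> linear_hom R M N" "module R N"
  shows "submodule {x \<in> carrier M. f x = \<zero>\<^bsub>N\<^esub>} R M"
proof -
  interpret N: module R N by fact
  show ?thesis
    by (rule submoduleI)
      (use linear_homD[OF assms(1)] linear_hom_zero[OF assms(1) module_axioms assms(2)]
        linear_hom_a_inv[OF assms(1) module_axioms assms(2)] in auto)
qed

section \<open>Algebra homomorphisms and linear operators on an algebra\<close>

lemma algebra_homD:
  assumes "f \<in> algebra_hom K A B"
  shows "f \<in> ring_hom A B"
    and algebra_hom_linear: "f \<in> linear_hom K A B"
    and algebra_hom_closed: "x \<in> carrier A \<Longrightarrow> f x \<in> carrier B"
    and algebra_hom_add: "x \<in> carrier A \<Longrightarrow> y \<in> carrier A \<Longrightarrow> f (x \<oplus>\<^bsub>A\<^esub> y) = f x \<oplus>\<^bsub>B\<^esub> f y"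
    and algebra_hom_smult: "a \<in> carrier K \<Longrightarrow> x \<in> carrier A \<Longrightarrow> f (a \<odot>\<^bsub>A\<^esub> x) = a \<odot>\<^bsub>B\<^esub> f x"
    and algebra_hom_mult: "x \<in> carrier A \<Longrightarrow> y \<in> carrier A \<Longrightarrow> f (x \<otimes>\<^bsub>A\<^esub> y) = f x \<otimes>\<^bsub>B\<^esub> f y"
    and algebra_hom_one: "f \<one>\<^bsub>A\<^esub> = \<one>\<^bsub>B\<^esub>"
  using assms by (auto simp: algebra_hom_def linear_hom_def ring_hom_def)

lemma algebra_homI:
  assumes "f \<in> linear_hom K A B"
    and "\<And>x y. x \<in> carrier A \<Longrightarrow> y \<in> carrier A \<Longrightarrow> f (x \<otimes>\<^bsub>A\<^esub> y) = f x \<otimes>\<^bsub>B\<^esub> f y"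
    and "f \<one>\<^bsub>A\<^esub> = \<one>\<^bsub>B\<^esub>"
  shows "f \<in> algebra_hom K A B"
  using assms by (auto simp: algebra_hom_def linear_hom_def ring_hom_def)

lemma algebra_hom_compose:
  "f \<in> algebra_hom K A B \<Longrightarrow> g \<in> algebra_hom K B C \<Longrightarrow> (\<lambda>x. g (f x)) \<in> algebra_hom K A C"
  by (rule algebra_homI)
    (auto dest: algebra_homD intro: linear_hom_compose simp: algebra_hom_mult algebra_hom_one algebra_hom_closed)

lemma algebra_hom_id: "(\<lambda>x. x) \<in> algebra_hom K A A"
  by (rule algebra_homI) (auto intro: linear_hom_id)

lemma (in assoc_algebra) linear_hom_mult_left:
  assumes "a \<in> carrier A" "f \<in> linear_hom K B A"
  shows "(\<lambda>x. a \<otimes>\<^bsub>A\<^esub> f x) \<in> linear_hom K B A"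
  using linear_homD[OF assms(2)] assms(1)
  by (intro linear_homI) (auto simp: A.r_distr smult_mult_right)

lemma (in assoc_algebra) linear_hom_mult_right:
  assumes "a \<in> carrier A" "f \<in> linear_hom K B A"
  shows "(\<lambda>x. f x \<otimes>\<^bsub>A\<^esub> a) \<in> linear_hom K B A"
  using linear_homD[OF assms(2)] assms(1)
  by (intro linear_homI) (auto simp: A.l_distr smult_mult_left)

lemma (in assoc_algebra) linear_hom_scalar:
  assumes "f \<in> linear_hom K B (ground_algebra K)" "a \<in> carrier A"
  shows "(\<lambda>x. f x \<odot>\<^bsub>A\<^esub> a) \<in> linear_hom K B A"
  using linear_homD[OF assms(1)] assms(2)
  by (intro linear_homI) (auto simp: ground_algebra_def smult_l_distr smult_assoc1)

lemma (in module) module: "module R M" ..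

lemma (in field) ground_assoc_algebra: "assoc_algebra R (ground_algebra R)"
proof -
  have m: "module R (ground_algebra R)"
    by (rule moduleI)
      (auto simp: ground_algebra_def l_distr r_distr m_assoc a_ac is_cring intro!: abelian_groupI
        intro: bexI[of _ "\<ominus> _"] l_neg)
  then interpret m: module R "ground_algebra R" .
  have "ring (ground_algebra R)"
    by (rule ringI[OF m.M.abelian_group_axioms], rule monoidI)
      (auto simp: ground_algebra_def l_distr r_distr m_assoc)
  with m show ?thesis
    by (intro assoc_algebra.intro assoc_algebra_axioms.intro)
      (auto simp: ground_algebra_def m_ac field_axioms)
qed

lemma ground_simps [simp]:
  "carrier (ground_algebra K) = carrier K" "mult (ground_algebra K) = mult K"
  "one (ground_algebra K) = one K" "zero (ground_algebra K) = zero K"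
  "add (ground_algebra K) = add K" "smult (ground_algebra K) = mult K"
  by (auto simp: ground_algebra_def)


text \<open>Turns anti-homomorphisms into homomorphisms: the antipode of the ambiskew algebra is
  obtained as a map into this algebra, to which the universal property applies.\<close>

definition opposite_algebra :: "('k, 'a, 'm) module_scheme \<Rightarrow> ('k, 'a, 'm) module_scheme" where
  "opposite_algebra A = A\<lparr>mult := \<lambda>x y. y \<otimes>\<^bsub>A\<^esub> x\<rparr>"

lemma opposite_simps [simp]:
  "carrier (opposite_algebra A) = carrier A" "x \<otimes>\<^bsub>opposite_algebra A\<^esub> y = y \<otimes>\<^bsub>A\<^esub> x"
  "\<one>\<^bsub>opposite_algebra A\<^esub> = \<one>\<^bsub>A\<^esub>" "\<zero>\<^bsub>opposite_algebra A\<^esub> = \<zero>\<^bsub>A\<^esub>"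
  "x \<oplus>\<^bsub>opposite_algebra A\<^esub> y = x \<oplus>\<^bsub>A\<^esub> y" "a \<odot>\<^bsub>opposite_algebra A\<^esub> x = a \<odot>\<^bsub>A\<^esub> x"
  by (simp_all add: opposite_algebra_def)

lemma opposite_a_minus [simp]: "x \<ominus>\<^bsub>opposite_algebra A\<^esub> y = x \<ominus>\<^bsub>A\<^esub> y"
  by (simp add: opposite_algebra_def a_minus_def a_inv_def m_inv_def)

lemma (in assoc_algebra) opposite_assoc_algebra: "assoc_algebra K (opposite_algebra A)"
proof -
  have m: "module K (opposite_algebra A)"
    by (rule moduleI[OF R.cring_axioms abelian_groupI])
      (auto simp: M.a_ac smult_l_distr smult_r_distr smult_assoc1 intro: bexI[of _ "\<ominus>\<^bsub>A\<^esub> _"] M.l_neg)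
  have "ring (opposite_algebra A)"
    by (rule ringI[OF module.axioms(2)[OF m] monoidI]) (auto simp: A.m_assoc A.l_distr A.r_distr)
  with m show ?thesis
    by (intro assoc_algebra.intro assoc_algebra_axioms.intro K.field_axioms)
      (auto simp: smult_mult_left smult_mult_right)
qed


section \<open>Monoid algebras\<close>

locale monoid_algebra_setup = K?: field K + M?: monoid M
  for K (structure) and M (structure)
begin

abbreviation (input) "F \<equiv> monoid_algebra K M"

abbreviation "supp f \<equiv> {x. f x \<noteq> \<zero>\<^bsub>K\<^esub>}"

lemma carrier_F: "f \<in> carrier F \<longleftrightarrow> finite (supp f) \<and> supp f \<subseteq> carrier M \<and> (\<forall>x. f x \<in> carrier K)"
  by (auto simp: monoid_algebra_def)

lemma F_simps:
  "\<zero>\<^bsub>F\<^esub> = (\<lambda>x. \<zero>\<^bsub>K\<^esub>)" "f \<oplus>\<^bsub>F\<^esub> g = (\<lambda>x. f x \<oplus>\<^bsub>K\<^esub> g x)" "a \<odot>\<^bsub>F\<^esub> f = (\<lambda>x. a \<otimes>\<^bsub>K\<^esub> f x)"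
  "\<one>\<^bsub>F\<^esub> = basis_elem K \<one>\<^bsub>M\<^esub>"
  by (auto simp: monoid_algebra_def basis_elem_def)

lemma basis_closed [simp]: "x \<in> carrier M \<Longrightarrow> basis_elem K x \<in> carrier F"
  by (auto simp: carrier_F basis_elem_def)

lemma module_F: "module K F"
proof (rule moduleI)
  show "cring K" ..
  show "abelian_group F"
  proof (rule abelian_groupI)
    fix f g assume f: "f \<in> carrier F" and g: "g \<in> carrier F"
    have "supp (f \<oplus>\<^bsub>F\<^esub> g) \<subseteq> supp f \<union> supp g" using f g by (auto simp: F_simps carrier_F)
    moreover have "finite (supp f \<union> supp g)" "supp f \<union> supp g \<subseteq> carrier M"
      using f g by (auto simp: carrier_F)
    ultimately have "finite (supp (f \<oplus>\<^bsub>F\<^esub> g))" "supp (f \<oplus>\<^bsub>F\<^esub> g) \<subseteq> carrier M"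
      using finite_subset subset_trans by metis+
    then show "f \<oplus>\<^bsub>F\<^esub> g \<in> carrier F" using f g by (auto simp: F_simps carrier_F)
  next
    fix f assume f: "f \<in> carrier F"
    have "supp (\<lambda>x. \<ominus>\<^bsub>K\<^esub> f x) = supp f"
      using f K.add.inv_eq_1_iff by (auto simp: carrier_F)
    then have "(\<lambda>x. \<ominus>\<^bsub>K\<^esub> f x) \<in> carrier F"
      using f by (auto simp: carrier_F)
    moreover have "(\<lambda>x. \<ominus>\<^bsub>K\<^esub> f x) \<oplus>\<^bsub>F\<^esub> f = \<zero>\<^bsub>F\<^esub>"
      using f by (auto simp: carrier_F F_simps K.l_neg)
    ultimately show "\<exists>g\<in>carrier F. g \<oplus>\<^bsub>F\<^esub> f = \<zero>\<^bsub>F\<^esub>" by blast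
  qed (auto simp: carrier_F F_simps K.a_ac)
next
  fix a f assume a: "a \<in> carrier K" and f: "f \<in> carrier F"
  have "supp (a \<odot>\<^bsub>F\<^esub> f) \<subseteq> supp f" using a f by (auto simp: F_simps carrier_F)
  then show "a \<odot>\<^bsub>F\<^esub> f \<in> carrier F"
    using a f finite_subset by (auto simp: F_simps carrier_F)
qed (auto simp: carrier_F F_simps K.m_assoc K.l_distr K.r_distr)

sublocale F: module K "monoid_algebra K M" by (rule module_F)

text \<open>Induction on the size of the support: resetting \<open>f\<close> to zero at one support
  point splits off one scaled basis element. The extension arguments for free algebras and tensor
  products all rest on this.\<close>

lemma induct_F [consumes 1, case_names zero add]:
  assumes "f \<in> carrier F" "P \<zero>\<^bsub>F\<^esub>"
    and step: "\<And>a x f. \<lbrakk>a \<in> carrier K; x \<in> carrier M; f \<in> carrier F; P f\<rbrakk>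
      \<Longrightarrow> P (a \<odot>\<^bsub>F\<^esub> basis_elem K x \<oplus>\<^bsub>F\<^esub> f)"
  shows "P f"
  using assms(1)
proof (induction "card (supp f)" arbitrary: f)
  case 0
  then have "f = \<zero>\<^bsub>F\<^esub>" by (auto simp: carrier_F F_simps)
  with assms(2) show ?case by simp
next
  case (Suc n)
  have fin: "finite (supp f)" using Suc.prems by (simp add: carrier_F)
  have "supp f \<noteq> {}"
  proof
    assume "supp f = {}"
    then have "card (supp f) = 0" by (simp only: card.empty)
    with Suc.hyps(2) show False by simp
  qed
  then obtain x where x: "f x \<noteq> \<zero>\<^bsub>K\<^esub>" by blast
  let ?g = "f(x := \<zero>\<^bsub>K\<^esub>)"
  have s: "supp ?g = supp f - {x}" by auto
  have xM: "x \<in> carrier M" and fK: "\<And>y. f y \<in> carrier K" using Suc.prems x by (auto simp: carrier_F)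
  have "?g \<in> carrier F" using Suc.prems unfolding carrier_F s by auto
  moreover have "n = card (supp ?g)" using Suc.hyps(2) x fin unfolding s by simp
  ultimately have "P ?g" using Suc.hyps(1) by blast
  moreover have "f = f x \<odot>\<^bsub>F\<^esub> basis_elem K x \<oplus>\<^bsub>F\<^esub> ?g"
    using fK by (auto simp: F_simps basis_elem_def)
  ultimately show ?case using step[OF fK xM \<open>?g \<in> carrier F\<close>] by metis
qed

lemma linear_ext_F:
  assumes "f \<in> carrier F" "\<phi> \<in> linear_hom K F N" "\<psi> \<in> linear_hom K F N" "module K N"
    and "\<And>x. x \<in> carrier M \<Longrightarrow> \<phi> (basis_elem K x) = \<psi> (basis_elem K x)"
  shows "\<phi> f = \<psi> f"
  using assms(1)
proof (induction rule: induct_F)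
  case zero then show ?case
    using linear_hom_zero[OF assms(2) module_F assms(4)] linear_hom_zero[OF assms(3) module_F assms(4)] by simp
next
  case (add a x f)
  then show ?case
    by (simp add: linear_homD[OF assms(2)] linear_homD[OF assms(3)] assms(5))
qed

text \<open>The defining sum of the product runs over an index set that depends on both factors and
  on \<open>z\<close>. Over a fixed finite rectangle, padded with zero terms, sums for different
  factors can be compared termwise, which is how bilinearity is proved.\<close>

lemma mult_superset:
  assumes f: "f \<in> carrier F" and g: "g \<in> carrier F"
    and X: "finite X" "supp f \<subseteq> X" and Y: "finite Y" "supp g \<subseteq> Y"
  shows "f \<otimes>\<^bsub>F\<^esub> g = (\<lambda>z. finsum K (\<lambda>p. if fst p \<otimes>\<^bsub>M\<^esub> snd p = z then f (fst p) \<otimes>\<^bsub>K\<^esub> g (snd p) else \<zero>\<^bsub>K\<^esub>) (X \<times> Y))"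
proof
  fix z
  have fK: "\<And>y. f y \<in> carrier K" "\<And>y. g y \<in> carrier K" using f g by (auto simp: carrier_F)
  have "(f \<otimes>\<^bsub>F\<^esub> g) z = finsum K (\<lambda>(x, y). f x \<otimes>\<^bsub>K\<^esub> g y)
        {(x, y). f x \<noteq> \<zero>\<^bsub>K\<^esub> \<and> g y \<noteq> \<zero>\<^bsub>K\<^esub> \<and> x \<otimes>\<^bsub>M\<^esub> y = z}" (is "_ = finsum K _ ?S")
    by (simp add: monoid_algebra_def)
  also have "\<dots> = finsum K (\<lambda>p. if fst p \<otimes>\<^bsub>M\<^esub> snd p = z then f (fst p) \<otimes>\<^bsub>K\<^esub> g (snd p) else \<zero>\<^bsub>K\<^esub>) (X \<times> Y)"
    by (rule K.add.finprod_mono_neutral_cong_left) (use X Y fK in auto)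
  finally show "(f \<otimes>\<^bsub>F\<^esub> g) z = \<dots>" .
qed

lemma mult_closed_F:
  assumes f: "f \<in> carrier F" and g: "g \<in> carrier F"
  shows "f \<otimes>\<^bsub>F\<^esub> g \<in> carrier F"
proof -
  have fK: "\<And>y. f y \<in> carrier K" "\<And>y. g y \<in> carrier K" "finite (supp f)" "finite (supp g)"
    "supp f \<subseteq> carrier M" "supp g \<subseteq> carrier M" using f g by (auto simp: carrier_F)
  have eq: "f \<otimes>\<^bsub>F\<^esub> g = (\<lambda>z. finsum K (\<lambda>p. if fst p \<otimes>\<^bsub>M\<^esub> snd p = z then f (fst p) \<otimes>\<^bsub>K\<^esub> g (snd p) else \<zero>\<^bsub>K\<^esub>) (supp f \<times> supp g))"
    using fK by (intro mult_superset[OF f g]) auto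
  have "supp (f \<otimes>\<^bsub>F\<^esub> g) \<subseteq> (\<lambda>p. fst p \<otimes>\<^bsub>M\<^esub> snd p) ` (supp f \<times> supp g)"
  proof
    fix z assume z: "z \<in> supp (f \<otimes>\<^bsub>F\<^esub> g)"
    show "z \<in> (\<lambda>p. fst p \<otimes>\<^bsub>M\<^esub> snd p) ` (supp f \<times> supp g)"
    proof (rule ccontr)
      assume "\<not> ?thesis"
      then have "(f \<otimes>\<^bsub>F\<^esub> g) z = \<zero>\<^bsub>K\<^esub>"
        unfolding eq by (intro K.add.finprod_one_eqI) auto
      with z show False by simp
    qed
  qed
  moreover have "finite ((\<lambda>p. fst p \<otimes>\<^bsub>M\<^esub> snd p) ` (supp f \<times> supp g))" using fK by simp
  moreover have "(\<lambda>p. fst p \<otimes>\<^bsub>M\<^esub> snd p) ` (supp f \<times> supp g) \<subseteq> carrier M"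
    using fK by (auto intro!: M.m_closed)
  moreover have "\<And>z. (f \<otimes>\<^bsub>F\<^esub> g) z \<in> carrier K"
    unfolding eq using fK by (intro K.finsum_closed) auto
  ultimately show ?thesis unfolding carrier_F by (meson finite_subset subset_trans)
qed

lemma basis_mult:
  assumes x: "x \<in> carrier M" and y: "y \<in> carrier M"
  shows "basis_elem K x \<otimes>\<^bsub>F\<^esub> basis_elem K y = basis_elem K (x \<otimes>\<^bsub>M\<^esub> y)"
proof -
  have "basis_elem K x \<otimes>\<^bsub>F\<^esub> basis_elem K y
    = (\<lambda>z. finsum K (\<lambda>p. if fst p \<otimes>\<^bsub>M\<^esub> snd p = z then basis_elem K x (fst p) \<otimes>\<^bsub>K\<^esub> basis_elem K y (snd p) else \<zero>\<^bsub>K\<^esub>) ({x} \<times> {y}))"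
    by (rule mult_superset[OF basis_closed[OF x] basis_closed[OF y]]) (auto simp: basis_elem_def)
  also have "\<dots> = basis_elem K (x \<otimes>\<^bsub>M\<^esub> y)"
    by (auto simp: fun_eq_iff basis_elem_def K.finsum_insert)
  finally show ?thesis .
qed

lemma mult_linear_left:
  assumes g: "g \<in> carrier F"
  shows "(\<lambda>f. f \<otimes>\<^bsub>F\<^esub> g) \<in> linear_hom K F F"
proof (rule linear_homI)
  fix f f' assume f: "f \<in> carrier F" and f': "f' \<in> carrier F"
  let ?X = "supp f \<union> supp f'"
  have s: "supp (f \<oplus>\<^bsub>F\<^esub> f') \<subseteq> ?X" using f f' by (auto simp: F_simps carrier_F)
  have fin: "finite ?X" "finite (supp g)" using f f' g by (auto simp: carrier_F)
  have cl: "\<And>y. f y \<in> carrier K" "\<And>y. f' y \<in> carrier K" "\<And>y. g y \<in> carrier K" using f f' g by (auto simp: carrier_F)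
  note m = mult_superset[OF _ g fin(1) _ fin(2) order_refl]
  show "(f \<oplus>\<^bsub>F\<^esub> f') \<otimes>\<^bsub>F\<^esub> g = f \<otimes>\<^bsub>F\<^esub> g \<oplus>\<^bsub>F\<^esub> f' \<otimes>\<^bsub>F\<^esub> g"
    unfolding m[OF F.M.add.m_closed[OF f f'] s] m[OF f Un_upper1] m[OF f' Un_upper2]
    unfolding F_simps
    by (rule ext, rule trans[OF _ K.finsum_addf], rule K.finsum_cong')
       (auto simp: cl K.l_distr)
next
  fix a f assume a: "a \<in> carrier K" and f: "f \<in> carrier F"
  have s: "supp (a \<odot>\<^bsub>F\<^esub> f) \<subseteq> supp f" using a f by (auto simp: F_simps carrier_F)
  have fin: "finite (supp f)" "finite (supp g)" using f g by (auto simp: carrier_F)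
  have cl: "\<And>y. f y \<in> carrier K" "\<And>y. g y \<in> carrier K" using f g by (auto simp: carrier_F)
  note m = mult_superset[OF _ g fin(1) _ fin(2) order_refl]
  show "(a \<odot>\<^bsub>F\<^esub> f) \<otimes>\<^bsub>F\<^esub> g = a \<odot>\<^bsub>F\<^esub> (f \<otimes>\<^bsub>F\<^esub> g)"
    unfolding m[OF F.smult_closed[OF a f] s] m[OF f order_refl] unfolding F_simps
    by (rule ext, subst K.finsum_rdistr)
       (auto simp: cl a fin K.m_assoc intro!: K.finsum_cong')
qed (simp add: mult_closed_F g)

lemma mult_linear_right:
  assumes g: "g \<in> carrier F"
  shows "(\<lambda>f. g \<otimes>\<^bsub>F\<^esub> f) \<in> linear_hom K F F"
proof (rule linear_homI)
  fix f f' assume f: "f \<in> carrier F" and f': "f' \<in> carrier F"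
  let ?X = "supp f \<union> supp f'"
  have s: "supp (f \<oplus>\<^bsub>F\<^esub> f') \<subseteq> ?X" using f f' by (auto simp: F_simps carrier_F)
  have fin: "finite ?X" "finite (supp g)" using f f' g by (auto simp: carrier_F)
  have cl: "\<And>y. f y \<in> carrier K" "\<And>y. f' y \<in> carrier K" "\<And>y. g y \<in> carrier K" using f f' g by (auto simp: carrier_F)
  note m = mult_superset[OF g _ fin(2) order_refl fin(1)]
  show "g \<otimes>\<^bsub>F\<^esub> (f \<oplus>\<^bsub>F\<^esub> f') = g \<otimes>\<^bsub>F\<^esub> f \<oplus>\<^bsub>F\<^esub> g \<otimes>\<^bsub>F\<^esub> f'"
    unfolding m[OF F.M.add.m_closed[OF f f'] s] m[OF f Un_upper1] m[OF f' Un_upper2]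
    unfolding F_simps
    by (rule ext, rule trans[OF _ K.finsum_addf], rule K.finsum_cong')
       (auto simp: cl K.r_distr)
next
  fix a f assume a: "a \<in> carrier K" and f: "f \<in> carrier F"
  have s: "supp (a \<odot>\<^bsub>F\<^esub> f) \<subseteq> supp f" using a f by (auto simp: F_simps carrier_F)
  have fin: "finite (supp f)" "finite (supp g)" using f g by (auto simp: carrier_F)
  have cl: "\<And>y. f y \<in> carrier K" "\<And>y. g y \<in> carrier K" using f g by (auto simp: carrier_F)
  note m = mult_superset[OF g _ fin(2) order_refl fin(1)]
  show "g \<otimes>\<^bsub>F\<^esub> (a \<odot>\<^bsub>F\<^esub> f) = a \<odot>\<^bsub>F\<^esub> (g \<otimes>\<^bsub>F\<^esub> f)"
    unfolding m[OF F.smult_closed[OF a f] s] m[OF f order_refl] unfolding F_simps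
    by (rule ext, subst K.finsum_rdistr)
       (auto simp: cl a fin K.m_ac intro!: K.finsum_cong')
qed (simp add: mult_closed_F g)

text \<open>Both sides are linear in each factor, so the factors are freed from being basis elements
  one at a time: the last one in \<open>1\<close>, the middle one in \<open>2\<close>, the first one
  at the end. On basis elements the claim is associativity of the monoid.\<close>

lemma mult_assoc_F:
  assumes f: "f \<in> carrier F" and g: "g \<in> carrier F" and h: "h \<in> carrier F"
  shows "(f \<otimes>\<^bsub>F\<^esub> g) \<otimes>\<^bsub>F\<^esub> h = f \<otimes>\<^bsub>F\<^esub> (g \<otimes>\<^bsub>F\<^esub> h)"
proof -
  note lin = linear_hom_compose[OF mult_linear_left mult_linear_left]
    linear_hom_compose[OF mult_linear_right mult_linear_right]
    linear_hom_compose[OF mult_linear_left mult_linear_right]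
    linear_hom_compose[OF mult_linear_right mult_linear_left]
    mult_linear_left mult_linear_right
  note cl = basis_closed mult_closed_F M.m_closed
  have 1: "(basis_elem K x \<otimes>\<^bsub>F\<^esub> basis_elem K y) \<otimes>\<^bsub>F\<^esub> h = basis_elem K x \<otimes>\<^bsub>F\<^esub> (basis_elem K y \<otimes>\<^bsub>F\<^esub> h)"
    if "x \<in> carrier M" "y \<in> carrier M" for x y
    by (rule linear_ext_F[OF h _ _ module_F]) (use that in \<open>auto intro: lin cl simp: basis_mult M.m_assoc\<close>)
  have 2: "(basis_elem K x \<otimes>\<^bsub>F\<^esub> g) \<otimes>\<^bsub>F\<^esub> h = basis_elem K x \<otimes>\<^bsub>F\<^esub> (g \<otimes>\<^bsub>F\<^esub> h)"
    if "x \<in> carrier M" for x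
    by (rule linear_ext_F[OF g _ _ module_F]) (use that h in \<open>auto intro: lin cl simp: 1\<close>)
  show ?thesis
    by (rule linear_ext_F[OF f _ _ module_F]) (use g h in \<open>auto intro: lin cl simp: 2\<close>)
qed

lemma assoc_algebra_F: "assoc_algebra K F"
proof -
  have one_left: "\<one>\<^bsub>F\<^esub> \<otimes>\<^bsub>F\<^esub> f = f" if f: "f \<in> carrier F" for f
    unfolding F_simps(4)
    by (rule linear_ext_F[OF f mult_linear_right linear_hom_id module_F]) (simp_all add: basis_mult)
  have one_right: "f \<otimes>\<^bsub>F\<^esub> \<one>\<^bsub>F\<^esub> = f" if f: "f \<in> carrier F" for f
    unfolding F_simps(4)
    by (rule linear_ext_F[OF f mult_linear_left linear_hom_id module_F]) (simp_all add: basis_mult)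
  have "monoid F"
    by (rule monoidI) (auto simp: mult_closed_F mult_assoc_F one_left one_right, simp add: F_simps(4))
  then have "ring F"
    by (intro ringI F.M.abelian_group_axioms)
      (auto simp: linear_hom_add[OF mult_linear_left] linear_hom_add[OF mult_linear_right])
  then show ?thesis
    by (intro assoc_algebra.intro assoc_algebra_axioms.intro module_F)
      (auto simp: linear_hom_smult[OF mult_linear_left] linear_hom_smult[OF mult_linear_right] K.field_axioms)
qed

sublocale F: assoc_algebra K "monoid_algebra K M" by (rule assoc_algebra_F)

text \<open>Same device as for the product: a common finite index set lets the extensions of two
  elements be added termwise.\<close>

lemma linear_extension_superset:
  assumes "module K N" "\<phi> \<in> carrier M \<rightarrow> carrier N" "f \<in> carrier F" "finite X" "supp f \<subseteq> X" "X \<subseteq> carrier M"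
  shows "linear_extension K N \<phi> f = finsum N (\<lambda>x. f x \<odot>\<^bsub>N\<^esub> \<phi> x) X"
proof -
  interpret N: module K N by fact
  have cl: "f x \<in> carrier K" for x using assms(3) by (auto simp: carrier_F)
  have cN: "\<phi> x \<in> carrier N" if "x \<in> X" for x using that assms by auto
  show ?thesis
    unfolding linear_extension_def
    by (rule N.M.add.finprod_mono_neutral_cong_left) (use assms cl cN in auto)
qed

lemma linear_extension_linear:
  assumes "module K N" "\<phi> \<in> carrier M \<rightarrow> carrier N"
  shows "linear_extension K N \<phi> \<in> linear_hom K F N"
proof -
  interpret N: module K N by fact
  note sup = linear_extension_superset[OF assms]
  show ?thesis
  proof (rule linear_homI)
    fix f assume f: "f \<in> carrier F"
    have "(\<lambda>x. f x \<odot>\<^bsub>N\<^esub> \<phi> x) \<in> supp f \<rightarrow> carrier N" using f assms by (auto simp: carrier_F)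
    then show "linear_extension K N \<phi> f \<in> carrier N"
      unfolding linear_extension_def by (rule N.M.finsum_closed)
  next
    fix f f' assume f: "f \<in> carrier F" and f': "f' \<in> carrier F"
    let ?X = "supp f \<union> supp f'"
    have s: "supp (f \<oplus>\<^bsub>F\<^esub> f') \<subseteq> ?X" using f f' by (auto simp: F_simps carrier_F)
    have fin: "finite ?X" "?X \<subseteq> carrier M" using f f' by (auto simp: carrier_F)
    have cl: "\<And>y. f y \<in> carrier K" "\<And>y. f' y \<in> carrier K" "\<And>y. y \<in> ?X \<Longrightarrow> \<phi> y \<in> carrier N"
      using f f' assms(2) by (auto simp: carrier_F)
    show "linear_extension K N \<phi> (f \<oplus>\<^bsub>F\<^esub> f') = linear_extension K N \<phi> f \<oplus>\<^bsub>N\<^esub> linear_extension K N \<phi> f'"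
      unfolding sup[OF F.M.add.m_closed[OF f f'] fin(1) s fin(2)]
        sup[OF f fin(1) Un_upper1 fin(2)] sup[OF f' fin(1) Un_upper2 fin(2)]
      using cl by (intro trans[OF _ N.M.finsum_addf] N.M.finsum_cong')
        (auto simp: F_simps N.smult_l_distr)
  next
    fix a f assume a: "a \<in> carrier K" and f: "f \<in> carrier F"
    have s: "supp (a \<odot>\<^bsub>F\<^esub> f) \<subseteq> supp f" using a f by (auto simp: F_simps carrier_F)
    have fin: "finite (supp f)" "supp f \<subseteq> carrier M" using f by (auto simp: carrier_F)
    have cl: "\<And>y. f y \<in> carrier K" "\<And>y. y \<in> supp f \<Longrightarrow> \<phi> y \<in> carrier N"
      using f assms(2) by (auto simp: carrier_F)
    show "linear_extension K N \<phi> (a \<odot>\<^bsub>F\<^esub> f) = a \<odot>\<^bsub>N\<^esub> linear_extension K N \<phi> f"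
      unfolding sup[OF F.smult_closed[OF a f] fin(1) s fin(2)]
        sup[OF f fin(1) order_refl fin(2)]
      using a cl fin by (subst N.finsum_smult_ldistr)
        (auto simp: F_simps N.smult_assoc1 intro!: N.M.finsum_cong')
  qed
qed

lemma linear_extension_basis:
  assumes "module K N" "\<phi> \<in> carrier M \<rightarrow> carrier N" "x \<in> carrier M"
  shows "linear_extension K N \<phi> (basis_elem K x) = \<phi> x"
proof -
  interpret N: module K N by fact
  have "\<phi> x \<in> carrier N" using assms by auto
  moreover have "linear_extension K N \<phi> (basis_elem K x) = finsum N (\<lambda>y. basis_elem K x y \<odot>\<^bsub>N\<^esub> \<phi> y) {x}"
    by (rule linear_extension_superset[OF assms(1,2) basis_closed[OF assms(3)]]) (use assms(3) in \<open>auto simp: basis_elem_def\<close>)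
  ultimately show ?thesis by (simp add: basis_elem_def N.M.finsum_insert)
qed

text \<open>Both sides of the product rule are bilinear, so multiplicativity on the monoid suffices;
  \<open>1\<close> handles a basis element on the left, the conclusion an arbitrary left
  factor.\<close>

lemma linear_extension_hom:
  assumes "assoc_algebra K B" "\<phi> \<in> carrier M \<rightarrow> carrier B"
    and mult: "\<And>x y. x \<in> carrier M \<Longrightarrow> y \<in> carrier M \<Longrightarrow> \<phi> (x \<otimes>\<^bsub>M\<^esub> y) = \<phi> x \<otimes>\<^bsub>B\<^esub> \<phi> y"
    and one: "\<phi> \<one>\<^bsub>M\<^esub> = \<one>\<^bsub>B\<^esub>"
  shows "linear_extension K B \<phi> \<in> algebra_hom K F B"
proof -
  interpret B: assoc_algebra K B by fact
  note lin = linear_extension_linear[OF B.module_axioms assms(2)]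
  note bas = linear_extension_basis[OF B.module_axioms assms(2)]
  let ?L = "linear_extension K B \<phi>"
  have 1: "?L (basis_elem K x \<otimes>\<^bsub>F\<^esub> g) = ?L (basis_elem K x) \<otimes>\<^bsub>B\<^esub> ?L g" if "x \<in> carrier M" "g \<in> carrier F" for x g
    by (rule linear_ext_F[OF that(2) linear_hom_compose[OF mult_linear_right lin] B.linear_hom_mult_left[OF _ lin] B.module_axioms])
      (use that assms(2) in \<open>auto simp: basis_mult bas mult linear_hom_closed[OF lin] Pi_iff\<close>)
  show ?thesis
  proof (rule algebra_homI[OF lin])
    fix f g assume f: "f \<in> carrier F" and g: "g \<in> carrier F"
    show "?L (f \<otimes>\<^bsub>F\<^esub> g) = ?L f \<otimes>\<^bsub>B\<^esub> ?L g"
      by (rule linear_ext_F[OF f linear_hom_compose[OF mult_linear_left lin] B.linear_hom_mult_right[OF _ lin] B.module_axioms])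
        (use g in \<open>auto simp: 1 linear_hom_closed[OF lin]\<close>)
  qed (simp add: F_simps bas one)
qed

end


section \<open>Quotient algebras\<close>

text \<open>\<open>A Quot I\<close> is a ring record and \<open>quotient_algebra A I\<close> a
  module record with the same ring operations; the ring axioms pass from one to the other in this
  way.\<close>

lemma ring_transfer:
  assumes "ring R" and "carrier S = carrier R" "mult S = mult R" "one S = one R" "zero S = zero R" "add S = add R"
  shows "ring S"
proof -
  interpret R: ring R by fact
  show ?thesis
    by (intro ringI abelian_groupI monoidI)
      (auto simp: assms R.a_ac R.m_assoc R.l_distr R.r_distr intro: bexI[of _ "\<ominus>\<^bsub>R\<^esub> _"] R.l_neg)
qed

locale algebra_ideal = assoc_algebra K A + ideal I A
  for K (structure) and A (structure) and I
begin

abbreviation "Q \<equiv> quotient_algebra A I"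

text \<open>Scaling by \<open>a\<close> is multiplication by \<open>a \<odot> \<one>\<close>, so a
  ring ideal is automatically a subspace.\<close>

lemma smult_in_I: "a \<in> carrier K \<Longrightarrow> x \<in> I \<Longrightarrow> a \<odot>\<^bsub>A\<^esub> x \<in> I"
proof -
  assume a: "a \<in> carrier K" and x: "x \<in> I"
  have xA: "x \<in> carrier A" using x by (rule Icarr)
  have "a \<odot>\<^bsub>A\<^esub> x = (a \<odot>\<^bsub>A\<^esub> \<one>\<^bsub>A\<^esub>) \<otimes>\<^bsub>A\<^esub> x" using a xA by (simp add: smult_mult_left)
  then show ?thesis using a x by (simp add: I_l_closed)
qed

lemma quotient_carrier: "carrier Q = (\<lambda>x. I +>\<^bsub>A\<^esub> x) ` carrier A"
  by (auto simp: quotient_algebra_def FactRing_simps)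

lemma quotient_closed [simp]: "x \<in> carrier A \<Longrightarrow> I +>\<^bsub>A\<^esub> x \<in> carrier Q"
  by (simp add: quotient_carrier)

lemma coset_eq_iff:
  "x \<in> carrier A \<Longrightarrow> y \<in> carrier A \<Longrightarrow> I +>\<^bsub>A\<^esub> x = I +>\<^bsub>A\<^esub> y \<longleftrightarrow> x \<ominus>\<^bsub>A\<^esub> y \<in> I"
  using A.quotient_eq_iff_same_a_r_cos[OF is_ideal] by simp

lemma mem_coset_iff: "x \<in> carrier A \<Longrightarrow> y \<in> I +>\<^bsub>A\<^esub> x \<longleftrightarrow> y \<in> carrier A \<and> I +>\<^bsub>A\<^esub> y = I +>\<^bsub>A\<^esub> x"
  using a_repr_independence' a_rcos_self a_elemrcos_carrier by (metis)

lemma quotient_ops: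
  assumes "x \<in> carrier A" "y \<in> carrier A"
  shows quotient_mult: "(I +>\<^bsub>A\<^esub> x) \<otimes>\<^bsub>Q\<^esub> (I +>\<^bsub>A\<^esub> y) = I +>\<^bsub>A\<^esub> (x \<otimes>\<^bsub>A\<^esub> y)"
    and quotient_add: "(I +>\<^bsub>A\<^esub> x) \<oplus>\<^bsub>Q\<^esub> (I +>\<^bsub>A\<^esub> y) = I +>\<^bsub>A\<^esub> (x \<oplus>\<^bsub>A\<^esub> y)"
  using rcoset_mult_add[OF assms] a_rcos_sum[OF assms]
  by (auto simp: quotient_algebra_def FactRing_def)

lemma quotient_one: "\<one>\<^bsub>Q\<^esub> = I +>\<^bsub>A\<^esub> \<one>\<^bsub>A\<^esub>"
  by (simp add: quotient_algebra_def FactRing_def)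

text \<open>The scalar action on cosets is encoded as a union over representatives. Two
  representatives differ by an element of \<open>I\<close>, which stays in \<open>I\<close> after
  scaling, so all members of the union are one and the same coset.\<close>

lemma quotient_smult:
  assumes "a \<in> carrier K" "x \<in> carrier A"
  shows "a \<odot>\<^bsub>Q\<^esub> (I +>\<^bsub>A\<^esub> x) = I +>\<^bsub>A\<^esub> (a \<odot>\<^bsub>A\<^esub> x)"
proof -
  have "I +>\<^bsub>A\<^esub> (a \<odot>\<^bsub>A\<^esub> y) = I +>\<^bsub>A\<^esub> (a \<odot>\<^bsub>A\<^esub> x)" if y: "y \<in> I +>\<^bsub>A\<^esub> x" for y
  proof -
    have yA: "y \<in> carrier A" and "y \<ominus>\<^bsub>A\<^esub> x \<in> I"
      using y assms mem_coset_iff coset_eq_iff by auto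
    then have "a \<odot>\<^bsub>A\<^esub> (y \<ominus>\<^bsub>A\<^esub> x) \<in> I" using assms smult_in_I by blast
    then have "a \<odot>\<^bsub>A\<^esub> y \<ominus>\<^bsub>A\<^esub> a \<odot>\<^bsub>A\<^esub> x \<in> I"
      using assms yA by (simp add: a_minus_def smult_r_distr smult_r_minus)
    then show ?thesis using assms yA coset_eq_iff by simp
  qed
  moreover have "x \<in> I +>\<^bsub>A\<^esub> x" using assms a_rcos_self by simp
  ultimately have "(\<Union>y\<in>I +>\<^bsub>A\<^esub> x. I +>\<^bsub>A\<^esub> (a \<odot>\<^bsub>A\<^esub> y)) = I +>\<^bsub>A\<^esub> (a \<odot>\<^bsub>A\<^esub> x)" by blast
  then show ?thesis by (simp add: quotient_algebra_def)
qed

lemma quotient_assoc_algebra: "assoc_algebra K Q"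
proof -
  have r: "ring Q"
    by (rule ring_transfer[OF quotient_is_ring]) (auto simp: quotient_algebra_def)
  interpret Q: ring Q by fact
  show ?thesis
    by (intro assoc_algebra.intro assoc_algebra_axioms.intro moduleI r Q.abelian_group_axioms R.cring_axioms K.field_axioms)
      (auto simp: quotient_carrier quotient_smult quotient_add quotient_mult smult_l_distr smult_r_distr
        smult_assoc1 smult_mult_left smult_mult_right)
qed

sublocale Q: assoc_algebra K Q by (rule quotient_assoc_algebra)

lemma projection_hom: "(\<lambda>x. I +>\<^bsub>A\<^esub> x) \<in> algebra_hom K A Q"
  by (intro algebra_homI linear_homI)
    (auto simp: quotient_mult quotient_add quotient_one quotient_smult)

text \<open>A linear map that vanishes on the ideal is constant on cosets, so the image of a coset
  is a singleton and \<open>the_elem\<close> reads off the induced map without a choice of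
  representative.\<close>

lemma quotient_lift_eq:
  assumes "f \<in> linear_hom K A N" "module K N" "\<And>x. x \<in> I \<Longrightarrow> f x = \<zero>\<^bsub>N\<^esub>" "x \<in> carrier A"
  shows "the_elem (f ` (I +>\<^bsub>A\<^esub> x)) = f x"
proof -
  interpret N: module K N by fact
  have "f y = f x" if "y \<in> I +>\<^bsub>A\<^esub> x" for y
  proof -
    have y: "y \<in> carrier A" "y \<ominus>\<^bsub>A\<^esub> x \<in> I"
      using that assms(4) mem_coset_iff coset_eq_iff by auto
    then have "f y \<ominus>\<^bsub>N\<^esub> f x = \<zero>\<^bsub>N\<^esub>"
      using assms(3) linear_hom_minus[OF assms(1) module_axioms assms(2) _ assms(4)] by metis
    then show ?thesis using linear_hom_closed[OF assms(1)] y(1) assms(4) by (simp add: N.M.minus_zero_iff)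
  qed
  moreover have "x \<in> I +>\<^bsub>A\<^esub> x" using assms a_rcos_self by simp
  ultimately have "f ` (I +>\<^bsub>A\<^esub> x) = {f x}" by blast
  then show ?thesis by simp
qed

lemma quotient_lift_linear:
  assumes "f \<in> linear_hom K A N" "module K N" "\<And>x. x \<in> I \<Longrightarrow> f x = \<zero>\<^bsub>N\<^esub>"
  shows "(\<lambda>U. the_elem (f ` U)) \<in> linear_hom K Q N"
  by (rule linear_homI)
    (auto simp: quotient_carrier quotient_add quotient_smult quotient_lift_eq[OF assms] linear_homD[OF assms(1)])

lemma quotient_lift_hom:
  assumes "f \<in> algebra_hom K A B" "assoc_algebra K B" "\<And>x. x \<in> I \<Longrightarrow> f x = \<zero>\<^bsub>B\<^esub>"
  shows "(\<lambda>U. the_elem (f ` U)) \<in> algebra_hom K Q B"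
proof -
  interpret B: assoc_algebra K B by fact
  note lin = algebra_hom_linear[OF assms(1)] B.module_axioms assms(3)
  show ?thesis
    by (intro algebra_homI quotient_lift_linear[OF lin])
      (auto simp: quotient_carrier quotient_mult quotient_one quotient_lift_eq[OF lin] algebra_homD[OF assms(1)])
qed

end

lemma (in assoc_algebra) algebra_ideal_genideal:
  "S \<subseteq> carrier A \<Longrightarrow> algebra_ideal K A (genideal A S)"
  by (intro algebra_ideal.intro A.genideal_ideal assoc_algebra_axioms)

lemma kernel_ideal:
  assumes "f \<in> algebra_hom K A B" "assoc_algebra K A" "assoc_algebra K B"
  shows "ideal {x \<in> carrier A. f x = \<zero>\<^bsub>B\<^esub>} A"
proof -
  interpret A: assoc_algebra K A by fact
  interpret B: assoc_algebra K B by fact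
  have "submodule {x \<in> carrier A. f x = \<zero>\<^bsub>B\<^esub>} K A"
    by (rule A.submodule_kernel[OF algebra_hom_linear[OF assms(1)] B.module_axioms])
  then show ?thesis
    by (intro idealI) (auto simp: submodule_def A.ring_axioms algebra_homD[OF assms(1)])
qed

text \<open>The kernel is an ideal, so killing the generators is enough. This is what makes maps
  descend to algebras given by relations.\<close>

lemma genideal_vanish:
  assumes "f \<in> algebra_hom K A B" "assoc_algebra K A" "assoc_algebra K B"
    and "S \<subseteq> carrier A" "\<And>x. x \<in> S \<Longrightarrow> f x = \<zero>\<^bsub>B\<^esub>" and "x \<in> genideal A S"
  shows "f x = \<zero>\<^bsub>B\<^esub>"
proof -
  interpret A: assoc_algebra K A by fact
  have "genideal A S \<subseteq> {x \<in> carrier A. f x = \<zero>\<^bsub>B\<^esub>}"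
    by (rule A.genideal_minimal[OF kernel_ideal[OF assms(1-3)]]) (use assms in auto)
  with assms(6) show ?thesis by auto
qed

section \<open>Tensor products of algebras\<close>

lemma (in module) linear_span_submodule:
  assumes "S \<subseteq> carrier M"
  shows "submodule (linear_span R M S) R M" and "S \<subseteq> linear_span R M S"
proof -
  have car: "submodule (carrier M) R M" by (rule carrier_is_submodule)
  show "S \<subseteq> linear_span R M S" by (auto simp: linear_span_def)
  show "submodule (linear_span R M S) R M"
  proof (rule submoduleI)
    show "linear_span R M S \<subseteq> carrier M"
      using car assms by (auto simp: linear_span_def)
    show "\<zero>\<^bsub>M\<^esub> \<in> linear_span R M S"
      using submoduleE(5)[of _ "\<zero>\<^bsub>M\<^esub>" "\<zero>\<^bsub>M\<^esub>"]
      by (auto simp: linear_span_def submodule_def dest: subgroup.one_closed)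
  qed (auto simp: linear_span_def intro: submoduleE(3-5))
qed

lemma linear_span_minimal:
  "submodule N K M \<Longrightarrow> S \<subseteq> N \<Longrightarrow> linear_span K M S \<subseteq> N"
  by (auto simp: linear_span_def)

definition bilinear_map ::
  "('k, 'r) ring_scheme \<Rightarrow> ('k, 'a, 'm) module_scheme \<Rightarrow> ('k, 'b, 'n) module_scheme
    \<Rightarrow> ('k, 'c, 'l) module_scheme \<Rightarrow> ('a \<Rightarrow> 'b \<Rightarrow> 'c) \<Rightarrow> bool" where
  "bilinear_map K A B M \<phi> \<longleftrightarrow> (\<forall>y\<in>carrier B. (\<lambda>x. \<phi> x y) \<in> linear_hom K A M) \<and>
     (\<forall>x\<in>carrier A. (\<lambda>y. \<phi> x y) \<in> linear_hom K B M)"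

lemma bilinear_mapI:
  assumes "\<And>y. y \<in> carrier B \<Longrightarrow> (\<lambda>x. \<phi> x y) \<in> linear_hom K A M"
    and "\<And>x. x \<in> carrier A \<Longrightarrow> (\<lambda>y. \<phi> x y) \<in> linear_hom K B M"
  shows "bilinear_map K A B M \<phi>"
  using assms by (auto simp: bilinear_map_def)

lemma bilinear_mapD:
  assumes "bilinear_map K A B M \<phi>"
  shows bilinear_left: "y \<in> carrier B \<Longrightarrow> (\<lambda>x. \<phi> x y) \<in> linear_hom K A M"
    and bilinear_right: "x \<in> carrier A \<Longrightarrow> (\<lambda>y. \<phi> x y) \<in> linear_hom K B M"
  using assms by (auto simp: bilinear_map_def)

lemma bilinear_closed:
  "bilinear_map K A B M \<phi> \<Longrightarrow> x \<in> carrier A \<Longrightarrow> y \<in> carrier B \<Longrightarrow> \<phi> x y \<in> carrier M"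
  by (rule linear_hom_closed[OF bilinear_left])

lemma bilinear_compose:
  "bilinear_map K A B M \<phi> \<Longrightarrow> L \<in> linear_hom K M N \<Longrightarrow> bilinear_map K A B N (\<lambda>x y. L (\<phi> x y))"
  by (rule bilinear_mapI) (rule linear_hom_compose[OF bilinear_left] linear_hom_compose[OF bilinear_right]; assumption)+

lemma bilinear_precompose:
  assumes "bilinear_map K C D M \<phi>" "f \<in> linear_hom K A C" "g \<in> linear_hom K B D"
  shows "bilinear_map K A B M (\<lambda>x y. \<phi> (f x) (g y))"
proof (rule bilinear_mapI)
  show "(\<lambda>x. \<phi> (f x) (g y)) \<in> linear_hom K A M" if "y \<in> carrier B" for y
    by (rule linear_hom_compose[OF assms(2) bilinear_left[OF assms(1) linear_hom_closed[OF assms(3) that]]])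
  show "(\<lambda>y. \<phi> (f x) (g y)) \<in> linear_hom K B M" if "x \<in> carrier A" for x
    by (rule linear_hom_compose[OF assms(3) bilinear_right[OF assms(1) linear_hom_closed[OF assms(2) that]]])
qed

lemma bilinear_cong:
  assumes "module K A" "module K B" "bilinear_map K A B M \<phi>"
    and "\<And>x y. x \<in> carrier A \<Longrightarrow> y \<in> carrier B \<Longrightarrow> \<phi> x y = \<psi> x y"
  shows "bilinear_map K A B M \<psi>"
proof (rule bilinear_mapI)
  show "(\<lambda>x. \<psi> x y) \<in> linear_hom K A M" if "y \<in> carrier B" for y
    by (rule linear_hom_cong[OF assms(1) bilinear_left[OF assms(3) that]]) (simp add: assms(4) that)
  show "(\<lambda>y. \<psi> x y) \<in> linear_hom K B M" if "x \<in> carrier A" for x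
    by (rule linear_hom_cong[OF assms(2) bilinear_right[OF assms(3) that]]) (simp add: assms(4) that)
qed

section \<open>The tensor product as a quotient of the monoid algebra of pairs\<close>

locale tensor_construction = A: assoc_algebra K A + B: assoc_algebra K B for K and A and B
begin

abbreviation (input) "F \<equiv> monoid_algebra K (A \<times>\<times> B)"
abbreviation (input) "T \<equiv> tensor_algebra K A B"
abbreviation (input) "J \<equiv> tensor_kernel K A B"
abbreviation (input) "\<delta> \<equiv> basis_elem K"

sublocale F: monoid_algebra_setup K "A \<times>\<times> B"
  by (intro monoid_algebra_setup.intro A.K.field_axioms DirProd_monoid A.A.monoid_axioms B.A.monoid_axioms)

lemma relations_closed: "bilinear_relations K A B \<subseteq> carrier F"
  by (auto simp: bilinear_relations_def Let_def)

lemma submodule_J: "submodule J K F"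
  unfolding tensor_kernel_def by (rule F.F.linear_span_submodule[OF relations_closed])

lemma relations_J: "bilinear_relations K A B \<subseteq> J"
  unfolding tensor_kernel_def by (rule F.F.linear_span_submodule[OF relations_closed])

lemma J_minimal: "submodule N K F \<Longrightarrow> bilinear_relations K A B \<subseteq> N \<Longrightarrow> J \<subseteq> N"
  unfolding tensor_kernel_def by (rule linear_span_minimal)

lemma relationsE:
  assumes "r \<in> bilinear_relations K A B"
  obtains
    (addl) x x' y where "x \<in> carrier A" "x' \<in> carrier A" "y \<in> carrier B"
      "r = \<delta> (x \<oplus>\<^bsub>A\<^esub> x', y) \<ominus>\<^bsub>F\<^esub> (\<delta> (x, y) \<oplus>\<^bsub>F\<^esub> \<delta> (x', y))"
  | (addr) x y y' where "x \<in> carrier A" "y \<in> carrier B" "y' \<in> carrier B"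
      "r = \<delta> (x, y \<oplus>\<^bsub>B\<^esub> y') \<ominus>\<^bsub>F\<^esub> (\<delta> (x, y) \<oplus>\<^bsub>F\<^esub> \<delta> (x, y'))"
  | (smultl) a x y where "a \<in> carrier K" "x \<in> carrier A" "y \<in> carrier B"
      "r = \<delta> (a \<odot>\<^bsub>A\<^esub> x, y) \<ominus>\<^bsub>F\<^esub> (a \<odot>\<^bsub>F\<^esub> \<delta> (x, y))"
  | (smultr) a x y where "a \<in> carrier K" "x \<in> carrier A" "y \<in> carrier B"
      "r = \<delta> (x, a \<odot>\<^bsub>B\<^esub> y) \<ominus>\<^bsub>F\<^esub> (a \<odot>\<^bsub>F\<^esub> \<delta> (x, y))"
  using assms unfolding bilinear_relations_def Let_def
  apply (elim UnE CollectE exE conjE)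
     apply (rule addl; assumption)
    apply (rule addr; assumption)
   apply (rule smultl; assumption)
  apply (rule smultr; assumption)
  done

lemma relationsI:
  shows "x \<in> carrier A \<Longrightarrow> x' \<in> carrier A \<Longrightarrow> y \<in> carrier B \<Longrightarrow>
      \<delta> (x \<oplus>\<^bsub>A\<^esub> x', y) \<ominus>\<^bsub>F\<^esub> (\<delta> (x, y) \<oplus>\<^bsub>F\<^esub> \<delta> (x', y)) \<in> J"
    and "x \<in> carrier A \<Longrightarrow> y \<in> carrier B \<Longrightarrow> y' \<in> carrier B \<Longrightarrow>
      \<delta> (x, y \<oplus>\<^bsub>B\<^esub> y') \<ominus>\<^bsub>F\<^esub> (\<delta> (x, y) \<oplus>\<^bsub>F\<^esub> \<delta> (x, y')) \<in> J"
    and "a \<in> carrier K \<Longrightarrow> x \<in> carrier A \<Longrightarrow> y \<in> carrier B \<Longrightarrow>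
      \<delta> (a \<odot>\<^bsub>A\<^esub> x, y) \<ominus>\<^bsub>F\<^esub> (a \<odot>\<^bsub>F\<^esub> \<delta> (x, y)) \<in> J"
    and "a \<in> carrier K \<Longrightarrow> x \<in> carrier A \<Longrightarrow> y \<in> carrier B \<Longrightarrow>
      \<delta> (x, a \<odot>\<^bsub>B\<^esub> y) \<ominus>\<^bsub>F\<^esub> (a \<odot>\<^bsub>F\<^esub> \<delta> (x, y)) \<in> J"
  by (rule subsetD[OF relations_J], unfold bilinear_relations_def Let_def,
      rule UnI1, rule UnI1, rule UnI1, rule CollectI, (rule exI)+, intro conjI, rule refl, assumption+)
    (rule subsetD[OF relations_J], unfold bilinear_relations_def Let_def,
      rule UnI1, rule UnI1, rule UnI2, rule CollectI, (rule exI)+, intro conjI, rule refl, assumption+,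
     rule subsetD[OF relations_J], unfold bilinear_relations_def Let_def,
      rule UnI1, rule UnI2, rule CollectI, (rule exI)+, intro conjI, rule refl, assumption+,
     rule subsetD[OF relations_J], unfold bilinear_relations_def Let_def,
      rule UnI2, rule CollectI, (rule exI)+, intro conjI, rule refl, assumption+)

text \<open>Lets stability of \<open>J\<close> under a linear map be tested on the bilinearity
  relations: a submodule that contains them contains \<open>J\<close>.\<close>

lemma linear_vimage_submodule:
  assumes "L \<in> linear_hom K F F"
  shows "submodule {f \<in> carrier F. L f \<in> J} K F"
proof (rule F.F.submoduleI)
  note L = linear_homD[OF assms] and J = F.F.submoduleE(3-5)[OF submodule_J]
  have J0: "\<zero>\<^bsub>F\<^esub> \<in> J"
    using subgroup.one_closed[OF submodule.axioms(1)[OF submodule_J]] by simp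
  show "\<zero>\<^bsub>F\<^esub> \<in> {f \<in> carrier F. L f \<in> J}"
    using J0 linear_hom_zero[OF assms F.module_F F.module_F] by simp
  show "\<And>f. f \<in> {f \<in> carrier F. L f \<in> J} \<Longrightarrow> \<ominus>\<^bsub>F\<^esub> f \<in> {f \<in> carrier F. L f \<in> J}"
    using J(1) linear_hom_a_inv[OF assms F.module_F F.module_F] by simp
  show "\<And>f g. f \<in> {f \<in> carrier F. L f \<in> J} \<Longrightarrow> g \<in> {f \<in> carrier F. L f \<in> J}
      \<Longrightarrow> f \<oplus>\<^bsub>F\<^esub> g \<in> {f \<in> carrier F. L f \<in> J}"
    using J(3) L(2) by simp
  show "\<And>a f. a \<in> carrier K \<Longrightarrow> f \<in> {f \<in> carrier F. L f \<in> J} \<Longrightarrow> a \<odot>\<^bsub>F\<^esub> f \<in> {f \<in> carrier F. L f \<in> J}"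
    using J(2) L(3) by simp
qed auto

text \<open>Multiplication in \<open>A\<close> and \<open>B\<close> is bilinear, so left or right
  multiplication by \<open>\<delta> (u, v)\<close> sends each bilinearity relation to a relation of
  the same kind; the preimage of \<open>J\<close> is then a submodule containing all
  relations.\<close>

lemma basis_mult_J:
  assumes "p \<in> carrier (A \<times>\<times> B)" "f \<in> J"
  shows "\<delta> p \<otimes>\<^bsub>F\<^esub> f \<in> J" "f \<otimes>\<^bsub>F\<^esub> \<delta> p \<in> J"
proof -
  obtain u v where p: "p = (u, v)" and u: "u \<in> carrier A" and v: "v \<in> carrier B" using assms(1) by auto
  have uv: "(u, v) \<in> carrier (A \<times>\<times> B)" using u v by simp
  then have pF: "\<delta> (u, v) \<in> carrier F" by simp
  note R = F.mult_linear_right[OF pF] and L = F.mult_linear_left[OF pF]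
  note sR = linear_homD[OF R] linear_hom_minus[OF R F.module_F F.module_F]
  note sL = linear_homD[OF L] linear_hom_minus[OF L F.module_F F.module_F]
  have "J \<subseteq> {f \<in> carrier F. \<delta> (u, v) \<otimes>\<^bsub>F\<^esub> f \<in> J}"
  proof (rule J_minimal[OF linear_vimage_submodule[OF R]], rule subsetI)
    fix r assume "r \<in> bilinear_relations K A B"
    then show "r \<in> {f \<in> carrier F. \<delta> (u, v) \<otimes>\<^bsub>F\<^esub> f \<in> J}"
      by (cases rule: relationsE)
        (auto simp: sR F.basis_mult[OF uv] u v A.A.r_distr B.A.r_distr A.smult_mult_right B.smult_mult_right
          simp del: sR(1) intro!: relationsI)
  qed
  then show "\<delta> p \<otimes>\<^bsub>F\<^esub> f \<in> J" using assms(2) by (auto simp: p)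
  have "J \<subseteq> {f \<in> carrier F. f \<otimes>\<^bsub>F\<^esub> \<delta> (u, v) \<in> J}"
  proof (rule J_minimal[OF linear_vimage_submodule[OF L]], rule subsetI)
    fix r assume "r \<in> bilinear_relations K A B"
    then show "r \<in> {f \<in> carrier F. f \<otimes>\<^bsub>F\<^esub> \<delta> (u, v) \<in> J}"
      by (cases rule: relationsE)
        (auto simp: sL F.basis_mult[OF _ uv] u v A.A.l_distr B.A.l_distr A.smult_mult_left B.smult_mult_left
          simp del: sL(1) intro!: relationsI)
  qed
  then show "f \<otimes>\<^bsub>F\<^esub> \<delta> p \<in> J" using assms(2) by (auto simp: p)
qed

lemma J_subset: "J \<subseteq> carrier F"
  by (rule F.F.submoduleE(1)[OF submodule_J])

text \<open>By definition \<open>J\<close> is only a linear span. It absorbs products because it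
  absorbs basis elements on both sides and an arbitrary multiplier is a combination of those; this
  gives the product on the quotient.\<close>

lemma ideal_J: "ideal J F"
proof (rule idealI[OF F.F.A.ring_axioms])
  show "subgroup J (add_monoid F)" by (rule submodule.axioms(1)[OF submodule_J])
  fix f g assume f: "f \<in> J" and g: "g \<in> carrier F"
  have fF: "f \<in> carrier F" using f J_subset by auto
  note J = F.F.submoduleE(4,5)[OF submodule_J]
  have J0: "\<zero>\<^bsub>F\<^esub> \<in> J"
    using subgroup.one_closed[OF submodule.axioms(1)[OF submodule_J]] by simp
  show "g \<otimes>\<^bsub>F\<^esub> f \<in> J" using g
  proof (induction rule: F.induct_F)
    case (add a x g)
    then show ?case
      using fF by (simp add: F.F.A.l_distr F.F.smult_mult_left J basis_mult_J f)
  qed (simp add: fF J0)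
  show "f \<otimes>\<^bsub>F\<^esub> g \<in> J" using g
  proof (induction rule: F.induct_F)
    case (add a x g)
    then show ?case
      using fF by (simp add: F.F.A.r_distr F.F.smult_mult_right J basis_mult_J f)
  qed (simp add: fF J0)
qed

sublocale Q: algebra_ideal K F J
  by (intro algebra_ideal.intro F.assoc_algebra_F ideal_J)

lemma tensor_assoc_algebra: "assoc_algebra K T"
  unfolding tensor_algebra_def by (rule Q.quotient_assoc_algebra)

lemma tensor_closed [simp]:
  "x \<in> carrier A \<Longrightarrow> y \<in> carrier B \<Longrightarrow> tensor K A B x y \<in> carrier T"
  by (simp add: tensor_def tensor_algebra_def)

lemma tensor_mult:
  "x \<in> carrier A \<Longrightarrow> y \<in> carrier B \<Longrightarrow> x' \<in> carrier A \<Longrightarrow> y' \<in> carrier B \<Longrightarrow>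
    tensor K A B x y \<otimes>\<^bsub>T\<^esub> tensor K A B x' y' = tensor K A B (x \<otimes>\<^bsub>A\<^esub> x') (y \<otimes>\<^bsub>B\<^esub> y')"
  by (simp add: tensor_def tensor_algebra_def Q.quotient_mult F.basis_mult)

lemma tensor_one: "\<one>\<^bsub>T\<^esub> = tensor K A B \<one>\<^bsub>A\<^esub> \<one>\<^bsub>B\<^esub>"
  by (simp add: tensor_def tensor_algebra_def Q.quotient_one F.F_simps)

lemma tensor_bilinear: "bilinear_map K A B T (tensor K A B)"
proof -
  have "tensor K A B (x \<oplus>\<^bsub>A\<^esub> x') y = tensor K A B x y \<oplus>\<^bsub>T\<^esub> tensor K A B x' y"
    if "x \<in> carrier A" "x' \<in> carrier A" "y \<in> carrier B" for x x' y
    using relationsI(1)[OF that] that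
    by (simp add: tensor_def tensor_algebra_def Q.quotient_add Q.coset_eq_iff)
  moreover have "tensor K A B x (y \<oplus>\<^bsub>B\<^esub> y') = tensor K A B x y \<oplus>\<^bsub>T\<^esub> tensor K A B x y'"
    if "x \<in> carrier A" "y \<in> carrier B" "y' \<in> carrier B" for x y y'
    using relationsI(2)[OF that] that
    by (simp add: tensor_def tensor_algebra_def Q.quotient_add Q.coset_eq_iff)
  moreover have "tensor K A B (a \<odot>\<^bsub>A\<^esub> x) y = a \<odot>\<^bsub>T\<^esub> tensor K A B x y"
    if "a \<in> carrier K" "x \<in> carrier A" "y \<in> carrier B" for a x y
    using relationsI(3)[OF that] that
    by (simp add: tensor_def tensor_algebra_def Q.quotient_smult Q.coset_eq_iff)
  moreover have "tensor K A B x (a \<odot>\<^bsub>B\<^esub> y) = a \<odot>\<^bsub>T\<^esub> tensor K A B x y"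
    if "a \<in> carrier K" "x \<in> carrier A" "y \<in> carrier B" for a x y
    using relationsI(4)[OF that] that
    by (simp add: tensor_def tensor_algebra_def Q.quotient_smult Q.coset_eq_iff)
  ultimately show ?thesis
    by (intro bilinear_mapI linear_homI) auto
qed

lemmas tensor_left = bilinear_left[OF tensor_bilinear] and tensor_right = bilinear_right[OF tensor_bilinear]

lemma tensor_module: "module K T"
  by (rule assoc_algebra.axioms(1)[OF tensor_assoc_algebra])

text \<open>Two cases suffice: a scalar is absorbed into the left factor of a pure tensor, and zero
  is the pure tensor of two zeros.\<close>

lemma tensor_induct [consumes 1, case_names tensor add]:
  assumes "u \<in> carrier T"
    and tensor: "\<And>x y. x \<in> carrier A \<Longrightarrow> y \<in> carrier B \<Longrightarrow> P (tensor K A B x y)"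
    and add: "\<And>u v. u \<in> carrier T \<Longrightarrow> v \<in> carrier T \<Longrightarrow> P u \<Longrightarrow> P v \<Longrightarrow> P (u \<oplus>\<^bsub>T\<^esub> v)"
  shows "P u"
proof -
  obtain f where f: "f \<in> carrier F" and u: "u = J +>\<^bsub>F\<^esub> f"
    using assms(1) by (auto simp: tensor_algebra_def Q.quotient_carrier)
  have "P (J +>\<^bsub>F\<^esub> f)" using f
  proof (induction rule: F.induct_F)
    case zero
    have "tensor K A B \<zero>\<^bsub>A\<^esub> \<zero>\<^bsub>B\<^esub> = \<zero>\<^bsub>T\<^esub>"
      by (rule linear_hom_zero[OF tensor_left A.module_axioms tensor_module]) simp
    also have "\<dots> = J +>\<^bsub>F\<^esub> \<zero>\<^bsub>F\<^esub>"
      using linear_hom_zero[OF algebra_hom_linear[OF Q.projection_hom] F.module_F Q.Q.module_axioms]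
      by (simp add: tensor_algebra_def)
    finally show ?case using tensor[of "\<zero>\<^bsub>A\<^esub>" "\<zero>\<^bsub>B\<^esub>"] by simp
  next
    case (add a p f)
    obtain x y where p: "p = (x, y)" and x: "x \<in> carrier A" and y: "y \<in> carrier B" using add(2) by auto
    have "P (tensor K A B (a \<odot>\<^bsub>A\<^esub> x) y \<oplus>\<^bsub>T\<^esub> (J +>\<^bsub>F\<^esub> f))"
      using add(1,3,4) x y by (intro assms(3) tensor tensor_closed) (simp_all add: tensor_algebra_def)
    moreover have "tensor K A B (a \<odot>\<^bsub>A\<^esub> x) y = J +>\<^bsub>F\<^esub> (a \<odot>\<^bsub>F\<^esub> \<delta> p)"
      using add x y linear_hom_smult[OF tensor_left[OF y] add(1) x]
      by (simp add: p tensor_def tensor_algebra_def Q.quotient_smult)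
    ultimately show ?case
      using add by (simp add: tensor_algebra_def Q.quotient_add)
  qed
  then show ?thesis by (simp add: u)
qed

lemma bilinear_extension:
  assumes "bilinear_map K A B N \<phi>" "module K N"
  shows "linear_extension K N (case_prod \<phi>) \<in> linear_hom K F N"
    and "f \<in> J \<Longrightarrow> linear_extension K N (case_prod \<phi>) f = \<zero>\<^bsub>N\<^esub>"
    and "x \<in> carrier A \<Longrightarrow> y \<in> carrier B \<Longrightarrow> linear_extension K N (case_prod \<phi>) (\<delta> (x, y)) = \<phi> x y"
proof -
  interpret N: module K N by fact
  have \<phi>: "case_prod \<phi> \<in> carrier (A \<times>\<times> B) \<rightarrow> carrier N"
    using bilinear_closed[OF assms(1)] by auto
  let ?L = "linear_extension K N (case_prod \<phi>)"
  show L: "?L \<in> linear_hom K F N" by (rule F.linear_extension_linear[OF assms(2) \<phi>])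
  show v: "?L (\<delta> (x, y)) = \<phi> x y" if "x \<in> carrier A" "y \<in> carrier B" for x y
    using F.linear_extension_basis[OF assms(2) \<phi>, of "(x, y)"] that by simp
  note bl = linear_homD[OF bilinear_left[OF assms(1)]] linear_homD[OF bilinear_right[OF assms(1)]]
  have "J \<subseteq> {f \<in> carrier F. ?L f = \<zero>\<^bsub>N\<^esub>}"
  proof (rule J_minimal[OF F.F.submodule_kernel[OF L assms(2)]], rule subsetI)
    fix r assume "r \<in> bilinear_relations K A B"
    then show "r \<in> {f \<in> carrier F. ?L f = \<zero>\<^bsub>N\<^esub>}"
      by (cases rule: relationsE)
        (auto simp: linear_homD[OF L] linear_hom_minus[OF L F.module_F assms(2)] v N.M.minus_zero_iff bl
          simp del: linear_homD(1)[OF L])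
  qed
  then show "f \<in> J \<Longrightarrow> ?L f = \<zero>\<^bsub>N\<^esub>" by auto
qed

lemma tensor_lift_linear:
  assumes "bilinear_map K A B N \<phi>" "module K N"
  shows "tensor_lift K N \<phi> \<in> linear_hom K T N"
  using Q.quotient_lift_linear[OF bilinear_extension(1)[OF assms] assms(2) bilinear_extension(2)[OF assms]]
  by (simp add: tensor_lift_def[abs_def] tensor_algebra_def)

lemma tensor_lift_tensor:
  assumes "bilinear_map K A B N \<phi>" "module K N" "x \<in> carrier A" "y \<in> carrier B"
  shows "tensor_lift K N \<phi> (tensor K A B x y) = \<phi> x y"
  using Q.quotient_lift_eq[OF bilinear_extension(1)[OF assms(1,2)] assms(2) bilinear_extension(2)[OF assms(1,2)], of "\<delta> (x, y)"] assms(3,4)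
    bilinear_extension(3)[OF assms(1,2)]
  by (simp add: tensor_lift_def tensor_def)

end

text \<open>Interface to the preceding construction: only the facts that characterize the tensor
  product are carried over, so that iterated tensor products can be treated without looking at
  cosets.\<close>

locale tensor_pair = A: assoc_algebra K A + B: assoc_algebra K B for K and A and B
begin

abbreviation (input) "T \<equiv> tensor_algebra K A B"

lemma tensor_construction: "tensor_construction K A B"
  by (intro tensor_construction.intro A.assoc_algebra_axioms B.assoc_algebra_axioms)

lemmas tensor_closed [simp] = tensor_construction.tensor_closed[OF tensor_construction]
  and tensor_mult = tensor_construction.tensor_mult[OF tensor_construction]
  and tensor_one = tensor_construction.tensor_one[OF tensor_construction]
  and tensor_bilinear = tensor_construction.tensor_bilinear[OF tensor_construction]
  and tensor_assoc_algebra = tensor_construction.tensor_assoc_algebra[OF tensor_construction]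
  and tensor_induct [consumes 1, case_names tensor add] = tensor_construction.tensor_induct[OF tensor_construction]
  and tensor_lift_linear = tensor_construction.tensor_lift_linear[OF tensor_construction]
  and tensor_lift_tensor = tensor_construction.tensor_lift_tensor[OF tensor_construction]

lemmas tensor_left = bilinear_left[OF tensor_bilinear] and tensor_right = bilinear_right[OF tensor_bilinear]

sublocale T: assoc_algebra K "tensor_algebra K A B" by (rule tensor_assoc_algebra)

lemma tensor_zero:
  "y \<in> carrier B \<Longrightarrow> tensor K A B \<zero>\<^bsub>A\<^esub> y = \<zero>\<^bsub>T\<^esub>" "x \<in> carrier A \<Longrightarrow> tensor K A B x \<zero>\<^bsub>B\<^esub> = \<zero>\<^bsub>T\<^esub>"
  using linear_hom_zero[OF tensor_left A.module_axioms T.module_axioms]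
    linear_hom_zero[OF tensor_right B.module_axioms T.module_axioms] by auto

lemma linear_ext_tensor:
  assumes "u \<in> carrier T" "f \<in> linear_hom K T N" "g \<in> linear_hom K T N"
    and "\<And>x y. x \<in> carrier A \<Longrightarrow> y \<in> carrier B \<Longrightarrow> f (tensor K A B x y) = g (tensor K A B x y)"
  shows "f u = g u"
  using assms(1)
  by (induction rule: tensor_induct) (simp_all add: assms(4) linear_homD[OF assms(2)] linear_homD[OF assms(3)])

lemma tensor_lift_eqI:
  assumes "bilinear_map K A B N \<phi>" "module K N" "u \<in> carrier T" "f \<in> linear_hom K T N"
    and "\<And>x y. x \<in> carrier A \<Longrightarrow> y \<in> carrier B \<Longrightarrow> \<phi> x y = f (tensor K A B x y)"
  shows "tensor_lift K N \<phi> u = f u"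
  by (rule linear_ext_tensor[OF assms(3) tensor_lift_linear[OF assms(1,2)] assms(4)])
    (simp add: tensor_lift_tensor[OF assms(1,2)] assms(5))

lemma tensor_lift_cong:
  assumes "bilinear_map K A B N \<phi>" "module K N" "u \<in> carrier T"
    and eq: "\<And>x y. x \<in> carrier A \<Longrightarrow> y \<in> carrier B \<Longrightarrow> \<phi> x y = \<psi> x y"
  shows "tensor_lift K N \<phi> u = tensor_lift K N \<psi> u"
proof -
  note \<psi> = bilinear_cong[OF A.module_axioms B.module_axioms assms(1) eq]
  show ?thesis
    by (rule tensor_lift_eqI[OF assms(1-3) tensor_lift_linear[OF \<psi> assms(2)]])
      (simp_all add: tensor_lift_tensor[OF \<psi> assms(2)] eq)
qed

lemma tensor_lift_self:
  assumes "u \<in> carrier T"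
  shows "tensor_lift K T (tensor K A B) u = u"
  using tensor_lift_eqI[OF tensor_bilinear T.module_axioms assms linear_hom_id] by simp

lemma tensor_lift_compose:
  assumes "bilinear_map K A B N \<phi>" "module K N" "module K P" "L \<in> linear_hom K N P" "u \<in> carrier T"
  shows "L (tensor_lift K N \<phi> u) = tensor_lift K P (\<lambda>x y. L (\<phi> x y)) u"
  by (rule tensor_lift_eqI[symmetric, OF bilinear_compose[OF assms(1,4)] assms(3,5)
        linear_hom_compose[OF tensor_lift_linear[OF assms(1,2)] assms(4)]])
    (simp add: tensor_lift_tensor[OF assms(1,2)])

text \<open>The product rule is linear in both arguments; \<open>1\<close> extends it from pure
  tensors to an arbitrary right factor, the conclusion to an arbitrary left factor as well.\<close>

lemma tensor_lift_hom:
  assumes "bilinear_map K A B D \<phi>" "assoc_algebra K D"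
    and mult: "\<And>x y x' y'. \<lbrakk>x \<in> carrier A; y \<in> carrier B; x' \<in> carrier A; y' \<in> carrier B\<rbrakk>
      \<Longrightarrow> \<phi> (x \<otimes>\<^bsub>A\<^esub> x') (y \<otimes>\<^bsub>B\<^esub> y') = \<phi> x y \<otimes>\<^bsub>D\<^esub> \<phi> x' y'"
    and one: "\<phi> \<one>\<^bsub>A\<^esub> \<one>\<^bsub>B\<^esub> = \<one>\<^bsub>D\<^esub>"
  shows "tensor_lift K D \<phi> \<in> algebra_hom K T D"
proof -
  interpret D: assoc_algebra K D by fact
  note L = tensor_lift_linear[OF assms(1) D.module_axioms]
  note v = tensor_lift_tensor[OF assms(1) D.module_axioms]
  let ?L = "tensor_lift K D \<phi>"
  note cl = linear_hom_closed[OF L]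
  have 1: "?L (tensor K A B x y \<otimes>\<^bsub>T\<^esub> w) = ?L (tensor K A B x y) \<otimes>\<^bsub>D\<^esub> ?L w"
    if "x \<in> carrier A" "y \<in> carrier B" "w \<in> carrier T" for x y w
    by (rule linear_ext_tensor[OF that(3) linear_hom_compose[OF T.linear_hom_mult_left[OF _ linear_hom_id] L] D.linear_hom_mult_left[OF _ L]])
      (use that in \<open>auto simp: tensor_mult v mult bilinear_closed[OF assms(1)] intro!: cl\<close>)
  show ?thesis
  proof (rule algebra_homI[OF L])
    fix u w assume u: "u \<in> carrier T" and w: "w \<in> carrier T"
    show "?L (u \<otimes>\<^bsub>T\<^esub> w) = ?L u \<otimes>\<^bsub>D\<^esub> ?L w"
      by (rule linear_ext_tensor[OF u linear_hom_compose[OF T.linear_hom_mult_right[OF w linear_hom_id] L] D.linear_hom_mult_right[OF cl[OF w] L]])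
        (use w in \<open>simp add: 1\<close>)
  qed (simp add: tensor_one v one)
qed

lemma tensor_map_bilinear:
  assumes "assoc_algebra K C" "assoc_algebra K D" "f \<in> linear_hom K A C" "g \<in> linear_hom K B D"
  shows "bilinear_map K A B (tensor_algebra K C D) (\<lambda>x y. tensor K C D (f x) (g y))"
proof -
  interpret C: tensor_pair K C D using assms by (simp add: tensor_pair_def)
  show ?thesis by (rule bilinear_precompose[OF C.tensor_bilinear assms(3,4)])
qed

lemma tensor_map_linear:
  assumes "assoc_algebra K C" "assoc_algebra K D" "f \<in> linear_hom K A C" "g \<in> linear_hom K B D"
  shows "tensor_map K C D f g \<in> linear_hom K T (tensor_algebra K C D)"
    and "x \<in> carrier A \<Longrightarrow> y \<in> carrier B \<Longrightarrow> tensor_map K C D f g (tensor K A B x y) = tensor K C D (f x) (g y)"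
proof -
  interpret C: tensor_pair K C D using assms by (simp add: tensor_pair_def)
  show "tensor_map K C D f g \<in> linear_hom K T (tensor_algebra K C D)"
    unfolding tensor_map_def by (rule tensor_lift_linear[OF tensor_map_bilinear[OF assms] C.T.module_axioms])
  show "x \<in> carrier A \<Longrightarrow> y \<in> carrier B \<Longrightarrow> tensor_map K C D f g (tensor K A B x y) = tensor K C D (f x) (g y)"
    unfolding tensor_map_def by (rule tensor_lift_tensor[OF tensor_map_bilinear[OF assms] C.T.module_axioms])
qed

lemma tensor_map_hom:
  assumes "assoc_algebra K C" "assoc_algebra K D" "f \<in> algebra_hom K A C" "g \<in> algebra_hom K B D"
  shows "tensor_map K C D f g \<in> algebra_hom K T (tensor_algebra K C D)"
proof -
  interpret C: tensor_pair K C D using assms by (simp add: tensor_pair_def)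
  note f = algebra_homD[OF assms(3)] and g = algebra_homD[OF assms(4)]
  show ?thesis
    unfolding tensor_map_def
    by (rule tensor_lift_hom[OF tensor_map_bilinear[OF assms(1,2) f(2) g(2)] C.tensor_assoc_algebra])
      (simp_all add: f g C.tensor_mult C.tensor_one)
qed

lemma tensor_lift_map:
  assumes "assoc_algebra K C" "assoc_algebra K D" "f \<in> linear_hom K A C" "g \<in> linear_hom K B D"
    and "bilinear_map K C D N \<phi>" "module K N" "u \<in> carrier T"
  shows "tensor_lift K N \<phi> (tensor_map K C D f g u) = tensor_lift K N (\<lambda>x y. \<phi> (f x) (g y)) u"
proof -
  interpret C: tensor_pair K C D using assms by (simp add: tensor_pair_def)
  show ?thesis
    by (rule tensor_lift_eqI[symmetric, OF bilinear_precompose[OF assms(5,3,4)] assms(6,7)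
          linear_hom_compose[OF tensor_map_linear(1)[OF assms(1-4)] C.tensor_lift_linear[OF assms(5,6)]]])
      (simp add: tensor_map_linear(2)[OF assms(1-4)] C.tensor_lift_tensor[OF assms(5,6)] linear_hom_closed[OF assms(3)] linear_hom_closed[OF assms(4)])
qed

text \<open>Needed for the bilinearity of iterated lifts, such as the one behind
  \<open>tensor_assoc\<close>, where the outer variable is a parameter of the inner lift. The
  induction on \<open>u\<close> works because on a pure tensor the lift is a single value of
  \<open>t\<close>, and a sum of linear maps is linear.\<close>

lemma tensor_lift_param_linear:
  assumes "u \<in> carrier T" "module K N"
    and "\<And>z. z \<in> carrier C \<Longrightarrow> bilinear_map K A B N (\<lambda>x y. t x y z)"
    and "\<And>x y. x \<in> carrier A \<Longrightarrow> y \<in> carrier B \<Longrightarrow> (\<lambda>z. t x y z) \<in> linear_hom K C N"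
    and "module K C"
  shows "(\<lambda>z. tensor_lift K N (\<lambda>x y. t x y z) u) \<in> linear_hom K C N"
  using assms(1)
proof (induction rule: tensor_induct)
  case (tensor x y)
  then show ?case
    by (intro linear_hom_cong[OF assms(5) assms(4)[OF tensor]])
      (simp add: tensor_lift_tensor[OF assms(3,2)])
next
  case (add u v)
  show ?case
    by (rule linear_hom_cong[OF assms(5) module.linear_hom_add_fun[OF assms(2) add(3,4)]])
      (simp add: linear_hom_add[OF tensor_lift_linear[OF assms(3,2)] add(1,2)])
qed

end

lemma (in assoc_algebra) mult_bilinear: "bilinear_map K A A A (\<lambda>x y. x \<otimes>\<^bsub>A\<^esub> y)"
  by (intro bilinear_mapI linear_hom_mult_left linear_hom_mult_right linear_hom_id)

lemma (in module) smult_bilinear_ground: "bilinear_map R (ground_algebra R) M M (\<lambda>a x. a \<odot>\<^bsub>M\<^esub> x)"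
  by (intro bilinear_mapI linear_homI) (auto simp: smult_l_distr smult_r_distr smult_assoc1[symmetric] R.m_comm)

lemma bilinear_flip: "bilinear_map K A B M \<phi> \<Longrightarrow> bilinear_map K B A M (\<lambda>x y. \<phi> y x)"
  by (auto simp: bilinear_map_def)

lemma (in module) scalar_bilinear:
  assumes "\<alpha> \<in> linear_hom R A (ground_algebra R)" "f \<in> linear_hom R B M"
  shows "bilinear_map R A B M (\<lambda>x y. \<alpha> x \<odot>\<^bsub>M\<^esub> f y)" "bilinear_map R B A M (\<lambda>y x. \<alpha> x \<odot>\<^bsub>M\<^esub> f y)"
  using bilinear_precompose[OF smult_bilinear_ground assms] by (auto intro: bilinear_flip)

text \<open>Scalars commute with everything, so pairing a character with a homomorphism is
  multiplicative. In this way \<epsilon> \<otimes> id and id \<otimes> \<epsilon> become algebra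
  homomorphisms, which reduces the counit laws to generators.\<close>

lemma algebra_hom_scalar:
  assumes "assoc_algebra K A" "assoc_algebra K B" "assoc_algebra K D"
    and "e \<in> algebra_hom K A (ground_algebra K)" "f \<in> algebra_hom K B D"
  shows "tensor_lift K D (\<lambda>x y. e x \<odot>\<^bsub>D\<^esub> f y) \<in> algebra_hom K (tensor_algebra K A B) D"
    and "tensor_lift K D (\<lambda>y x. e x \<odot>\<^bsub>D\<^esub> f y) \<in> algebra_hom K (tensor_algebra K B A) D"
proof -
  interpret AB: tensor_pair K A B using assms by (simp add: tensor_pair_def)
  interpret BA: tensor_pair K B A using assms by (simp add: tensor_pair_def)
  interpret D: assoc_algebra K D by fact
  note e = algebra_homD[OF assms(4), simplified] and f = algebra_homD[OF assms(5)]
  note el = algebra_hom_linear[OF assms(4)]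
  have m: "(a \<otimes>\<^bsub>K\<^esub> b) \<odot>\<^bsub>D\<^esub> (x \<otimes>\<^bsub>D\<^esub> y) = (a \<odot>\<^bsub>D\<^esub> x) \<otimes>\<^bsub>D\<^esub> (b \<odot>\<^bsub>D\<^esub> y)"
    if "a \<in> carrier K" "b \<in> carrier K" "x \<in> carrier D" "y \<in> carrier D" for a b x y
    using that by (simp add: D.smult_mult_left D.smult_mult_right D.smult_assoc1[symmetric] AB.A.R.m_comm)
  show "tensor_lift K D (\<lambda>x y. e x \<odot>\<^bsub>D\<^esub> f y) \<in> algebra_hom K (tensor_algebra K A B) D"
    by (rule AB.tensor_lift_hom[OF D.scalar_bilinear(1)[OF el f(2)] assms(3)])
      (simp_all add: e(3,6,7) f(3,6,7) m)
  show "tensor_lift K D (\<lambda>y x. e x \<odot>\<^bsub>D\<^esub> f y) \<in> algebra_hom K (tensor_algebra K B A) D"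
    by (rule BA.tensor_lift_hom[OF D.scalar_bilinear(2)[OF el f(2)] assms(3)])
      (simp_all add: e(3,6,7) f(3,6,7) m)
qed

section \<open>Triple tensor products and reassociation\<close>

locale tensor_triple = assoc_algebra K A for K (structure) and A (structure)
begin

abbreviation "AA \<equiv> tensor_algebra K A A"

sublocale AA: tensor_pair K A A by unfold_locales
sublocale AAl: tensor_pair K AA A by (simp add: tensor_pair_def assoc_algebra_axioms AA.tensor_assoc_algebra)
sublocale AAr: tensor_pair K A AA by (simp add: tensor_pair_def assoc_algebra_axioms AA.tensor_assoc_algebra)

abbreviation "A3l \<equiv> tensor_algebra K AA A"
abbreviation "A3r \<equiv> tensor_algebra K A AA"

lemma assoc_inner_bilinear:
  assumes z: "z \<in> carrier A"
  shows "bilinear_map K A A A3r (\<lambda>x y. tensor K A AA x (tensor K A A y z))"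
  by (rule bilinear_precompose[OF AAr.tensor_bilinear linear_hom_id AA.tensor_left[OF z]])

lemma assoc_bilinear:
  "bilinear_map K AA A A3r (\<lambda>u z. tensor_lift K A3r (\<lambda>x y. tensor K A AA x (tensor K A A y z)) u)"
  by (intro bilinear_mapI AA.tensor_lift_linear[OF assoc_inner_bilinear AAr.T.module_axioms]
     AA.tensor_lift_param_linear[OF _ AAr.T.module_axioms assoc_inner_bilinear linear_hom_compose[OF AA.tensor_right AAr.tensor_right] module_axioms])

lemma tensor_assoc_linear: "tensor_assoc K A \<in> linear_hom K A3l A3r"
  using AAl.tensor_lift_linear[OF assoc_bilinear AAr.T.module_axioms]
  by (simp add: tensor_assoc_def[abs_def] Let_def)

lemma tensor_assoc_tensor:
  "x \<in> carrier A \<Longrightarrow> y \<in> carrier A \<Longrightarrow> z \<in> carrier A \<Longrightarrow>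
   tensor_assoc K A (tensor K AA A (tensor K A A x y) z) = tensor K A AA x (tensor K A A y z)"
  by (simp add: tensor_assoc_def Let_def AAl.tensor_lift_tensor[OF assoc_bilinear AAr.T.module_axioms]
     AA.tensor_lift_tensor[OF assoc_inner_bilinear AAr.T.module_axioms])

text \<open>Multiplicativity of the reassociation map is what makes coassociativity of the new
  comultiplication an equality of algebra homomorphisms.\<close>

lemma tensor_assoc_hom: "tensor_assoc K A \<in> algebra_hom K A3l A3r"
proof -
  let ?\<phi> = "\<lambda>u z. tensor_lift K A3r (\<lambda>x y. tensor K A AA x (tensor K A A y z)) u"
  note v = AA.tensor_lift_tensor[OF assoc_inner_bilinear AAr.T.module_axioms]
  note lin = AA.tensor_lift_linear[OF assoc_inner_bilinear AAr.T.module_axioms]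
  note cl = linear_hom_closed[OF lin]
  have 1: "?\<phi> (tensor K A A x y \<otimes>\<^bsub>AA\<^esub> w) (z \<otimes>\<^bsub>A\<^esub> z') = ?\<phi> (tensor K A A x y) z \<otimes>\<^bsub>A3r\<^esub> ?\<phi> w z'"
    if "x \<in> carrier A" "y \<in> carrier A" "z \<in> carrier A" "z' \<in> carrier A" "w \<in> carrier AA" for x y w z z'
    by (rule AA.linear_ext_tensor[OF that(5) linear_hom_compose[OF AA.T.linear_hom_mult_left[OF _ linear_hom_id] lin] AAr.T.linear_hom_mult_left[OF _ lin]])
      (use that in \<open>simp_all add: AA.tensor_mult v AAr.tensor_mult\<close>)
  have 2: "?\<phi> (u \<otimes>\<^bsub>AA\<^esub> w) (z \<otimes>\<^bsub>A\<^esub> z') = ?\<phi> u z \<otimes>\<^bsub>A3r\<^esub> ?\<phi> w z'"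
    if "u \<in> carrier AA" "z \<in> carrier A" "z' \<in> carrier A" "w \<in> carrier AA" for u w z z'
    by (rule AA.linear_ext_tensor[OF that(1) linear_hom_compose[OF AA.T.linear_hom_mult_right[OF that(4) linear_hom_id] lin] AAr.T.linear_hom_mult_right[OF _ lin]])
      (use that in \<open>simp_all add: 1 cl\<close>)
  show ?thesis
    unfolding tensor_assoc_def Let_def
    by (rule AAl.tensor_lift_hom[OF assoc_bilinear AAr.tensor_assoc_algebra])
      (simp_all add: 2 AA.tensor_one AAr.tensor_one v)
qed

end

section \<open>Free algebras and free products\<close>

definition word_eval :: "('b, 'm) monoid_scheme \<Rightarrow> ('x \<Rightarrow> 'b) \<Rightarrow> 'x list \<Rightarrow> 'b" where
  "word_eval B \<phi> w = foldr (\<lambda>x r. \<phi> x \<otimes>\<^bsub>B\<^esub> r) w \<one>\<^bsub>B\<^esub>"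

lemma (in monoid) word_eval:
  assumes "\<phi> \<in> X \<rightarrow> carrier G"
  shows "w \<in> lists X \<Longrightarrow> word_eval G \<phi> w \<in> carrier G"
    and "u \<in> lists X \<Longrightarrow> v \<in> lists X \<Longrightarrow> word_eval G \<phi> (u @ v) = word_eval G \<phi> u \<otimes> word_eval G \<phi> v"
proof -
  show cl: "word_eval G \<phi> w \<in> carrier G" if "w \<in> lists X" for w
    using that by (induction w) (use assms in \<open>auto simp: word_eval_def\<close>)
  show "word_eval G \<phi> (u @ v) = word_eval G \<phi> u \<otimes> word_eval G \<phi> v" if "u \<in> lists X" "v \<in> lists X"
    using that(1)
  proof (induction u)
    case Nil
    then show ?case using cl[OF that(2)] by (simp add: word_eval_def)
  next
    case (Cons x u)
    then have "\<phi> x \<in> carrier G" using assms by auto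
    then show ?case
      using Cons cl[OF that(2)] cl[of u] by (simp add: word_eval_def m_assoc)
  qed
qed

locale free_algebra_setup = K: field K for K (structure) + fixes X :: "'x set"
begin

abbreviation (input) "Fr \<equiv> free_algebra K X"
abbreviation (input) "W \<equiv> \<lparr>carrier = lists X, mult = (@), one = []\<rparr>"

lemma monoid_W: "monoid W"
  by (rule monoidI) auto

lemma setup_W: "monoid_algebra_setup K W"
  by (intro monoid_algebra_setup.intro K.field_axioms monoid_W)

lemma free_assoc_algebra: "assoc_algebra K Fr"
  unfolding free_algebra_def by (rule monoid_algebra_setup.assoc_algebra_F[OF setup_W])

lemma free_gen_closed [simp]: "x \<in> X \<Longrightarrow> free_gen K x \<in> carrier Fr"
  unfolding free_algebra_def free_gen_def by (rule monoid_algebra_setup.basis_closed[OF setup_W]) simp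

lemma free_universal:
  assumes "assoc_algebra K B" "\<phi> \<in> X \<rightarrow> carrier B"
  shows "\<exists>\<Phi>\<in>algebra_hom K Fr B. \<forall>x\<in>X. \<Phi> (free_gen K x) = \<phi> x"
proof -
  interpret B: assoc_algebra K B by fact
  note we = B.A.word_eval[OF assms(2)]
  have cl: "word_eval B \<phi> \<in> carrier W \<rightarrow> carrier B" using we(1) by simp
  have "linear_extension K B (word_eval B \<phi>) \<in> algebra_hom K Fr B"
    unfolding free_algebra_def
    by (rule monoid_algebra_setup.linear_extension_hom[OF setup_W assms(1) cl])
      (use we in \<open>simp_all add: word_eval_def\<close>)
  moreover have "linear_extension K B (word_eval B \<phi>) (free_gen K x) = \<phi> x" if "x \<in> X" for x
  proof -
    have "linear_extension K B (word_eval B \<phi>) (free_gen K x) = word_eval B \<phi> [x]"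
      unfolding free_gen_def
      by (rule monoid_algebra_setup.linear_extension_basis[OF setup_W B.module_axioms cl]) (use that in simp)
    also have "\<dots> = \<phi> x" using funcset_mem[OF assms(2) that] by (simp add: word_eval_def)
    finally show ?thesis .
  qed
  ultimately show ?thesis by blast
qed

lemma free_induct [consumes 1, case_names one gen add mult smult]:
  assumes "u \<in> carrier Fr" "P \<one>\<^bsub>Fr\<^esub>" "\<And>x. x \<in> X \<Longrightarrow> P (free_gen K x)"
    and add: "\<And>u v. \<lbrakk>u \<in> carrier Fr; v \<in> carrier Fr; P u; P v\<rbrakk> \<Longrightarrow> P (u \<oplus>\<^bsub>Fr\<^esub> v)"
    and mult: "\<And>u v. \<lbrakk>u \<in> carrier Fr; v \<in> carrier Fr; P u; P v\<rbrakk> \<Longrightarrow> P (u \<otimes>\<^bsub>Fr\<^esub> v)"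
    and smult: "\<And>a u. \<lbrakk>a \<in> carrier K; u \<in> carrier Fr; P u\<rbrakk> \<Longrightarrow> P (a \<odot>\<^bsub>Fr\<^esub> u)"
  shows "P u"
proof -
  interpret Fr: assoc_algebra K Fr by (rule free_assoc_algebra)
  note basis = monoid_algebra_setup.basis_closed[OF setup_W, folded free_algebra_def]
  have w: "P (basis_elem K w)" if "w \<in> lists X" for w
    using that
  proof (induction w)
    case Nil
    then show ?case using assms(2) monoid_algebra_setup.F_simps(4)[OF setup_W] by (simp add: free_algebra_def)
  next
    case (Cons x w)
    have "free_gen K x \<otimes>\<^bsub>Fr\<^esub> basis_elem K w = basis_elem K (x # w)"
      using monoid_algebra_setup.basis_mult[OF setup_W, of "[x]" w] Cons.hyps
      by (simp add: free_algebra_def free_gen_def)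
    then show ?case
      using mult[of "free_gen K x" "basis_elem K w"] Cons assms(3) basis[of w] by simp
  qed
  have zero: "P \<zero>\<^bsub>Fr\<^esub>"
    using smult[of "\<zero>\<^bsub>K\<^esub>" "\<one>\<^bsub>Fr\<^esub>"] assms(2) by simp
  show ?thesis
    by (rule monoid_algebra_setup.induct_F[OF setup_W, folded free_algebra_def, OF assms(1), where P = P, OF zero])
       (use w add smult basis in auto)
qed

end

section \<open>Free products of algebras\<close>

lemma hom_relations_closed:
  assumes "assoc_algebra K B" "assoc_algebra K F" "\<And>x. x \<in> carrier B \<Longrightarrow> j x \<in> carrier F"
  shows "hom_relations K B F j \<subseteq> carrier F"
proof -
  interpret B: assoc_algebra K B by fact
  interpret F: assoc_algebra K F by fact
  show ?thesis by (auto simp: hom_relations_def assms(3))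
qed

lemma hom_relations_quotient:
  assumes "assoc_algebra K B" "algebra_ideal K F I" "\<And>x. x \<in> carrier B \<Longrightarrow> j x \<in> carrier F"
    and "hom_relations K B F j \<subseteq> I"
  shows "(\<lambda>x. I +>\<^bsub>F\<^esub> j x) \<in> algebra_hom K B (quotient_algebra F I)"
proof -
  interpret B: assoc_algebra K B by fact
  interpret I: algebra_ideal K F I by fact
  have eq: "I +>\<^bsub>F\<^esub> u = I +>\<^bsub>F\<^esub> v"
    if "u \<ominus>\<^bsub>F\<^esub> v \<in> hom_relations K B F j" "u \<in> carrier F" "v \<in> carrier F" for u v
    using that assms(4) I.coset_eq_iff by blast
  have "I +>\<^bsub>F\<^esub> j (x \<oplus>\<^bsub>B\<^esub> y) = I +>\<^bsub>F\<^esub> (j x \<oplus>\<^bsub>F\<^esub> j y)" if "x \<in> carrier B" "y \<in> carrier B" for x y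
    by (rule eq) (use that assms(3) in \<open>simp_all add: hom_relations_def, blast?\<close>)
  moreover have "I +>\<^bsub>F\<^esub> j (x \<otimes>\<^bsub>B\<^esub> y) = I +>\<^bsub>F\<^esub> (j x \<otimes>\<^bsub>F\<^esub> j y)" if "x \<in> carrier B" "y \<in> carrier B" for x y
    by (rule eq) (use that assms(3) in \<open>simp_all add: hom_relations_def, blast?\<close>)
  moreover have "I +>\<^bsub>F\<^esub> j (a \<odot>\<^bsub>B\<^esub> x) = I +>\<^bsub>F\<^esub> (a \<odot>\<^bsub>F\<^esub> j x)" if "a \<in> carrier K" "x \<in> carrier B" for a x
    by (rule eq) (use that assms(3) in \<open>simp_all add: hom_relations_def, blast?\<close>)
  moreover have "I +>\<^bsub>F\<^esub> j \<one>\<^bsub>B\<^esub> = I +>\<^bsub>F\<^esub> \<one>\<^bsub>F\<^esub>"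
    by (rule eq) (use assms(3) in \<open>simp_all add: hom_relations_def\<close>)
  ultimately show ?thesis
    by (intro algebra_homI linear_homI)
      (simp_all add: assms(3) I.quotient_add I.quotient_mult I.quotient_smult I.quotient_one)
qed

lemma hom_relations_vanish:
  assumes "assoc_algebra K B" "assoc_algebra K F" "assoc_algebra K C" "\<And>x. x \<in> carrier B \<Longrightarrow> j x \<in> carrier F"
    and "\<Phi> \<in> algebra_hom K F C" "f \<in> algebra_hom K B C" "\<And>x. x \<in> carrier B \<Longrightarrow> \<Phi> (j x) = f x"
    and "r \<in> hom_relations K B F j"
  shows "\<Phi> r = \<zero>\<^bsub>C\<^esub>"
proof -
  interpret B: assoc_algebra K B by fact
  interpret F: assoc_algebra K F by fact
  interpret C: assoc_algebra K C by fact
  note f = algebra_homD[OF assms(6)] and \<Phi> = algebra_homD[OF assms(5)]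
  note m = linear_hom_minus[OF \<Phi>(2) F.module_axioms C.module_axioms]
  from assms(8) consider
      (add) x y where "r = j (x \<oplus>\<^bsub>B\<^esub> y) \<ominus>\<^bsub>F\<^esub> (j x \<oplus>\<^bsub>F\<^esub> j y)" "x \<in> carrier B" "y \<in> carrier B"
    | (smult) a x where "r = j (a \<odot>\<^bsub>B\<^esub> x) \<ominus>\<^bsub>F\<^esub> (a \<odot>\<^bsub>F\<^esub> j x)" "a \<in> carrier K" "x \<in> carrier B"
    | (mult) x y where "r = j (x \<otimes>\<^bsub>B\<^esub> y) \<ominus>\<^bsub>F\<^esub> (j x \<otimes>\<^bsub>F\<^esub> j y)" "x \<in> carrier B" "y \<in> carrier B"
    | (one) "r = j \<one>\<^bsub>B\<^esub> \<ominus>\<^bsub>F\<^esub> \<one>\<^bsub>F\<^esub>"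
    unfolding hom_relations_def by blast
  then show ?thesis
    by cases (simp_all add: m \<Phi>(4-7) f assms(4,7) C.M.minus_zero_iff)
qed

locale free_product_setup = A: assoc_algebra K A + B: assoc_algebra K B for K and A and B
begin

abbreviation (input) "Fr \<equiv> free_algebra K (carrier A <+> carrier B)"
abbreviation (input) "I \<equiv> free_product_ideal K A B"
abbreviation (input) "P \<equiv> free_product K A B"
abbreviation (input) "jl \<equiv> (\<lambda>x. free_gen K (Inl x))"
abbreviation (input) "jr \<equiv> (\<lambda>x. free_gen K (Inr x))"

lemma setup_Fr: "free_algebra_setup K"
  by (rule free_algebra_setup.intro[OF A.K.field_axioms])

lemmas Fr_assoc_algebra = free_algebra_setup.free_assoc_algebra[OF setup_Fr, of "carrier A <+> carrier B"]

lemma gens_closed: "x \<in> carrier A \<Longrightarrow> jl x \<in> carrier Fr" "y \<in> carrier B \<Longrightarrow> jr y \<in> carrier Fr"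
  by (auto intro!: free_algebra_setup.free_gen_closed[OF setup_Fr])

lemma relations_closed: "hom_relations K A Fr jl \<union> hom_relations K B Fr jr \<subseteq> carrier Fr"
  by (rule Un_least[OF hom_relations_closed[OF A.assoc_algebra_axioms Fr_assoc_algebra gens_closed(1)]
        hom_relations_closed[OF B.assoc_algebra_axioms Fr_assoc_algebra gens_closed(2)]])

lemma ideal_I: "algebra_ideal K Fr I"
  unfolding free_product_ideal_def Let_def
  by (rule assoc_algebra.algebra_ideal_genideal[OF Fr_assoc_algebra relations_closed])

lemma relations_I: "hom_relations K A Fr jl \<union> hom_relations K B Fr jr \<subseteq> I"
  unfolding free_product_ideal_def Let_def
  by (rule ring.genideal_self[OF assoc_algebra.axioms(3)[OF Fr_assoc_algebra] relations_closed])

lemma free_product_assoc_algebra: "assoc_algebra K P"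
  unfolding free_product_def by (rule algebra_ideal.quotient_assoc_algebra[OF ideal_I])

lemma inl_hom: "free_product_inl K A B \<in> algebra_hom K A P"
  unfolding free_product_def free_product_inl_def[abs_def]
  by (rule hom_relations_quotient[OF A.assoc_algebra_axioms ideal_I gens_closed(1) subset_trans[OF Un_upper1 relations_I]])

lemma inr_hom: "free_product_inr K A B \<in> algebra_hom K B P"
  unfolding free_product_def free_product_inr_def[abs_def]
  by (rule hom_relations_quotient[OF B.assoc_algebra_axioms ideal_I gens_closed(2) subset_trans[OF Un_upper2 relations_I]])

lemma free_product_universal:
  assumes "assoc_algebra K C" "f \<in> algebra_hom K A C" "f' \<in> algebra_hom K B C"
  shows "\<exists>\<Phi>\<in>algebra_hom K P C. (\<forall>x\<in>carrier A. \<Phi> (free_product_inl K A B x) = f x) \<and>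
    (\<forall>y\<in>carrier B. \<Phi> (free_product_inr K A B y) = f' y)"
proof -
  have "case_sum f f' \<in> carrier A <+> carrier B \<rightarrow> carrier C"
    using algebra_hom_closed[OF assms(2)] algebra_hom_closed[OF assms(3)] by auto
  from free_algebra_setup.free_universal[OF setup_Fr assms(1) this]
  obtain \<Psi> where \<Psi>: "\<Psi> \<in> algebra_hom K Fr C"
    and "\<And>z. z \<in> carrier A <+> carrier B \<Longrightarrow> \<Psi> (free_gen K z) = case_sum f f' z" by blast
  from this(2)[OF InlI] this(2)[OF InrI]
  have gen: "\<And>x. x \<in> carrier A \<Longrightarrow> \<Psi> (jl x) = f x" "\<And>y. y \<in> carrier B \<Longrightarrow> \<Psi> (jr y) = f' y"
    by simp_all
  have van: "\<Psi> r = \<zero>\<^bsub>C\<^esub>" if "r \<in> I" for r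
  proof (rule genideal_vanish[OF \<Psi> Fr_assoc_algebra assms(1) relations_closed])
    show "\<Psi> x = \<zero>\<^bsub>C\<^esub>" if "x \<in> hom_relations K A Fr jl \<union> hom_relations K B Fr jr" for x
      using that hom_relations_vanish[where j = jl and \<Phi> = \<Psi> and f = f, OF A.assoc_algebra_axioms Fr_assoc_algebra assms(1) gens_closed(1) \<Psi> assms(2) gen(1), of x]
        hom_relations_vanish[where j = jr and \<Phi> = \<Psi> and f = f', OF B.assoc_algebra_axioms Fr_assoc_algebra assms(1) gens_closed(2) \<Psi> assms(3) gen(2), of x]
      by blast
    show "r \<in> Idl\<^bsub>Fr\<^esub> (hom_relations K A Fr jl \<union> hom_relations K B Fr jr)"
      using that by (simp add: free_product_ideal_def Let_def)
  qed
  let ?\<Phi> = "\<lambda>U. the_elem (\<Psi> ` U)"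
  have hom: "?\<Phi> \<in> algebra_hom K P C"
    unfolding free_product_def by (rule algebra_ideal.quotient_lift_hom[OF ideal_I \<Psi> assms(1) van])
  note eq = algebra_ideal.quotient_lift_eq[OF ideal_I algebra_hom_linear[OF \<Psi>] assoc_algebra.axioms(1)[OF assms(1)] van]
  have l: "?\<Phi> (free_product_inl K A B x) = f x" if "x \<in> carrier A" for x
    unfolding free_product_inl_def using eq[OF _ gens_closed(1)[OF that]] gen(1)[OF that] by simp
  have r: "?\<Phi> (free_product_inr K A B y) = f' y" if "y \<in> carrier B" for y
    unfolding free_product_inr_def using eq[OF _ gens_closed(2)[OF that]] gen(2)[OF that] by simp
  show ?thesis by (intro bexI[OF _ hom] conjI ballI l r)
qed

text \<open>The unit and the scalars come from the image of \<open>A\<close>, since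
  \<open>a \<odot> u\<close> is the image of \<open>a \<odot> \<one>\<close> times \<open>u\<close>;
  so generators, sums and products cover everything.\<close>

lemma free_product_induct [consumes 1, case_names inl inr add mult]:
  assumes "u \<in> carrier P"
    and inl: "\<And>x. x \<in> carrier A \<Longrightarrow> Q (free_product_inl K A B x)"
    and inr: "\<And>y. y \<in> carrier B \<Longrightarrow> Q (free_product_inr K A B y)"
    and add: "\<And>u v. \<lbrakk>u \<in> carrier P; v \<in> carrier P; Q u; Q v\<rbrakk> \<Longrightarrow> Q (u \<oplus>\<^bsub>P\<^esub> v)"
    and mult: "\<And>u v. \<lbrakk>u \<in> carrier P; v \<in> carrier P; Q u; Q v\<rbrakk> \<Longrightarrow> Q (u \<otimes>\<^bsub>P\<^esub> v)"
  shows "Q u"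
proof -
  interpret I: algebra_ideal K Fr I by (rule ideal_I)
  interpret P: assoc_algebra K P by (rule free_product_assoc_algebra)
  note inl_h = algebra_homD[OF inl_hom]
  have one: "Q \<one>\<^bsub>P\<^esub>" using inl[of "\<one>\<^bsub>A\<^esub>"] inl_h(7) by simp
  have smult: "Q (a \<odot>\<^bsub>P\<^esub> u)" if "a \<in> carrier K" "u \<in> carrier P" "Q u" for a u
  proof -
    have "a \<odot>\<^bsub>P\<^esub> u = free_product_inl K A B (a \<odot>\<^bsub>A\<^esub> \<one>\<^bsub>A\<^esub>) \<otimes>\<^bsub>P\<^esub> u"
      using that by (simp add: inl_h(5,7) P.smult_mult_left)
    then show ?thesis using that by (simp add: mult inl inl_h(3))
  qed
  obtain w where w: "w \<in> carrier Fr" and u: "u = I +>\<^bsub>Fr\<^esub> w"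
    using assms(1) by (auto simp: free_product_def I.quotient_carrier)
  note pr = algebra_homD[OF I.projection_hom, folded free_product_def]
  have "Q (I +>\<^bsub>Fr\<^esub> w)" using w
  proof (induction rule: free_algebra_setup.free_induct[OF setup_Fr, consumes 1])
    case 1
    then show ?case using one pr(7) by simp
  next
    case (2 x)
    then show ?case using inl inr by (auto simp: free_product_inl_def free_product_inr_def)
  qed (simp_all add: pr(3-6) add mult smult)
  then show ?thesis using u by simp
qed

end


section \<open>Generalized ambiskew polynomial algebras\<close>

locale ambiskew_setup = R: assoc_algebra K R for K and R +
  fixes \<tau> \<omega> :: "'b \<Rightarrow> 'b" and c :: 'b and \<xi> :: 'a
  assumes \<tau>_closed: "r \<in> carrier R \<Longrightarrow> \<tau> r \<in> carrier R" and \<omega>_closed: "r \<in> carrier R \<Longrightarrow> \<omega> r \<in> carrier R"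
    and c_closed: "c \<in> carrier R" and \<xi>_closed: "\<xi> \<in> carrier K"
begin

abbreviation (input) "XY \<equiv> free_algebra K {VarX, VarY}"
abbreviation (input) "P \<equiv> adjoin_xy K R"
abbreviation (input) "i \<equiv> free_product_inl K R XY"
abbreviation (input) "x \<equiv> free_product_inr K R XY (free_gen K VarX)"
abbreviation (input) "y \<equiv> free_product_inr K R XY (free_gen K VarY)"
abbreviation (input) "I \<equiv> ambiskew_ideal K R \<tau> \<omega> c \<xi>"
abbreviation (input) "relations \<equiv> {x \<otimes>\<^bsub>P\<^esub> i r \<ominus>\<^bsub>P\<^esub> (i (\<tau> r) \<otimes>\<^bsub>P\<^esub> x) | r. r \<in> carrier R} \<union>
        {y \<otimes>\<^bsub>P\<^esub> i r \<ominus>\<^bsub>P\<^esub> (i (\<omega> r) \<otimes>\<^bsub>P\<^esub> y) | r. r \<in> carrier R} \<union>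
        {(x \<otimes>\<^bsub>P\<^esub> y \<ominus>\<^bsub>P\<^esub> (\<xi> \<odot>\<^bsub>P\<^esub> (y \<otimes>\<^bsub>P\<^esub> x))) \<ominus>\<^bsub>P\<^esub> i c}"
abbreviation "A \<equiv> ambiskew K R \<tau> \<omega> c \<xi>"
abbreviation "\<iota> \<equiv> ambiskew_coeff K R \<tau> \<omega> c \<xi>"
abbreviation "E \<equiv> ambiskew_var K R \<tau> \<omega> c \<xi> VarX"
abbreviation "F \<equiv> ambiskew_var K R \<tau> \<omega> c \<xi> VarY"

lemma setup_XY: "free_algebra_setup K"
  by (rule free_algebra_setup.intro[OF R.K.field_axioms])

lemma setup_P: "free_product_setup K R XY"
  by (intro free_product_setup.intro R.assoc_algebra_axioms free_algebra_setup.free_assoc_algebra[OF setup_XY])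

lemma P_assoc_algebra: "assoc_algebra K P"
  unfolding adjoin_xy_def by (rule free_product_setup.free_product_assoc_algebra[OF setup_P])

lemma i_hom: "i \<in> algebra_hom K R P" and inr_hom: "free_product_inr K R XY \<in> algebra_hom K XY P"
  unfolding adjoin_xy_def
  by (rule free_product_setup.inl_hom[OF setup_P] free_product_setup.inr_hom[OF setup_P])+

lemma xy_closed: "x \<in> carrier P" "y \<in> carrier P"
  by (rule algebra_hom_closed[OF inr_hom], rule free_algebra_setup.free_gen_closed[OF setup_XY], simp)+

lemma ideal_I_gen: "I = genideal P relations"
  by (simp add: ambiskew_ideal_def Let_def)

lemma relations_closed: "relations \<subseteq> carrier P"
proof -
  interpret P: assoc_algebra K P by (rule P_assoc_algebra)
  show ?thesis
    using xy_closed algebra_hom_closed[OF i_hom] \<tau>_closed \<omega>_closed c_closed \<xi>_closed by auto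
qed

lemma ideal_I: "algebra_ideal K P I"
  unfolding ideal_I_gen by (rule assoc_algebra.algebra_ideal_genideal[OF P_assoc_algebra relations_closed])

lemma relations_I: "relations \<subseteq> I"
  unfolding ideal_I_gen
  by (rule ring.genideal_self[OF assoc_algebra.axioms(3)[OF P_assoc_algebra] relations_closed])

lemma ambiskew_assoc_algebra: "assoc_algebra K A"
  unfolding ambiskew_def by (rule algebra_ideal.quotient_assoc_algebra[OF ideal_I])

lemma projection_hom: "(\<lambda>u. I +>\<^bsub>P\<^esub> u) \<in> algebra_hom K P A"
  unfolding ambiskew_def by (rule algebra_ideal.projection_hom[OF ideal_I])

lemma coeff_hom: "\<iota> \<in> algebra_hom K R A"
  unfolding ambiskew_coeff_def[abs_def] by (rule algebra_hom_compose[OF i_hom projection_hom])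

lemma var_closed: "E \<in> carrier A" "F \<in> carrier A"
  unfolding ambiskew_var_def using xy_closed algebra_hom_closed[OF projection_hom] by auto

lemma ambiskew_relations:
  shows "r \<in> carrier R \<Longrightarrow> E \<otimes>\<^bsub>A\<^esub> \<iota> r = \<iota> (\<tau> r) \<otimes>\<^bsub>A\<^esub> E"
    and "r \<in> carrier R \<Longrightarrow> F \<otimes>\<^bsub>A\<^esub> \<iota> r = \<iota> (\<omega> r) \<otimes>\<^bsub>A\<^esub> F"
    and "E \<otimes>\<^bsub>A\<^esub> F \<ominus>\<^bsub>A\<^esub> \<xi> \<odot>\<^bsub>A\<^esub> (F \<otimes>\<^bsub>A\<^esub> E) = \<iota> c"
proof -
  interpret P: assoc_algebra K P by (rule P_assoc_algebra)
  interpret A: assoc_algebra K A by (rule ambiskew_assoc_algebra)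
  note pr = algebra_homD[OF projection_hom]
  note prm = linear_hom_minus[OF pr(2) P.module_axioms A.module_axioms]
  note cl = xy_closed algebra_hom_closed[OF i_hom] \<tau>_closed \<omega>_closed c_closed \<xi>_closed
  have eq: "I +>\<^bsub>P\<^esub> u = I +>\<^bsub>P\<^esub> v" if "u \<ominus>\<^bsub>P\<^esub> v \<in> relations" "u \<in> carrier P" "v \<in> carrier P" for u v
    using that relations_I algebra_ideal.coset_eq_iff[OF ideal_I] by blast
  show "E \<otimes>\<^bsub>A\<^esub> \<iota> r = \<iota> (\<tau> r) \<otimes>\<^bsub>A\<^esub> E" if "r \<in> carrier R"
    using eq[of "x \<otimes>\<^bsub>P\<^esub> i r" "i (\<tau> r) \<otimes>\<^bsub>P\<^esub> x"] that cl
    by (simp add: ambiskew_var_def ambiskew_coeff_def pr(6)[symmetric]) blast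
  show "F \<otimes>\<^bsub>A\<^esub> \<iota> r = \<iota> (\<omega> r) \<otimes>\<^bsub>A\<^esub> F" if "r \<in> carrier R"
    using eq[of "y \<otimes>\<^bsub>P\<^esub> i r" "i (\<omega> r) \<otimes>\<^bsub>P\<^esub> y"] that cl
    by (simp add: ambiskew_var_def ambiskew_coeff_def pr(6)[symmetric]) blast
  have "I +>\<^bsub>P\<^esub> (x \<otimes>\<^bsub>P\<^esub> y \<ominus>\<^bsub>P\<^esub> (\<xi> \<odot>\<^bsub>P\<^esub> (y \<otimes>\<^bsub>P\<^esub> x))) = I +>\<^bsub>P\<^esub> i c"
    by (rule eq) (use cl in auto)
  then show "E \<otimes>\<^bsub>A\<^esub> F \<ominus>\<^bsub>A\<^esub> \<xi> \<odot>\<^bsub>A\<^esub> (F \<otimes>\<^bsub>A\<^esub> E) = \<iota> c"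
    using cl by (simp add: ambiskew_var_def ambiskew_coeff_def prm pr(5,6))
qed

text \<open>Source of every map out of \<open>A\<close> in what follows: the two representations on
  series, the comultiplication, the counit and the antipode. The homomorphism comes from the free
  product and descends because it kills the three families of relations.\<close>

lemma ambiskew_universal:
  assumes "assoc_algebra K B" "f \<in> algebra_hom K R B" "e \<in> carrier B" "e' \<in> carrier B"
    and "\<And>r. r \<in> carrier R \<Longrightarrow> e \<otimes>\<^bsub>B\<^esub> f r = f (\<tau> r) \<otimes>\<^bsub>B\<^esub> e"
    and "\<And>r. r \<in> carrier R \<Longrightarrow> e' \<otimes>\<^bsub>B\<^esub> f r = f (\<omega> r) \<otimes>\<^bsub>B\<^esub> e'"
    and "e \<otimes>\<^bsub>B\<^esub> e' \<ominus>\<^bsub>B\<^esub> \<xi> \<odot>\<^bsub>B\<^esub> (e' \<otimes>\<^bsub>B\<^esub> e) = f c"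
  shows "\<exists>\<Phi>\<in>algebra_hom K A B. (\<forall>r\<in>carrier R. \<Phi> (\<iota> r) = f r) \<and> \<Phi> E = e \<and> \<Phi> F = e'"
proof -
  interpret B: assoc_algebra K B by fact
  interpret P: assoc_algebra K P by (rule P_assoc_algebra)
  have "case_variable e e' \<in> {VarX, VarY} \<rightarrow> carrier B" using assms(3,4) by auto
  from free_algebra_setup.free_universal[OF setup_XY assms(1) this]
  obtain f' where f': "f' \<in> algebra_hom K XY B" "f' (free_gen K VarX) = e" "f' (free_gen K VarY) = e'"
    by auto
  have gXY: "free_gen K VarX \<in> carrier XY" "free_gen K VarY \<in> carrier XY"
    by (rule free_algebra_setup.free_gen_closed[OF setup_XY]; simp)+
  from free_product_setup.free_product_universal[OF setup_P assms(1,2) f'(1), folded adjoin_xy_def]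
  obtain \<Psi> where \<Psi>: "\<Psi> \<in> algebra_hom K P B" and \<Psi>i: "\<And>r. r \<in> carrier R \<Longrightarrow> \<Psi> (i r) = f r"
    and "\<Psi> x = e" "\<Psi> y = e'"
    using f'(2,3) gXY by auto
  note cl = xy_closed algebra_hom_closed[OF i_hom] \<tau>_closed \<omega>_closed c_closed \<xi>_closed
  note \<Psi>h = algebra_homD[OF \<Psi>]
  note \<Psi>m = linear_hom_minus[OF \<Psi>h(2) P.module_axioms B.module_axioms]
  have f_cl: "r \<in> carrier R \<Longrightarrow> f r \<in> carrier B" for r by (rule algebra_hom_closed[OF assms(2)])
  have van: "\<Psi> r = \<zero>\<^bsub>B\<^esub>" if "r \<in> I" for r
  proof (rule genideal_vanish[OF \<Psi> P_assoc_algebra assms(1) relations_closed])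
    show "r \<in> Idl\<^bsub>P\<^esub> relations" using that ideal_I_gen by simp
    fix z assume "z \<in> relations"
    then consider r where "z = x \<otimes>\<^bsub>P\<^esub> i r \<ominus>\<^bsub>P\<^esub> (i (\<tau> r) \<otimes>\<^bsub>P\<^esub> x)" "r \<in> carrier R"
      | r where "z = y \<otimes>\<^bsub>P\<^esub> i r \<ominus>\<^bsub>P\<^esub> (i (\<omega> r) \<otimes>\<^bsub>P\<^esub> y)" "r \<in> carrier R"
      | "z = (x \<otimes>\<^bsub>P\<^esub> y \<ominus>\<^bsub>P\<^esub> (\<xi> \<odot>\<^bsub>P\<^esub> (y \<otimes>\<^bsub>P\<^esub> x))) \<ominus>\<^bsub>P\<^esub> i c" by blast
    then show "\<Psi> z = \<zero>\<^bsub>B\<^esub>"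
      by cases (simp_all add: \<Psi>m \<Psi>h(5,6) cl \<Psi>i \<open>\<Psi> x = e\<close> \<open>\<Psi> y = e'\<close> assms(3-7) f_cl B.M.minus_zero_iff)
  qed
  let ?\<Phi> = "\<lambda>U. the_elem (\<Psi> ` U)"
  have hom: "?\<Phi> \<in> algebra_hom K A B"
    unfolding ambiskew_def by (rule algebra_ideal.quotient_lift_hom[OF ideal_I \<Psi> assms(1) van])
  note eq = algebra_ideal.quotient_lift_eq[OF ideal_I \<Psi>h(2) B.module_axioms van]
  have l: "?\<Phi> (\<iota> r) = f r" if "r \<in> carrier R" for r
    unfolding ambiskew_coeff_def using eq[of "i r"] cl that \<Psi>i by simp
  have r: "?\<Phi> E = e" "?\<Phi> F = e'"
    unfolding ambiskew_var_def using eq[of x] eq[of y] cl \<open>\<Psi> x = e\<close> \<open>\<Psi> y = e'\<close> by simp_all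
  show ?thesis by (intro bexI[OF _ hom] conjI ballI l r)
qed

text \<open>Unit and scalars are coefficients, which leaves generators, sums and products. This form
  serves properties that are not equalities of two homomorphisms, in particular the antipode
  laws.\<close>

lemma ambiskew_induct [consumes 1, case_names coeff E F add mult]:
  assumes "u \<in> carrier A"
    and coeff: "\<And>r. r \<in> carrier R \<Longrightarrow> Q (\<iota> r)" and E: "Q E" and F: "Q F"
    and add: "\<And>u v. \<lbrakk>u \<in> carrier A; v \<in> carrier A; Q u; Q v\<rbrakk> \<Longrightarrow> Q (u \<oplus>\<^bsub>A\<^esub> v)"
    and mult: "\<And>u v. \<lbrakk>u \<in> carrier A; v \<in> carrier A; Q u; Q v\<rbrakk> \<Longrightarrow> Q (u \<otimes>\<^bsub>A\<^esub> v)"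
  shows "Q u"
proof -
  interpret A: assoc_algebra K A by (rule ambiskew_assoc_algebra)
  note pr = algebra_homD[OF projection_hom] and inr = algebra_homD[OF inr_hom]
  note \<iota>h = algebra_homD[OF coeff_hom]
  have one: "Q \<one>\<^bsub>A\<^esub>" using coeff[of "\<one>\<^bsub>R\<^esub>"] \<iota>h(7) by simp
  have smult: "Q (a \<odot>\<^bsub>A\<^esub> u)" if "a \<in> carrier K" "u \<in> carrier A" "Q u" for a u
  proof -
    have "a \<odot>\<^bsub>A\<^esub> u = \<iota> (a \<odot>\<^bsub>R\<^esub> \<one>\<^bsub>R\<^esub>) \<otimes>\<^bsub>A\<^esub> u"
      using that by (simp add: \<iota>h(5,7) A.smult_mult_left)
    then show ?thesis using that by (simp add: mult coeff \<iota>h(3))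
  qed
  have inr_Q: "Q (I +>\<^bsub>P\<^esub> free_product_inr K R XY w)" if "w \<in> carrier XY" for w
    using that
  proof (induction rule: free_algebra_setup.free_induct[OF setup_XY, consumes 1])
    case 1
    then show ?case using one pr(7) inr(7) by simp
  next
    case (2 v)
    then show ?case using E F by (auto simp: ambiskew_var_def)
  qed (simp_all add: inr(3-6) pr(3-6) add mult smult)
  obtain w where w: "w \<in> carrier P" and u: "u = I +>\<^bsub>P\<^esub> w"
    using assms(1) by (auto simp: ambiskew_def algebra_ideal.quotient_carrier[OF ideal_I])
  have "Q (I +>\<^bsub>P\<^esub> w)" using w
    unfolding adjoin_xy_def
  proof (induction rule: free_product_setup.free_product_induct[OF setup_P, consumes 1])
    case (1 r)
    then show ?case using coeff by (simp add: ambiskew_coeff_def adjoin_xy_def)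
  next
    case (2 v)
    then show ?case using inr_Q by (simp add: adjoin_xy_def)
  qed (simp_all flip: adjoin_xy_def add: pr(3-6) add mult)
  then show ?thesis using u by simp
qed

lemma ambiskew_hom_ext:
  assumes "assoc_algebra K B" "f \<in> algebra_hom K A B" "f' \<in> algebra_hom K A B" "u \<in> carrier A"
    and "\<And>r. r \<in> carrier R \<Longrightarrow> f (\<iota> r) = f' (\<iota> r)" "f E = f' E" "f F = f' F"
  shows "f u = f' u"
  using assms(4)
  by (induction rule: ambiskew_induct)
    (simp_all add: assms(5-7) algebra_homD[OF assms(2)] algebra_homD[OF assms(3)])

end

section \<open>Sweedler calculus in a Hopf algebra\<close>

definition trilinear_map ::
  "('k, 'r) ring_scheme \<Rightarrow> ('k, 'a, 'm) module_scheme \<Rightarrow> ('k, 'c, 'l) module_scheme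
    \<Rightarrow> ('a \<Rightarrow> 'a \<Rightarrow> 'a \<Rightarrow> 'c) \<Rightarrow> bool" where
  "trilinear_map K A M t \<longleftrightarrow>
     (\<forall>y\<in>carrier A. \<forall>z\<in>carrier A. (\<lambda>x. t x y z) \<in> linear_hom K A M) \<and>
     (\<forall>x\<in>carrier A. \<forall>z\<in>carrier A. (\<lambda>y. t x y z) \<in> linear_hom K A M) \<and>
     (\<forall>x\<in>carrier A. \<forall>y\<in>carrier A. (\<lambda>z. t x y z) \<in> linear_hom K A M)"

lemma trilinear_mapD:
  assumes "trilinear_map K A M t"
  shows trilinear_1: "y \<in> carrier A \<Longrightarrow> z \<in> carrier A \<Longrightarrow> (\<lambda>x. t x y z) \<in> linear_hom K A M"
    and trilinear_2: "x \<in> carrier A \<Longrightarrow> z \<in> carrier A \<Longrightarrow> (\<lambda>y. t x y z) \<in> linear_hom K A M"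
    and trilinear_3: "x \<in> carrier A \<Longrightarrow> y \<in> carrier A \<Longrightarrow> (\<lambda>z. t x y z) \<in> linear_hom K A M"
    and trilinear_12: "z \<in> carrier A \<Longrightarrow> bilinear_map K A A M (\<lambda>x y. t x y z)"
    and trilinear_23: "x \<in> carrier A \<Longrightarrow> bilinear_map K A A M (\<lambda>y z. t x y z)"
  using assms by (auto simp: trilinear_map_def intro!: bilinear_mapI)

context hopf_algebra
begin

sublocale tensor_triple K H ..

lemmas comult = algebra_homD[OF comult_hom] and counit = algebra_homD[OF counit_hom, simplified]

abbreviation sweedler :: "('a, 'x, 'y) module_scheme \<Rightarrow> ('c \<Rightarrow> 'c \<Rightarrow> 'x) \<Rightarrow> 'c \<Rightarrow> 'x" where
  "sweedler N \<phi> r \<equiv> tensor_lift K N \<phi> (\<Delta> r)"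

lemma ground_module: "module K (ground_algebra K)"
  by (rule assoc_algebra.axioms(1)[OF K.ground_assoc_algebra])

lemma sweedler_linear:
  assumes "bilinear_map K H H N \<phi>" "module K N"
  shows "(\<lambda>r. sweedler N \<phi> r) \<in> linear_hom K H N"
  by (rule linear_hom_compose[OF comult(2) AA.tensor_lift_linear[OF assms]])

lemmas sweedler_cong = AA.tensor_lift_cong[OF _ _ comult(3)]
lemmas sweedler_compose = AA.tensor_lift_compose[OF _ _ _ _ comult(3)]
lemmas sweedler_eqI = AA.tensor_lift_eqI[OF _ _ comult(3)]

text \<open>Coassociativity in the form used for computing with r1, r2, r3: a trilinear
  \<open>t\<close> induces a linear map \<open>?\<Psi>\<close> on H \<otimes> (H \<otimes> H), and
  applying it to the two sides of the axiom gives the two iterated sums.\<close>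

lemma coassoc_trilinear:
  assumes t: "trilinear_map K H N t" and N: "module K N" and r: "r \<in> carrier H"
  shows "sweedler N (\<lambda>x z. sweedler N (\<lambda>x' y. t x' y z) x) r = sweedler N (\<lambda>x y. sweedler N (\<lambda>y' z. t x y' z) y) r"
proof -
  note t12 = trilinear_12[OF t] and t23 = trilinear_23[OF t]
  let ?\<psi> = "\<lambda>x v. tensor_lift K N (\<lambda>y z. t x y z) v"
  have \<psi>: "bilinear_map K H AA N ?\<psi>"
    by (intro bilinear_mapI AA.tensor_lift_linear[OF t23 N]
        AA.tensor_lift_param_linear[OF _ N t23 trilinear_1[OF t] module_axioms])
  let ?\<Psi> = "tensor_lift K N ?\<psi>"
  note \<Psi> = AAr.tensor_lift_linear[OF \<psi> N] and \<Psi>t = AAr.tensor_lift_tensor[OF \<psi> N]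
  note L = linear_hom_compose[OF tensor_assoc_linear \<Psi>]
  have 1: "?\<Psi> (tensor_assoc K H (tensor K AA H w z)) = tensor_lift K N (\<lambda>x' y. t x' y z) w"
    if w: "w \<in> carrier AA" and z: "z \<in> carrier H" for w z
    by (rule AA.linear_ext_tensor[OF w linear_hom_compose[OF AAl.tensor_left[OF z] L] AA.tensor_lift_linear[OF t12[OF z] N]])
      (use z in \<open>simp add: tensor_assoc_tensor \<Psi>t AA.tensor_lift_tensor[OF t23 N] AA.tensor_lift_tensor[OF t12 N]\<close>)
  note m1 = AA.tensor_map_linear[OF AA.tensor_assoc_algebra assoc_algebra_axioms comult(2) linear_hom_id]
  note m2 = AA.tensor_map_linear[OF assoc_algebra_axioms AA.tensor_assoc_algebra linear_hom_id comult(2)]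
  have b1: "bilinear_map K H H N (\<lambda>x z. sweedler N (\<lambda>x' y. t x' y z) x)"
    by (intro bilinear_mapI sweedler_linear[OF t12 N]
        AA.tensor_lift_param_linear[OF comult(3) N t12 trilinear_3[OF t] module_axioms])
  have b2: "bilinear_map K H H N (\<lambda>x y. sweedler N (\<lambda>y' z. t x y' z) y)"
    by (intro bilinear_mapI sweedler_linear[OF t23 N]
        AA.tensor_lift_param_linear[OF comult(3) N t23 trilinear_1[OF t] module_axioms])
  have "sweedler N (\<lambda>x z. sweedler N (\<lambda>x' y. t x' y z) x) r =
    ?\<Psi> (tensor_assoc K H (tensor_map K AA H \<Delta> (\<lambda>x. x) (\<Delta> r)))"
    by (rule sweedler_eqI[OF b1 N r linear_hom_compose[OF m1(1) L]])
      (simp add: m1(2) 1 comult(3))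
  also have "\<dots> = ?\<Psi> (tensor_map K H AA (\<lambda>x. x) \<Delta> (\<Delta> r))"
    using coassoc[OF r] by simp
  also have "\<dots> = sweedler N (\<lambda>x y. sweedler N (\<lambda>y' z. t x y' z) y) r"
    by (rule sweedler_eqI[symmetric, OF b2 N r linear_hom_compose[OF m2(1) \<Psi>]])
      (simp add: m2(2) \<Psi>t comult(3))
  finally show ?thesis .
qed


subsection \<open>Convolution and the antipode\<close>

abbreviation conv :: "('c \<Rightarrow> 'c) \<Rightarrow> ('c \<Rightarrow> 'c) \<Rightarrow> 'c \<Rightarrow> 'c" where
  "conv f f' r \<equiv> sweedler H (\<lambda>x y. f x \<otimes>\<^bsub>H\<^esub> f' y) r"

abbreviation unit_map :: "'c \<Rightarrow> 'c" where
  "unit_map r \<equiv> \<epsilon> r \<odot>\<^bsub>H\<^esub> \<one>\<^bsub>H\<^esub>"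

lemma conv_bilinear:
  "f \<in> linear_hom K H H \<Longrightarrow> f' \<in> linear_hom K H H \<Longrightarrow> bilinear_map K H H H (\<lambda>x y. f x \<otimes>\<^bsub>H\<^esub> f' y)"
  by (rule bilinear_precompose[OF mult_bilinear])

lemma conv_linear:
  "f \<in> linear_hom K H H \<Longrightarrow> f' \<in> linear_hom K H H \<Longrightarrow> (\<lambda>r. conv f f' r) \<in> linear_hom K H H"
  by (rule sweedler_linear[OF conv_bilinear module_axioms])

lemma unit_map_linear: "unit_map \<in> linear_hom K H H"
  by (rule linear_hom_scalar[OF counit(2) A.one_closed])

text \<open>Coassociativity for the trilinear map f1(x) f2(y) f3(z).\<close>

lemma conv_assoc:
  assumes f: "f1 \<in> linear_hom K H H" "f2 \<in> linear_hom K H H" "f3 \<in> linear_hom K H H" and r: "r \<in> carrier H"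
  shows "conv (conv f1 f2) f3 r = conv f1 (conv f2 f3) r"
proof -
  note cl = linear_hom_closed[OF f(1)] linear_hom_closed[OF f(2)] linear_hom_closed[OF f(3)]
  have t: "trilinear_map K H H (\<lambda>x y z. f1 x \<otimes>\<^bsub>H\<^esub> f2 y \<otimes>\<^bsub>H\<^esub> f3 z)"
    unfolding trilinear_map_def
    by (intro conjI ballI linear_hom_mult_left linear_hom_mult_right f A.m_closed cl)
  have "conv (conv f1 f2) f3 r = sweedler H (\<lambda>x z. sweedler H (\<lambda>x' y. f1 x' \<otimes>\<^bsub>H\<^esub> f2 y \<otimes>\<^bsub>H\<^esub> f3 z) x) r"
    by (rule sweedler_cong[OF conv_bilinear[OF conv_linear[OF f(1,2)] f(3)] module_axioms r])
      (rule sweedler_compose[OF conv_bilinear[OF f(1,2)] module_axioms module_axioms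
          linear_hom_mult_right[OF cl(3) linear_hom_id]])
  also have "\<dots> = sweedler H (\<lambda>x y. sweedler H (\<lambda>y' z. f1 x \<otimes>\<^bsub>H\<^esub> f2 y' \<otimes>\<^bsub>H\<^esub> f3 z) y) r"
    by (rule coassoc_trilinear[OF t module_axioms r])
  also have "\<dots> = conv f1 (conv f2 f3) r"
  proof (rule sweedler_cong[symmetric, OF conv_bilinear[OF f(1) conv_linear[OF f(2,3)]] module_axioms r])
    fix x y assume x: "x \<in> carrier H" and y: "y \<in> carrier H"
    have "f1 x \<otimes>\<^bsub>H\<^esub> conv f2 f3 y = sweedler H (\<lambda>y' z. f1 x \<otimes>\<^bsub>H\<^esub> (f2 y' \<otimes>\<^bsub>H\<^esub> f3 z)) y"
      by (rule sweedler_compose[OF conv_bilinear[OF f(2,3)] module_axioms module_axioms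
          linear_hom_mult_left[OF cl(1)[OF x] linear_hom_id] y])
    also have "\<dots> = sweedler H (\<lambda>y' z. f1 x \<otimes>\<^bsub>H\<^esub> f2 y' \<otimes>\<^bsub>H\<^esub> f3 z) y"
      by (rule sweedler_cong[OF bilinear_compose[OF conv_bilinear[OF f(2,3)] linear_hom_mult_left[OF cl(1)[OF x] linear_hom_id]] module_axioms y])
        (simp add: A.m_assoc cl x)
    finally show "f1 x \<otimes>\<^bsub>H\<^esub> conv f2 f3 y = sweedler H (\<lambda>y' z. f1 x \<otimes>\<^bsub>H\<^esub> f2 y' \<otimes>\<^bsub>H\<^esub> f3 z) y" .
  qed
  finally show ?thesis .
qed

lemma conv_unit_right:
  assumes f: "f \<in> linear_hom K H H" and r: "r \<in> carrier H"
  shows "conv f unit_map r = f r"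
proof -
  note b = scalar_bilinear(2)[OF counit(2) linear_hom_id]
  have "conv f unit_map r = sweedler H (\<lambda>x y. f (\<epsilon> y \<odot>\<^bsub>H\<^esub> x)) r"
    by (rule sweedler_cong[OF conv_bilinear[OF f unit_map_linear] module_axioms r])
      (use linear_homD[OF f] counit(3) in \<open>simp add: smult_mult_right\<close>)
  also have "\<dots> = f (sweedler H (\<lambda>x y. \<epsilon> y \<odot>\<^bsub>H\<^esub> x) r)"
    by (rule sweedler_compose[symmetric, OF b module_axioms module_axioms f r])
  finally show ?thesis using counit_right[OF r] by simp
qed

text \<open>The usual cancellation X = (X * T) * T' in the convolution algebra, with
  \<open>T'\<close> a right inverse of \<open>T\<close>. Identities for the antipode are reduced by
  it to identities after convolution, where the antipode axioms apply.\<close>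

lemma conv_right_cancel:
  assumes lin: "X \<in> linear_hom K H H" "Y \<in> linear_hom K H H" "T \<in> linear_hom K H H" "T' \<in> linear_hom K H H"
    and XY: "\<And>r. r \<in> carrier H \<Longrightarrow> conv X T r = conv Y T r"
    and T: "\<And>r. r \<in> carrier H \<Longrightarrow> conv T T' r = unit_map r" and r: "r \<in> carrier H"
  shows "X r = Y r"
proof -
  have *: "Z r = conv (conv Z T) T' r" if Z: "Z \<in> linear_hom K H H" for Z
  proof -
    have "Z r = conv Z unit_map r" by (rule conv_unit_right[symmetric, OF Z r])
    also have "\<dots> = conv Z (conv T T') r"
      by (rule sweedler_cong[OF conv_bilinear[OF Z unit_map_linear] module_axioms r]) (simp add: T)
    also have "\<dots> = conv (conv Z T) T' r"
      by (rule conv_assoc[symmetric, OF Z lin(3,4) r])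
    finally show ?thesis .
  qed
  have "conv (conv X T) T' r = conv (conv Y T) T' r"
    by (rule sweedler_cong[OF conv_bilinear[OF conv_linear[OF lin(1,3)] lin(4)] module_axioms r]) (simp add: XY)
  with * lin show ?thesis by simp
qed

lemma antipode_closed: "r \<in> carrier H \<Longrightarrow> S r \<in> carrier H"
  by (rule linear_hom_closed[OF antipode_linear])

lemma antipode_one: "S \<one>\<^bsub>H\<^esub> = \<one>\<^bsub>H\<^esub>"
  using antipode_left[OF A.one_closed] AA.tensor_lift_tensor[OF conv_bilinear[OF antipode_linear linear_hom_id] module_axioms, of "\<one>\<^bsub>H\<^esub>" "\<one>\<^bsub>H\<^esub>"]
  by (simp add: comult(7) AA.tensor_one counit(7) antipode_closed)

text \<open>With \<open>y\<close> fixed, \<open>x \<mapsto> S(xy)\<close> and \<open>x \<mapsto> S(y)S(x)\<close> have the same convolution product with the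
  identity, which is right invertible; that product is computed by the same argument in \<open>y\<close>.\<close>

lemma antipode_mult:
  assumes x: "x \<in> carrier H" and y: "y \<in> carrier H"
  shows "S (x \<otimes>\<^bsub>H\<^esub> y) = S y \<otimes>\<^bsub>H\<^esub> S x"
proof -
  note S = antipode_linear and id = linear_hom_id[of K H] and mod = module_axioms
  note Sm = linear_hom_compose[OF linear_hom_mult_right[OF _ id] S] and Sm' = linear_hom_compose[OF linear_hom_mult_left[OF _ id] S]
  have b: "bilinear_map K H H H (\<lambda>a b. S (a \<otimes>\<^bsub>H\<^esub> y) \<otimes>\<^bsub>H\<^esub> b)" if "y \<in> carrier H" for y
    by (rule conv_bilinear[OF Sm[OF that] id])
  let ?m = "tensor_lift K H (\<lambda>a b. S a \<otimes>\<^bsub>H\<^esub> b)"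
  note m = AA.tensor_lift_linear[OF conv_bilinear[OF S id] mod]
    and mt = AA.tensor_lift_tensor[OF conv_bilinear[OF S id] mod]
  let ?X = "\<lambda>x y. sweedler H (\<lambda>a b. S (a \<otimes>\<^bsub>H\<^esub> y) \<otimes>\<^bsub>H\<^esub> b) x"
  have X: "?X x y = \<epsilon> x \<odot>\<^bsub>H\<^esub> S y" if x: "x \<in> carrier H" and y: "y \<in> carrier H" for x y
  proof (rule conv_right_cancel[OF _ _ id S _ _ y])
    show Xl: "?X x \<in> linear_hom K H H"
      by (rule AA.tensor_lift_param_linear[OF comult(3)[OF x] mod b _ mod])
        (auto intro!: linear_hom_mult_right Sm')
    show Yl: "(\<lambda>y. \<epsilon> x \<odot>\<^bsub>H\<^esub> S y) \<in> linear_hom K H H"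
      by (rule linear_hom_smult_fun[OF counit(3)[OF x] S])
    show "conv (\<lambda>x. x) S r = unit_map r" if "r \<in> carrier H" for r
      by (rule antipode_right[OF that])
    fix y assume y: "y \<in> carrier H"
    \<comment> \<open>Peels off the second tensor factor, so that convolving \<open>?X x\<close>
      with the identity at \<open>y\<close> becomes \<open>?m\<close> on \<Delta>(x)\<Delta>(y) =
      \<Delta>(xy). There the antipode axiom at xy applies.\<close>
    have 1: "?m (u \<otimes>\<^bsub>AA\<^esub> tensor K H H p q) = tensor_lift K H (\<lambda>a b. S (a \<otimes>\<^bsub>H\<^esub> p) \<otimes>\<^bsub>H\<^esub> b) u \<otimes>\<^bsub>H\<^esub> q"
      if u: "u \<in> carrier AA" and p: "p \<in> carrier H" and q: "q \<in> carrier H" for u p q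
      by (rule AA.linear_ext_tensor[OF u linear_hom_compose[OF AA.T.linear_hom_mult_right[OF AA.tensor_closed[OF p q] linear_hom_id] m]
            linear_hom_mult_right[OF q AA.tensor_lift_linear[OF b[OF p] mod]]])
        (use p q in \<open>simp add: AA.tensor_mult mt AA.tensor_lift_tensor[OF b mod] A.m_assoc antipode_closed\<close>)
    have "conv (?X x) (\<lambda>y. y) y = ?m (\<Delta> x \<otimes>\<^bsub>AA\<^esub> \<Delta> y)"
      by (rule sweedler_eqI[OF conv_bilinear[OF Xl id] mod y
            linear_hom_compose[OF AA.T.linear_hom_mult_left[OF comult(3)[OF x] linear_hom_id] m]])
        (simp add: 1 comult(3) x)
    also have "\<dots> = \<epsilon> (x \<otimes>\<^bsub>H\<^esub> y) \<odot>\<^bsub>H\<^esub> \<one>\<^bsub>H\<^esub>"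
      using antipode_left[of "x \<otimes>\<^bsub>H\<^esub> y"] x y by (simp add: comult(6))
    also have "\<dots> = \<epsilon> x \<odot>\<^bsub>H\<^esub> conv S (\<lambda>y. y) y"
      using x y by (simp add: antipode_left counit(3,6) smult_assoc1)
    also have "\<dots> = sweedler H (\<lambda>a b. \<epsilon> x \<odot>\<^bsub>H\<^esub> (S a \<otimes>\<^bsub>H\<^esub> b)) y"
      by (rule sweedler_compose[OF conv_bilinear[OF S id] mod mod linear_hom_smult_fun[OF counit(3)[OF x] id] y])
    also have "\<dots> = conv (\<lambda>y. \<epsilon> x \<odot>\<^bsub>H\<^esub> S y) (\<lambda>y. y) y"
      by (rule sweedler_cong[symmetric, OF conv_bilinear[OF Yl id] mod y])
        (simp add: smult_mult_left counit(3) x antipode_closed)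
    finally show "conv (?X x) (\<lambda>y. y) y = conv (\<lambda>y. \<epsilon> x \<odot>\<^bsub>H\<^esub> S y) (\<lambda>y. y) y" .
  qed
  show ?thesis
  proof (rule conv_right_cancel[OF Sm[OF y] linear_hom_mult_left[OF antipode_closed[OF y] S] id S _ _ x])
    show "conv (\<lambda>x. x) S r = unit_map r" if "r \<in> carrier H" for r
      by (rule antipode_right[OF that])
    fix x assume x: "x \<in> carrier H"
    have "conv (\<lambda>x. S (x \<otimes>\<^bsub>H\<^esub> y)) (\<lambda>x. x) x = \<epsilon> x \<odot>\<^bsub>H\<^esub> S y" by (rule X[OF x y])
    also have "\<dots> = S y \<otimes>\<^bsub>H\<^esub> conv S (\<lambda>x. x) x"
      using x y by (simp add: antipode_left smult_mult_right counit(3) antipode_closed)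
    also have "\<dots> = sweedler H (\<lambda>a b. S y \<otimes>\<^bsub>H\<^esub> (S a \<otimes>\<^bsub>H\<^esub> b)) x"
      by (rule sweedler_compose[OF conv_bilinear[OF S id] mod mod linear_hom_mult_left[OF antipode_closed[OF y] id] x])
    also have "\<dots> = conv (\<lambda>x. S y \<otimes>\<^bsub>H\<^esub> S x) (\<lambda>x. x) x"
      by (rule sweedler_cong[symmetric, OF conv_bilinear[OF linear_hom_mult_left[OF antipode_closed[OF y] S] id] mod x])
        (simp add: A.m_assoc y antipode_closed)
    finally show "conv (\<lambda>x. S (x \<otimes>\<^bsub>H\<^esub> y)) (\<lambda>x. x) x = conv (\<lambda>x. S y \<otimes>\<^bsub>H\<^esub> S x) (\<lambda>x. x) x" .
  qed
qed


subsection \<open>Group-like elements\<close>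

lemma grouplikeD:
  assumes "g \<in> grouplikes K H \<Delta>"
  shows grouplike_closed: "g \<in> carrier H" and grouplike_nonzero: "g \<noteq> \<zero>\<^bsub>H\<^esub>" and grouplike_comult: "\<Delta> g = tensor K H H g g"
  using assms by (auto simp: grouplikes_def)

lemma grouplike_sweedler:
  assumes "g \<in> grouplikes K H \<Delta>" "bilinear_map K H H N \<phi>" "module K N"
  shows "sweedler N \<phi> g = \<phi> g g"
  using AA.tensor_lift_tensor[OF assms(2,3)] grouplikeD[OF assms(1)] by simp

text \<open>The counit law at \<open>g\<close> gives \<epsilon>(g) g = g; over a field, g being
  nonzero forces \<epsilon>(g) = 1.\<close>

lemma grouplike_counit:
  assumes g: "g \<in> grouplikes K H \<Delta>"
  shows "\<epsilon> g = \<one>\<^bsub>K\<^esub>"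
proof (rule ccontr)
  note gH = grouplike_closed[OF g]
  let ?a = "\<epsilon> g \<ominus>\<^bsub>K\<^esub> \<one>\<^bsub>K\<^esub>"
  assume "\<epsilon> g \<noteq> \<one>\<^bsub>K\<^esub>"
  then have a: "?a \<in> carrier K" "?a \<noteq> \<zero>\<^bsub>K\<^esub>"
    using counit(3)[OF gH] by (auto simp: R.minus_zero_iff)
  then have a': "?a \<in> Units K" using K.field_Units by simp
  have "\<epsilon> g \<odot>\<^bsub>H\<^esub> g = g"
    using counit_left[OF gH] grouplike_sweedler[OF g scalar_bilinear(1)[OF counit(2) linear_hom_id] module_axioms] by simp
  then have "?a \<odot>\<^bsub>H\<^esub> g = \<zero>\<^bsub>H\<^esub>"
    using counit(3)[OF gH] gH by (simp add: a_minus_def smult_l_distr smult_l_minus M.r_neg)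
  moreover have "inv\<^bsub>K\<^esub> ?a \<odot>\<^bsub>H\<^esub> (?a \<odot>\<^bsub>H\<^esub> g) = g"
    using a' gH a(1) by (simp add: smult_assoc1[symmetric])
  ultimately have "g = \<zero>\<^bsub>H\<^esub>" using a' by (metis R.Units_inv_closed smult_r_null)
  with grouplike_nonzero[OF g] show False by simp
qed

lemma grouplike_antipode:
  assumes g: "g \<in> grouplikes K H \<Delta>"
  shows "S g \<otimes>\<^bsub>H\<^esub> g = \<one>\<^bsub>H\<^esub>" "g \<otimes>\<^bsub>H\<^esub> S g = \<one>\<^bsub>H\<^esub>" "inv\<^bsub>H\<^esub> g = S g"
proof -
  note gH = grouplike_closed[OF g]
  show 1: "S g \<otimes>\<^bsub>H\<^esub> g = \<one>\<^bsub>H\<^esub>"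
    using antipode_left[OF gH] grouplike_sweedler[OF g conv_bilinear[OF antipode_linear linear_hom_id] module_axioms]
    by (simp add: grouplike_counit[OF g])
  show 2: "g \<otimes>\<^bsub>H\<^esub> S g = \<one>\<^bsub>H\<^esub>"
    using antipode_right[OF gH] grouplike_sweedler[OF g conv_bilinear[OF linear_hom_id antipode_linear] module_axioms]
    by (simp add: grouplike_counit[OF g])
  show "inv\<^bsub>H\<^esub> g = S g"
    by (rule A.inv_unique'[symmetric, OF gH antipode_closed[OF gH] 2 1])
qed

text \<open>\<open>\<Delta> (S g)\<close> is a left inverse of \<open>\<Delta> g\<close> because
  \<Delta> is multiplicative, S g \<otimes> S g is a right inverse because \<Delta>(g) = g \<otimes>
  g, and a left and a right inverse agree.\<close>

lemma grouplike_antipode_comult: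
  assumes g: "g \<in> grouplikes K H \<Delta>"
  shows "\<Delta> (S g) = tensor K H H (S g) (S g)"
proof -
  note gH = grouplike_closed[OF g] and SH = antipode_closed[OF grouplike_closed[OF g]]
  have 1: "\<Delta> (S g) \<otimes>\<^bsub>AA\<^esub> \<Delta> g = \<one>\<^bsub>AA\<^esub>"
    using gH SH by (simp add: comult(6)[symmetric] grouplike_antipode[OF g] comult(7))
  have 2: "\<Delta> g \<otimes>\<^bsub>AA\<^esub> tensor K H H (S g) (S g) = \<one>\<^bsub>AA\<^esub>"
    using gH SH by (simp add: grouplike_comult[OF g] AA.tensor_mult grouplike_antipode[OF g] AA.tensor_one)
  show ?thesis
    by (rule AA.T.A.inv_unique[OF 1 2]) (simp_all add: comult(3) gH SH)
qed

lemma grouplike_antipode_grouplike: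
  assumes "g \<in> grouplikes K H \<Delta>"
  shows "S g \<in> grouplikes K H \<Delta>" "S (S g) = g"
proof -
  note gH = grouplike_closed[OF assms] and SH = antipode_closed[OF grouplike_closed[OF assms]]
  have "S g \<noteq> \<zero>\<^bsub>H\<^esub>"
  proof
    assume "S g = \<zero>\<^bsub>H\<^esub>"
    then have "\<one>\<^bsub>H\<^esub> = \<zero>\<^bsub>H\<^esub>" using grouplike_antipode(1)[OF assms] gH by simp
    then show False using grouplike_nonzero[OF assms] A.l_one[OF gH] gH by simp
  qed
  then show Sg: "S g \<in> grouplikes K H \<Delta>"
    using SH grouplike_antipode_comult[OF assms] by (simp add: grouplikes_def)
  show "S (S g) = g"
    by (rule A.inv_unique[OF grouplike_antipode(1)[OF Sg] grouplike_antipode(1)[OF assms] SH antipode_closed[OF SH] gH])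
qed

lemma character_grouplike:
  assumes "\<alpha> \<in> characters K H" and g: "g \<in> grouplikes K H \<Delta>"
  shows "\<alpha> g \<in> carrier K" "\<alpha> (S g) \<otimes>\<^bsub>K\<^esub> \<alpha> g = \<one>\<^bsub>K\<^esub>" "\<alpha> g \<noteq> \<zero>\<^bsub>K\<^esub>"
proof -
  note \<alpha> = algebra_homD[OF assms(1)[unfolded characters_def], simplified]
  note gH = grouplike_closed[OF g] and SH = antipode_closed[OF grouplike_closed[OF g]]
  show "\<alpha> g \<in> carrier K" using \<alpha>(3) gH .
  show 1: "\<alpha> (S g) \<otimes>\<^bsub>K\<^esub> \<alpha> g = \<one>\<^bsub>K\<^esub>"
    using \<alpha>(6)[OF SH gH] \<alpha>(7) by (simp add: grouplike_antipode[OF g])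
  then show "\<alpha> g \<noteq> \<zero>\<^bsub>K\<^esub>" using \<alpha>(3)[OF SH] by auto
qed


subsection \<open>Winding automorphisms\<close>

text \<open>Since \<Delta>(g) = g \<otimes> g, and likewise for the inverse \<open>S g\<close>,
  conjugation by \<open>g\<close> becomes conjugation in both tensor factors.\<close>

lemma conjugation_comult:
  assumes g: "g \<in> grouplikes K H \<Delta>" and x: "x \<in> carrier H"
  shows "\<Delta> (g \<otimes>\<^bsub>H\<^esub> x \<otimes>\<^bsub>H\<^esub> S g) =
    sweedler AA (\<lambda>x y. tensor K H H (g \<otimes>\<^bsub>H\<^esub> x \<otimes>\<^bsub>H\<^esub> S g) (g \<otimes>\<^bsub>H\<^esub> y \<otimes>\<^bsub>H\<^esub> S g)) x"
proof -
  note gH = grouplike_closed[OF g] and SH = antipode_closed[OF grouplike_closed[OF g]]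
  have p: "(\<lambda>x. g \<otimes>\<^bsub>H\<^esub> x \<otimes>\<^bsub>H\<^esub> S g) \<in> linear_hom K H H"
    by (intro linear_hom_mult_left linear_hom_mult_right linear_hom_id gH SH)
  have L: "(\<lambda>u. tensor K H H g g \<otimes>\<^bsub>AA\<^esub> u \<otimes>\<^bsub>AA\<^esub> tensor K H H (S g) (S g)) \<in> linear_hom K AA AA"
    by (intro AA.T.linear_hom_mult_left AA.T.linear_hom_mult_right linear_hom_id AA.tensor_closed gH SH)
  have "\<Delta> (g \<otimes>\<^bsub>H\<^esub> x \<otimes>\<^bsub>H\<^esub> S g) = tensor K H H g g \<otimes>\<^bsub>AA\<^esub> \<Delta> x \<otimes>\<^bsub>AA\<^esub> tensor K H H (S g) (S g)"
    using x gH SH by (simp add: comult(6) grouplike_comult[OF g] grouplike_antipode_comult[OF g])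
  also have "\<dots> = sweedler AA (\<lambda>x y. tensor K H H (g \<otimes>\<^bsub>H\<^esub> x \<otimes>\<^bsub>H\<^esub> S g) (g \<otimes>\<^bsub>H\<^esub> y \<otimes>\<^bsub>H\<^esub> S g)) x"
    by (rule sweedler_eqI[symmetric, OF bilinear_precompose[OF AA.tensor_bilinear p p] AA.T.module_axioms x L])
      (simp add: AA.tensor_mult gH SH)
  finally show ?thesis .
qed

text \<open>By coassociativity \<Delta>(\<tau>(r)) = \<alpha>(r1) r2 \<otimes> r3 = \<tau>(r1)
  \<otimes> r2.\<close>

lemma left_winding_comult:
  assumes \<alpha>: "\<alpha> \<in> characters K H" and \<tau>: "\<And>r. r \<in> carrier H \<Longrightarrow> \<tau> r = sweedler H (\<lambda>x y. \<alpha> x \<odot>\<^bsub>H\<^esub> y) r"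
    and r: "r \<in> carrier H"
  shows "\<Delta> (\<tau> r) = tensor_map K H H \<tau> (\<lambda>x. x) (\<Delta> r)"
proof -
  note \<alpha>h = algebra_homD[OF \<alpha>[unfolded characters_def]]
  note \<alpha>c = \<alpha>h(3)[simplified]
  note b = scalar_bilinear(1)[OF \<alpha>h(2) linear_hom_id]
  have \<tau>l: "\<tau> \<in> linear_hom K H H"
    by (rule linear_hom_cong[OF module_axioms sweedler_linear[OF b module_axioms]]) (simp add: \<tau>)
  have t: "trilinear_map K H AA (\<lambda>x y z. \<alpha> x \<odot>\<^bsub>AA\<^esub> tensor K H H y z)"
    unfolding trilinear_map_def
    by (intro conjI ballI AA.T.linear_hom_scalar AA.T.linear_hom_smult_fun \<alpha>h(2) \<alpha>c AA.tensor_closed AA.tensor_left AA.tensor_right)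
  have "tensor_map K H H \<tau> (\<lambda>x. x) (\<Delta> r) =
    sweedler AA (\<lambda>x z. sweedler AA (\<lambda>x' y. \<alpha> x' \<odot>\<^bsub>AA\<^esub> tensor K H H y z) x) r"
    unfolding tensor_map_def
  proof (rule sweedler_cong[OF bilinear_precompose[OF AA.tensor_bilinear \<tau>l linear_hom_id] AA.T.module_axioms r])
    fix x z assume x: "x \<in> carrier H" and z: "z \<in> carrier H"
    show "tensor K H H (\<tau> x) z = sweedler AA (\<lambda>x' y. \<alpha> x' \<odot>\<^bsub>AA\<^esub> tensor K H H y z) x"
      unfolding \<tau>[OF x] sweedler_compose[OF b module_axioms AA.T.module_axioms AA.tensor_left[OF z] x]
      by (rule sweedler_cong[OF bilinear_compose[OF b AA.tensor_left[OF z]] AA.T.module_axioms x])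
        (simp add: linear_hom_smult[OF AA.tensor_left[OF z]] \<alpha>c)
  qed
  also have "\<dots> = sweedler AA (\<lambda>x y. sweedler AA (\<lambda>y z. \<alpha> x \<odot>\<^bsub>AA\<^esub> tensor K H H y z) y) r"
    by (rule coassoc_trilinear[OF t AA.T.module_axioms r])
  also have "\<dots> = sweedler AA (\<lambda>x y. \<Delta> (\<alpha> x \<odot>\<^bsub>H\<^esub> y)) r"
  proof (rule sweedler_cong[symmetric, OF bilinear_compose[OF b comult(2)] AA.T.module_axioms r])
    fix x y assume x: "x \<in> carrier H" and y: "y \<in> carrier H"
    show "\<Delta> (\<alpha> x \<odot>\<^bsub>H\<^esub> y) = sweedler AA (\<lambda>y z. \<alpha> x \<odot>\<^bsub>AA\<^esub> tensor K H H y z) y"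
      using sweedler_compose[OF AA.tensor_bilinear AA.T.module_axioms AA.T.module_axioms
          AA.T.linear_hom_smult_fun[OF \<alpha>c[OF x] linear_hom_id] y]
      by (simp add: AA.tensor_lift_self comult(3,5) x y \<alpha>c)
  qed
  also have "\<dots> = \<Delta> (\<tau> r)"
    unfolding \<tau>[OF r] by (rule sweedler_compose[symmetric, OF b module_axioms AA.T.module_axioms comult(2) r])
  finally show ?thesis by simp
qed

text \<open>Mirror image of the preceding argument. With p the conjugation by \<open>g\<close>,
  which commutes with \<Delta>, one has \<Delta>(\<tau>(r)) = p(r1) \<otimes> p(r2) \<alpha>(r3) =
  p(r1) \<otimes> \<tau>(r2).\<close>

lemma right_winding_comult:
  assumes \<alpha>: "\<alpha> \<in> characters K H" and g: "g \<in> grouplikes K H \<Delta>"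
    and \<tau>: "\<And>r. r \<in> carrier H \<Longrightarrow> \<tau> r = sweedler H (\<lambda>x y. \<alpha> y \<odot>\<^bsub>H\<^esub> (g \<otimes>\<^bsub>H\<^esub> x \<otimes>\<^bsub>H\<^esub> S g)) r"
    and r: "r \<in> carrier H"
  shows "\<Delta> (\<tau> r) = tensor_map K H H (\<lambda>x. g \<otimes>\<^bsub>H\<^esub> x \<otimes>\<^bsub>H\<^esub> S g) \<tau> (\<Delta> r)"
proof -
  let ?p = "\<lambda>x. g \<otimes>\<^bsub>H\<^esub> x \<otimes>\<^bsub>H\<^esub> S g"
  note gH = grouplike_closed[OF g] and SH = antipode_closed[OF grouplike_closed[OF g]]
  have p: "?p \<in> linear_hom K H H"
    by (intro linear_hom_mult_left linear_hom_mult_right linear_hom_id gH SH)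
  note pc = linear_hom_closed[OF p]
  note \<alpha>h = algebra_homD[OF \<alpha>[unfolded characters_def]]
  note \<alpha>c = \<alpha>h(3)[simplified]
  note b = scalar_bilinear(2)[OF \<alpha>h(2) p]
  have \<tau>l: "\<tau> \<in> linear_hom K H H"
    by (rule linear_hom_cong[OF module_axioms sweedler_linear[OF b module_axioms]]) (simp add: \<tau>)
  note tl = linear_hom_compose[OF p AA.tensor_left] and tr = linear_hom_compose[OF p AA.tensor_right]
  have t: "trilinear_map K H AA (\<lambda>x y z. \<alpha> z \<odot>\<^bsub>AA\<^esub> tensor K H H (?p x) (?p y))"
    unfolding trilinear_map_def
    by (intro conjI ballI AA.T.linear_hom_scalar AA.T.linear_hom_smult_fun \<alpha>h(2) \<alpha>c AA.tensor_closed tl tr pc)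
  have "tensor_map K H H ?p \<tau> (\<Delta> r) =
    sweedler AA (\<lambda>x y. sweedler AA (\<lambda>y z. \<alpha> z \<odot>\<^bsub>AA\<^esub> tensor K H H (?p x) (?p y)) y) r"
    unfolding tensor_map_def
  proof (rule sweedler_cong[OF bilinear_precompose[OF AA.tensor_bilinear p \<tau>l] AA.T.module_axioms r])
    fix x y assume x: "x \<in> carrier H" and y: "y \<in> carrier H"
    note px = AA.tensor_right[OF pc[OF x]]
    show "tensor K H H (?p x) (\<tau> y) = sweedler AA (\<lambda>y z. \<alpha> z \<odot>\<^bsub>AA\<^esub> tensor K H H (?p x) (?p y)) y"
      unfolding \<tau>[OF y] sweedler_compose[OF b module_axioms AA.T.module_axioms px y]
      by (rule sweedler_cong[OF bilinear_compose[OF b px] AA.T.module_axioms y])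
        (simp add: linear_hom_smult[OF px] \<alpha>c pc)
  qed
  also have "\<dots> = sweedler AA (\<lambda>x z. sweedler AA (\<lambda>x y. \<alpha> z \<odot>\<^bsub>AA\<^esub> tensor K H H (?p x) (?p y)) x) r"
    by (rule coassoc_trilinear[symmetric, OF t AA.T.module_axioms r])
  also have "\<dots> = sweedler AA (\<lambda>x z. \<Delta> (\<alpha> z \<odot>\<^bsub>H\<^esub> ?p x)) r"
  proof (rule sweedler_cong[symmetric, OF bilinear_compose[OF b comult(2)] AA.T.module_axioms r])
    fix x z assume x: "x \<in> carrier H" and z: "z \<in> carrier H"
    show "\<Delta> (\<alpha> z \<odot>\<^bsub>H\<^esub> ?p x) = sweedler AA (\<lambda>x y. \<alpha> z \<odot>\<^bsub>AA\<^esub> tensor K H H (?p x) (?p y)) x"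
      using sweedler_compose[OF bilinear_precompose[OF AA.tensor_bilinear p p] AA.T.module_axioms AA.T.module_axioms
          AA.T.linear_hom_smult_fun[OF \<alpha>c[OF z] linear_hom_id] x]
      by (simp add: comult(5) conjugation_comult[OF g x] x z \<alpha>c pc)
  qed
  also have "\<dots> = \<Delta> (\<tau> r)"
    unfolding \<tau>[OF r] by (rule sweedler_compose[symmetric, OF b module_axioms AA.T.module_axioms comult(2) r])
  finally show ?thesis by simp
qed

text \<open>Both sides become \<open>\<epsilon>(\<sigma>(r))\<cdot>1\<close> after convolution with \<open>\<sigma>\<close>, by the antipode axiom at \<open>\<sigma>(r)\<close>
  applied to the two expressions for \<open>\<Delta>(\<sigma>(r))\<close>; and \<open>\<sigma>\<close> is right invertible for convolution.\<close>

lemma antipode_twist: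
  assumes \<sigma>: "\<sigma> \<in> algebra_hom K H H" and k: "k \<in> grouplikes K H \<Delta>" and r: "r \<in> carrier H"
    and tw1: "\<And>r. r \<in> carrier H \<Longrightarrow> \<Delta> (\<sigma> r) = tensor_map K H H \<sigma> (\<lambda>x. x) (\<Delta> r)"
    and tw2: "\<And>r. r \<in> carrier H \<Longrightarrow> \<Delta> (\<sigma> r) = tensor_map K H H (\<lambda>x. k \<otimes>\<^bsub>H\<^esub> x \<otimes>\<^bsub>H\<^esub> S k) \<sigma> (\<Delta> r)"
  shows "\<sigma> (S (\<sigma> r)) = k \<otimes>\<^bsub>H\<^esub> S r \<otimes>\<^bsub>H\<^esub> S k"
proof -
  note \<sigma>h = algebra_homD[OF \<sigma>]
  note alg = assoc_algebra_axioms assoc_algebra_axioms and mod = module_axioms and id = linear_hom_id[of K H] and S = antipode_linear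
  note kH = grouplike_closed[OF k] and SkH = antipode_closed[OF grouplike_closed[OF k]]
  let ?p = "\<lambda>x. k \<otimes>\<^bsub>H\<^esub> x \<otimes>\<^bsub>H\<^esub> S k"
  let ?\<alpha> = "\<lambda>r. \<epsilon> (\<sigma> r)"
  have p: "?p \<in> linear_hom K H H"
    by (intro linear_hom_mult_left linear_hom_mult_right id kH SkH)
  have \<alpha>: "?\<alpha> \<in> algebra_hom K H (ground_algebra K)"
    by (rule algebra_hom_compose[OF \<sigma> counit_hom])
  note \<alpha>h = algebra_homD[OF \<alpha>, simplified]
  have X: "(\<lambda>r. \<sigma> (S (\<sigma> r))) \<in> linear_hom K H H"
    by (rule linear_hom_compose[OF linear_hom_compose[OF \<sigma>h(2) S] \<sigma>h(2)])
  have Y: "(\<lambda>r. k \<otimes>\<^bsub>H\<^esub> S r \<otimes>\<^bsub>H\<^esub> S k) \<in> linear_hom K H H"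
    by (intro linear_hom_mult_left linear_hom_mult_right S kH SkH)
  have a: "(\<lambda>r. ?\<alpha> (S r) \<odot>\<^bsub>H\<^esub> \<one>\<^bsub>H\<^esub>) \<in> linear_hom K H H"
    by (rule linear_hom_scalar[OF linear_hom_compose[OF S algebra_hom_linear[OF \<alpha>]] A.one_closed])
  \<comment> \<open>Right convolution inverse of \<sigma>: by \<open>3\<close> below \<sigma> * S is
    r \<mapsto> \<alpha>(r)1, and composing the character \<alpha> = \<epsilon> \<circ> \<sigma>
    with S gives its convolution inverse.\<close>
  let ?T' = "conv S (\<lambda>r. ?\<alpha> (S r) \<odot>\<^bsub>H\<^esub> \<one>\<^bsub>H\<^esub>)"
  have 1: "conv (\<lambda>x. S (\<sigma> x)) (\<lambda>y. y) r = ?\<alpha> r \<odot>\<^bsub>H\<^esub> \<one>\<^bsub>H\<^esub>" if "r \<in> carrier H" for r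
    using AA.tensor_lift_map[OF alg \<sigma>h(2) id conv_bilinear[OF S id] mod comult(3)[OF that]]
      antipode_left[OF \<sigma>h(3)[OF that]] by (simp add: tw1[OF that])
  have 2: "conv (\<lambda>x. S (?p x)) \<sigma> r = ?\<alpha> r \<odot>\<^bsub>H\<^esub> \<one>\<^bsub>H\<^esub>" if "r \<in> carrier H" for r
    using AA.tensor_lift_map[OF alg p \<sigma>h(2) conv_bilinear[OF S id] mod comult(3)[OF that]]
      antipode_left[OF \<sigma>h(3)[OF that]] by (simp add: tw2[OF that])
  have 3: "conv \<sigma> S r = ?\<alpha> r \<odot>\<^bsub>H\<^esub> \<one>\<^bsub>H\<^esub>" if "r \<in> carrier H" for r
    using AA.tensor_lift_map[OF alg \<sigma>h(2) id conv_bilinear[OF id S] mod comult(3)[OF that]]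
      antipode_right[OF \<sigma>h(3)[OF that]] by (simp add: tw1[OF that])
  show ?thesis
  proof (rule conv_right_cancel[OF X Y \<sigma>h(2) conv_linear[OF S a] _ _ r])
    fix r assume r: "r \<in> carrier H"
    have "conv (\<lambda>r. \<sigma> (S (\<sigma> r))) \<sigma> r = sweedler H (\<lambda>x y. \<sigma> (S (\<sigma> x) \<otimes>\<^bsub>H\<^esub> y)) r"
      by (rule sweedler_cong[OF conv_bilinear[OF X \<sigma>h(2)] mod r]) (simp add: \<sigma>h(3,6) antipode_closed)
    also have "\<dots> = \<sigma> (conv (\<lambda>x. S (\<sigma> x)) (\<lambda>y. y) r)"
      by (rule sweedler_compose[symmetric, OF conv_bilinear[OF linear_hom_compose[OF \<sigma>h(2) S] id] mod mod \<sigma>h(2) r])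
    also have "\<dots> = ?\<alpha> r \<odot>\<^bsub>H\<^esub> \<one>\<^bsub>H\<^esub>"
      using r by (simp add: 1 \<sigma>h(5,7) \<alpha>h(3))
    also have "\<dots> = conv (\<lambda>x. S (?p x)) \<sigma> r" by (rule 2[OF r, symmetric])
    \<comment> \<open>S(k x S(k)) = k S(x) S(k), because S reverses products and S(S(k)) = k for a
      group-like k.\<close>
    also have "\<dots> = conv (\<lambda>r. k \<otimes>\<^bsub>H\<^esub> S r \<otimes>\<^bsub>H\<^esub> S k) \<sigma> r"
      by (rule sweedler_cong[OF conv_bilinear[OF linear_hom_compose[OF p S] \<sigma>h(2)] mod r])
        (simp add: antipode_mult kH SkH antipode_closed grouplike_antipode_grouplike[OF k] A.m_assoc)
    finally show "conv (\<lambda>r. \<sigma> (S (\<sigma> r))) \<sigma> r = conv (\<lambda>r. k \<otimes>\<^bsub>H\<^esub> S r \<otimes>\<^bsub>H\<^esub> S k) \<sigma> r" .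
  next
    fix r assume r: "r \<in> carrier H"
    have "conv \<sigma> ?T' r = conv (conv \<sigma> S) (\<lambda>r. ?\<alpha> (S r) \<odot>\<^bsub>H\<^esub> \<one>\<^bsub>H\<^esub>) r"
      by (rule conv_assoc[symmetric, OF \<sigma>h(2) S a r])
    also have "\<dots> = sweedler H (\<lambda>x y. ?\<alpha> (x \<otimes>\<^bsub>H\<^esub> S y) \<odot>\<^bsub>H\<^esub> \<one>\<^bsub>H\<^esub>) r"
      by (rule sweedler_cong[OF conv_bilinear[OF conv_linear[OF \<sigma>h(2) S] a] mod r])
        (simp add: 3 \<alpha>h(3,6) antipode_closed smult_mult_left smult_assoc1)
    also have "\<dots> = ?\<alpha> (conv (\<lambda>x. x) S r) \<odot>\<^bsub>H\<^esub> \<one>\<^bsub>H\<^esub>"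
      by (rule sweedler_compose[symmetric, OF conv_bilinear[OF id S] mod mod linear_hom_scalar[OF algebra_hom_linear[OF \<alpha>] A.one_closed] r])
    also have "\<dots> = unit_map r"
      using r by (simp add: antipode_right \<alpha>h(5,7) counit(3))
    finally show "conv \<sigma> ?T' r = unit_map r" .
  qed
qed

end

section \<open>Verma modules\<close>

text \<open>Restricting to extensional functions makes maps that agree on the carrier equal, so the
  algebra axioms hold as equations.\<close>

definition endo_algebra :: "('k, 'r) ring_scheme \<Rightarrow> ('k, 'a, 'm) module_scheme \<Rightarrow> ('k, 'a \<Rightarrow> 'a) module" where
  "endo_algebra K N = \<lparr>carrier = linear_hom K N N \<inter> extensional (carrier N),
     mult = (\<lambda>f g. \<lambda>x\<in>carrier N. f (g x)), one = (\<lambda>x\<in>carrier N. x),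
     zero = (\<lambda>x\<in>carrier N. \<zero>\<^bsub>N\<^esub>), add = (\<lambda>f g. \<lambda>x\<in>carrier N. f x \<oplus>\<^bsub>N\<^esub> g x),
     smult = (\<lambda>a f. \<lambda>x\<in>carrier N. a \<odot>\<^bsub>N\<^esub> f x)\<rparr>"

lemma endo_carrier: "f \<in> carrier (endo_algebra K N) \<longleftrightarrow> f \<in> linear_hom K N N \<and> f \<in> extensional (carrier N)"
  by (simp add: endo_algebra_def)

lemma endo_eqI:
  assumes "f \<in> carrier (endo_algebra K N)" "g \<in> carrier (endo_algebra K N)"
    and "\<And>x. x \<in> carrier N \<Longrightarrow> f x = g x"
  shows "f = g"
  using assms by (auto simp: endo_carrier intro: extensionalityI)

lemma (in module) endo_restrict:
  "f \<in> linear_hom R M M \<Longrightarrow> restrict f (carrier M) \<in> carrier (endo_algebra R M)"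
  using linear_hom_cong[OF module_axioms, of f M "restrict f (carrier M)"] by (simp add: endo_carrier)

lemma endo_apply:
  "x \<in> carrier N \<Longrightarrow> (f \<otimes>\<^bsub>endo_algebra K N\<^esub> g) x = f (g x)"
  "x \<in> carrier N \<Longrightarrow> (f \<oplus>\<^bsub>endo_algebra K N\<^esub> g) x = f x \<oplus>\<^bsub>N\<^esub> g x"
  "x \<in> carrier N \<Longrightarrow> (a \<odot>\<^bsub>endo_algebra K N\<^esub> f) x = a \<odot>\<^bsub>N\<^esub> f x"
  "x \<in> carrier N \<Longrightarrow> \<one>\<^bsub>endo_algebra K N\<^esub> x = x"
  "x \<in> carrier N \<Longrightarrow> \<zero>\<^bsub>endo_algebra K N\<^esub> x = \<zero>\<^bsub>N\<^esub>"
  by (simp_all add: endo_algebra_def)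

lemma (in module) endo_closed:
  shows endo_mult_closed: "f \<in> carrier (endo_algebra R M) \<Longrightarrow> g \<in> carrier (endo_algebra R M) \<Longrightarrow>
      f \<otimes>\<^bsub>endo_algebra R M\<^esub> g \<in> carrier (endo_algebra R M)"
    and endo_add_closed: "f \<in> carrier (endo_algebra R M) \<Longrightarrow> g \<in> carrier (endo_algebra R M) \<Longrightarrow>
      f \<oplus>\<^bsub>endo_algebra R M\<^esub> g \<in> carrier (endo_algebra R M)"
    and endo_smult_closed: "a \<in> carrier R \<Longrightarrow> f \<in> carrier (endo_algebra R M) \<Longrightarrow>
      a \<odot>\<^bsub>endo_algebra R M\<^esub> f \<in> carrier (endo_algebra R M)"
    and endo_one_closed: "\<one>\<^bsub>endo_algebra R M\<^esub> \<in> carrier (endo_algebra R M)"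
    and endo_zero_closed: "\<zero>\<^bsub>endo_algebra R M\<^esub> \<in> carrier (endo_algebra R M)"
proof -
  have eq: "f \<otimes>\<^bsub>endo_algebra R M\<^esub> g = (\<lambda>x\<in>carrier M. f (g x))"
    "f \<oplus>\<^bsub>endo_algebra R M\<^esub> g = (\<lambda>x\<in>carrier M. f x \<oplus>\<^bsub>M\<^esub> g x)"
    "a \<odot>\<^bsub>endo_algebra R M\<^esub> f = (\<lambda>x\<in>carrier M. a \<odot>\<^bsub>M\<^esub> f x)"
    "\<one>\<^bsub>endo_algebra R M\<^esub> = (\<lambda>x\<in>carrier M. x)" "\<zero>\<^bsub>endo_algebra R M\<^esub> = (\<lambda>x\<in>carrier M. \<zero>\<^bsub>M\<^esub>)" for a f g
    by (simp_all add: endo_algebra_def)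
  have lin: "f \<in> carrier (endo_algebra R M) \<Longrightarrow> f \<in> linear_hom R M M" for f by (simp add: endo_carrier)
  show "f \<otimes>\<^bsub>endo_algebra R M\<^esub> g \<in> carrier (endo_algebra R M)"
    if "f \<in> carrier (endo_algebra R M)" "g \<in> carrier (endo_algebra R M)"
    unfolding eq by (rule endo_restrict[OF linear_hom_compose[OF lin[OF that(2)] lin[OF that(1)]]])
  show "f \<oplus>\<^bsub>endo_algebra R M\<^esub> g \<in> carrier (endo_algebra R M)"
    if "f \<in> carrier (endo_algebra R M)" "g \<in> carrier (endo_algebra R M)"
    unfolding eq by (rule endo_restrict[OF linear_hom_add_fun[OF lin[OF that(1)] lin[OF that(2)]]])
  show "a \<odot>\<^bsub>endo_algebra R M\<^esub> f \<in> carrier (endo_algebra R M)"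
    if "a \<in> carrier R" "f \<in> carrier (endo_algebra R M)"
    unfolding eq by (rule endo_restrict[OF linear_hom_smult_fun[OF that(1) lin[OF that(2)]]])
  show "\<one>\<^bsub>endo_algebra R M\<^esub> \<in> carrier (endo_algebra R M)"
    unfolding eq by (rule endo_restrict[OF linear_hom_id])
  show "\<zero>\<^bsub>endo_algebra R M\<^esub> \<in> carrier (endo_algebra R M)"
    unfolding eq by (rule endo_restrict[OF linear_hom_zero_fun])
qed

lemma (in module) endo_assoc_algebra:
  assumes "field R"
  shows "assoc_algebra R (endo_algebra R M)"
proof -
  let ?E = "endo_algebra R M"
  have cl: "f \<in> carrier ?E \<Longrightarrow> x \<in> carrier M \<Longrightarrow> f x \<in> carrier M" for f x
    by (auto simp: endo_carrier dest: linear_hom_closed)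
  have add: "f \<in> carrier ?E \<Longrightarrow> x \<in> carrier M \<Longrightarrow> y \<in> carrier M \<Longrightarrow> f (x \<oplus>\<^bsub>M\<^esub> y) = f x \<oplus>\<^bsub>M\<^esub> f y" for f x y
    by (auto simp: endo_carrier dest: linear_hom_add)
  have smult: "f \<in> carrier ?E \<Longrightarrow> a \<in> carrier R \<Longrightarrow> x \<in> carrier M \<Longrightarrow> f (a \<odot>\<^bsub>M\<^esub> x) = a \<odot>\<^bsub>M\<^esub> f x" for f a x
    by (auto simp: endo_carrier dest: linear_hom_smult)
  note s = endo_closed endo_apply cl add smult
  have ab: "abelian_group ?E"
  proof (rule abelian_groupI)
    fix f assume f: "f \<in> carrier ?E"
    have "((\<ominus>\<^bsub>R\<^esub> \<one>\<^bsub>R\<^esub>) \<odot>\<^bsub>?E\<^esub> f) \<oplus>\<^bsub>?E\<^esub> f = \<zero>\<^bsub>?E\<^esub>"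
      by (rule endo_eqI[of _ R M]) (use f in \<open>simp_all add: s smult_l_minus M.l_neg\<close>)
    then show "\<exists>g\<in>carrier ?E. g \<oplus>\<^bsub>?E\<^esub> f = \<zero>\<^bsub>?E\<^esub>"
      using f by (intro bexI[of _ "(\<ominus>\<^bsub>R\<^esub> \<one>\<^bsub>R\<^esub>) \<odot>\<^bsub>?E\<^esub> f"]) (simp_all add: s)
  next
    fix f g k assume "f \<in> carrier ?E" "g \<in> carrier ?E" "k \<in> carrier ?E"
    then show "f \<oplus>\<^bsub>?E\<^esub> g \<oplus>\<^bsub>?E\<^esub> k = f \<oplus>\<^bsub>?E\<^esub> (g \<oplus>\<^bsub>?E\<^esub> k)"
      by (intro endo_eqI[of _ R M]) (simp_all add: s M.a_assoc)
  next
    fix f g assume "f \<in> carrier ?E" "g \<in> carrier ?E"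
    then show "f \<oplus>\<^bsub>?E\<^esub> g = g \<oplus>\<^bsub>?E\<^esub> f"
      by (intro endo_eqI[of _ R M]) (simp_all add: s M.a_comm)
  next
    fix f assume "f \<in> carrier ?E"
    then show "\<zero>\<^bsub>?E\<^esub> \<oplus>\<^bsub>?E\<^esub> f = f"
      by (intro endo_eqI[of _ R M]) (simp_all add: s)
  qed (simp_all add: s)
  have mod: "module R ?E"
    by (rule moduleI[OF R.cring_axioms ab]; (rule endo_eqI[of _ R M])?)
      (simp_all add: s smult_l_distr smult_r_distr smult_assoc1)
  have mon: "monoid ?E"
    by (rule monoidI; (rule endo_eqI[of _ R M])?) (simp_all add: s)
  have ring: "ring ?E"
    by (rule ringI[OF ab mon]; rule endo_eqI[of _ R M]) (simp_all add: s)
  show ?thesis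
    by (intro assoc_algebra.intro assoc_algebra_axioms.intro mod ring assms; rule endo_eqI[of _ R M])
      (simp_all add: s)
qed

text \<open>The n-th entry is the coefficient of the n-th power of the variable. Admitting all
  sequences leaves no condition on supports to verify for the operators of the
  representation.\<close>

definition seq_module :: "('k, 'a, 'm) module_scheme \<Rightarrow> ('k, nat \<Rightarrow> 'a) module" where
  "seq_module N = \<lparr>carrier = {m. \<forall>n. m n \<in> carrier N}, mult = undefined, one = undefined,
     zero = (\<lambda>n. \<zero>\<^bsub>N\<^esub>), add = (\<lambda>m m' n. m n \<oplus>\<^bsub>N\<^esub> m' n), smult = (\<lambda>a m n. a \<odot>\<^bsub>N\<^esub> m n)\<rparr>"

lemma seq_simps:
  "m \<in> carrier (seq_module N) \<longleftrightarrow> (\<forall>n. m n \<in> carrier N)" "\<zero>\<^bsub>seq_module N\<^esub> = (\<lambda>n. \<zero>\<^bsub>N\<^esub>)"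
  "m \<oplus>\<^bsub>seq_module N\<^esub> m' = (\<lambda>n. m n \<oplus>\<^bsub>N\<^esub> m' n)" "a \<odot>\<^bsub>seq_module N\<^esub> m = (\<lambda>n. a \<odot>\<^bsub>N\<^esub> m n)"
  by (simp_all add: seq_module_def)

lemma (in module) seq_module: "module R (seq_module M)"
proof (rule moduleI[OF R.cring_axioms])
  show "abelian_group (seq_module M)"
  proof (rule abelian_groupI)
    fix m assume "m \<in> carrier (seq_module M)"
    then show "\<exists>m'\<in>carrier (seq_module M). m' \<oplus>\<^bsub>seq_module M\<^esub> m = \<zero>\<^bsub>seq_module M\<^esub>"
      by (intro bexI[of _ "\<lambda>n. \<ominus>\<^bsub>M\<^esub> m n"]) (simp_all add: seq_simps M.l_neg)
  qed (simp_all add: seq_simps M.a_ac)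
qed (simp_all add: seq_simps smult_l_distr smult_r_distr smult_assoc1)

text \<open>The induced module \<open>A/AY\<close>, completed to formal series \<open>\<Sum> m\<^sub>i X\<^sup>i\<close>. The relation
  \<open>XY - \<xi>YX = c\<close> forces \<open>Y X\<^sup>i\<^sup>+\<^sup>1 = d\<^sub>i\<^sub>+\<^sub>1 X\<^sup>i\<close> with \<open>d\<^sub>0 = 0\<close> and \<open>\<xi> d\<^sub>i\<^sub>+\<^sub>1 = \<tau>(d\<^sub>i) - c\<close>.
  It replaces the PBW basis: the coefficients of \<open>1\<close> and \<open>X\<close> of \<open>u\<cdot>1\<close> are linear in \<open>u\<close>.\<close>

lemma (in assoc_algebra) verma_module:
  assumes \<tau>: "\<tau> \<in> algebra_hom K A A" and \<omega>: "\<omega> \<in> algebra_hom K A A"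
    and comm: "\<And>r. r \<in> carrier A \<Longrightarrow> \<tau> (\<omega> r) = \<omega> (\<tau> r)"
    and c: "c \<in> sigma_center A (\<tau> \<circ> \<omega>)" and \<xi>: "\<xi> \<in> carrier K - {\<zero>\<^bsub>K\<^esub>}"
  defines "B \<equiv> endo_algebra K (seq_module A)"
  shows "\<exists>f\<in>algebra_hom K A B. \<exists>X\<in>carrier B. \<exists>Y\<in>carrier B.
    \<exists>p0\<in>linear_hom K B A. \<exists>p1\<in>linear_hom K B A.
    (\<forall>r\<in>carrier A. X \<otimes>\<^bsub>B\<^esub> f r = f (\<tau> r) \<otimes>\<^bsub>B\<^esub> X \<and> Y \<otimes>\<^bsub>B\<^esub> f r = f (\<omega> r) \<otimes>\<^bsub>B\<^esub> Y) \<and>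
    X \<otimes>\<^bsub>B\<^esub> Y \<ominus>\<^bsub>B\<^esub> \<xi> \<odot>\<^bsub>B\<^esub> (Y \<otimes>\<^bsub>B\<^esub> X) = f c \<and>
    (\<forall>r\<in>carrier A. p0 (f r) = r \<and> p1 (f r) = \<zero>\<^bsub>A\<^esub> \<and> p0 (f r \<otimes>\<^bsub>B\<^esub> X) = \<zero>\<^bsub>A\<^esub> \<and> p1 (f r \<otimes>\<^bsub>B\<^esub> X) = r \<and>
      p1 (f r \<otimes>\<^bsub>B\<^esub> Y) = \<zero>\<^bsub>A\<^esub>)"
proof -
  define N where "N = seq_module A"
  have B: "B = endo_algebra K N" by (simp add: B_def N_def)
  interpret N: module K N unfolding N_def by (rule seq_module)
  interpret B: assoc_algebra K B unfolding B by (rule N.endo_assoc_algebra[OF K.field_axioms])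
  note \<tau>h = algebra_homD[OF \<tau>] and \<omega>h = algebra_homD[OF \<omega>]
  have cA: "c \<in> carrier A" and cz: "\<And>r. r \<in> carrier A \<Longrightarrow> c \<otimes>\<^bsub>A\<^esub> r = \<tau> (\<omega> r) \<otimes>\<^bsub>A\<^esub> c"
    using c by (auto simp: sigma_center_def)
  have \<xi>K: "\<xi> \<in> carrier K" "\<xi> \<in> Units K" using \<xi> K.field_Units by auto
  define \<xi>' where "\<xi>' = inv\<^bsub>K\<^esub> \<xi>"
  have \<xi>': "\<xi>' \<in> carrier K" "\<xi> \<otimes>\<^bsub>K\<^esub> \<xi>' = \<one>\<^bsub>K\<^esub>" using \<xi>K by (simp_all add: \<xi>'_def)
  define d where "d = rec_nat \<zero>\<^bsub>A\<^esub> (\<lambda>n x. \<xi>' \<odot>\<^bsub>A\<^esub> (\<tau> x \<ominus>\<^bsub>A\<^esub> c))"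
  have d0: "d 0 = \<zero>\<^bsub>A\<^esub>" and dS: "d (Suc n) = \<xi>' \<odot>\<^bsub>A\<^esub> (\<tau> (d n) \<ominus>\<^bsub>A\<^esub> c)" for n by (simp_all add: d_def)
  have dA: "d n \<in> carrier A" for n
    by (induction n) (simp_all add: d0 dS \<xi>' \<tau>h(3) cA)
  have xd: "\<xi> \<odot>\<^bsub>A\<^esub> d (Suc n) = \<tau> (d n) \<ominus>\<^bsub>A\<^esub> c" for n
    using \<xi>K \<xi>' by (simp add: dS smult_assoc1[symmetric] \<tau>h(3) dA cA)
  define f where "f = (\<lambda>r. \<lambda>m\<in>carrier N. \<lambda>n. r \<otimes>\<^bsub>A\<^esub> m n)"
  \<comment> \<open>The operators are read off from moving the variables to the right past the
    coefficients: X m X^n = \<tau>(m) X^(n+1) and Y m X^(n+1) = \<omega>(m) d_(n+1) X^n.\<close>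
  define X where "X = (\<lambda>m\<in>carrier N. \<lambda>n. case n of 0 \<Rightarrow> \<zero>\<^bsub>A\<^esub> | Suc n \<Rightarrow> \<tau> (m n))"
  define Y where "Y = (\<lambda>m\<in>carrier N. \<lambda>n. \<omega> (m (Suc n)) \<otimes>\<^bsub>A\<^esub> d (Suc n))"
  have mN: "m n \<in> carrier A" if "m \<in> carrier N" for m n using that by (simp add: N_def seq_simps)
  have fB: "f r \<in> carrier B" if "r \<in> carrier A" for r
    unfolding B f_def
    by (rule N.endo_restrict, rule linear_homI)
      (use that in \<open>simp_all add: N_def seq_simps A.r_distr smult_mult_right\<close>)
  have XB: "X \<in> carrier B"
    unfolding B X_def
    by (rule N.endo_restrict, rule linear_homI)
      (auto simp: N_def seq_simps \<tau>h fun_eq_iff split: nat.split)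
  have YB: "Y \<in> carrier B"
    unfolding B Y_def
    by (rule N.endo_restrict, rule linear_homI)
      (simp_all add: N_def seq_simps \<omega>h dA A.l_distr smult_mult_left)
  have fap: "f r m = (\<lambda>n. r \<otimes>\<^bsub>A\<^esub> m n)" if "m \<in> carrier N" for r m using that by (simp add: f_def)
  have Xap: "X m = (\<lambda>n. case n of 0 \<Rightarrow> \<zero>\<^bsub>A\<^esub> | Suc n \<Rightarrow> \<tau> (m n))" if "m \<in> carrier N" for m
    using that by (simp add: X_def)
  have Yap: "Y m = (\<lambda>n. \<omega> (m (Suc n)) \<otimes>\<^bsub>A\<^esub> d (Suc n))" if "m \<in> carrier N" for m
    using that by (simp add: Y_def)
  have BN: "u m \<in> carrier N" if "u \<in> carrier B" "m \<in> carrier N" for u m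
    using that unfolding B by (auto simp: endo_carrier dest: linear_hom_closed)
  have ncl: "r \<in> carrier A \<Longrightarrow> m \<in> carrier N \<Longrightarrow> (\<lambda>n. r \<otimes>\<^bsub>A\<^esub> m n) \<in> carrier N"
    "m \<in> carrier N \<Longrightarrow> (\<lambda>n. case n of 0 \<Rightarrow> \<zero>\<^bsub>A\<^esub> | Suc n \<Rightarrow> \<tau> (m n)) \<in> carrier N"
    "m \<in> carrier N \<Longrightarrow> (\<lambda>n. \<omega> (m (Suc n)) \<otimes>\<^bsub>A\<^esub> d (Suc n)) \<in> carrier N" for r m
    by (auto simp: N_def seq_simps \<tau>h(3) \<omega>h(3) dA split: nat.split)
  note ap = endo_apply[where K = K and N = N, folded B]
  have eqI: "u = v" if "u \<in> carrier B" "v \<in> carrier B" "\<And>m n. m \<in> carrier N \<Longrightarrow> u m n = v m n" for u v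
    using that by (auto simp: B intro!: endo_eqI[of u K N v])
  have f: "f \<in> algebra_hom K A B"
    by (rule algebra_homI[OF linear_homI]; (rule eqI)?)
      (simp_all add: fB fap ap BN ncl mN, simp_all add: N_def seq_simps A.l_distr smult_mult_left A.m_assoc)
  have r1: "X \<otimes>\<^bsub>B\<^esub> f r = f (\<tau> r) \<otimes>\<^bsub>B\<^esub> X" if "r \<in> carrier A" for r
    by (rule eqI) (use that in \<open>simp_all add: XB fB ap BN ncl Xap fap \<tau>h mN split: nat.split\<close>)
  have r2: "Y \<otimes>\<^bsub>B\<^esub> f r = f (\<omega> r) \<otimes>\<^bsub>B\<^esub> Y" if "r \<in> carrier A" for r
    by (rule eqI) (use that in \<open>simp_all add: YB fB ap BN ncl Yap fap \<omega>h mN dA A.m_assoc\<close>)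
  have "X \<otimes>\<^bsub>B\<^esub> Y = f c \<oplus>\<^bsub>B\<^esub> \<xi> \<odot>\<^bsub>B\<^esub> (Y \<otimes>\<^bsub>B\<^esub> X)"
  proof (rule eqI)
    fix m n assume m: "m \<in> carrier N"
    let ?s = "\<tau> (\<omega> (m n))"
    note cl = mN[OF m] \<tau>h(3) \<omega>h(3) dA cA \<xi>K(1)
    \<comment> \<open>For n = 0 the left side vanishes since X produces no constant term, and the
      right side because d_0 = 0; for n > 0 the left side is \<tau> applied to \<omega>(m_n)
      d_n.\<close>
    have L: "(X \<otimes>\<^bsub>B\<^esub> Y) m n = ?s \<otimes>\<^bsub>A\<^esub> \<tau> (d n)"
      by (cases n) (simp_all add: ap m BN ncl YB Xap Yap \<tau>h cl d0 linear_hom_zero[OF \<tau>h(2) module_axioms module_axioms])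
    have "(f c \<oplus>\<^bsub>B\<^esub> \<xi> \<odot>\<^bsub>B\<^esub> (Y \<otimes>\<^bsub>B\<^esub> X)) m n = c \<otimes>\<^bsub>A\<^esub> m n \<oplus>\<^bsub>A\<^esub> \<xi> \<odot>\<^bsub>A\<^esub> (\<omega> (\<tau> (m n)) \<otimes>\<^bsub>A\<^esub> d (Suc n))"
      by (simp add: ap m BN ncl XB YB fap Xap Yap, simp add: N_def seq_simps)
    \<comment> \<open>Here \<sigma>-centrality moves c to the right of the coefficient, and the
      commutation of \<tau> with \<omega> gives both terms the same left factor. The recursion
      \<open>xd\<close> then lets the two occurrences of c cancel.\<close>
    also have "\<dots> = ?s \<otimes>\<^bsub>A\<^esub> c \<oplus>\<^bsub>A\<^esub> ?s \<otimes>\<^bsub>A\<^esub> (\<tau> (d n) \<ominus>\<^bsub>A\<^esub> c)"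
      by (simp add: cz comm cl smult_mult_right[symmetric] xd)
    also have "\<dots> = ?s \<otimes>\<^bsub>A\<^esub> (c \<oplus>\<^bsub>A\<^esub> (\<tau> (d n) \<ominus>\<^bsub>A\<^esub> c))"
      by (simp add: A.r_distr cl)
    also have "c \<oplus>\<^bsub>A\<^esub> (\<tau> (d n) \<ominus>\<^bsub>A\<^esub> c) = \<tau> (d n)"
      using cl by (simp add: a_minus_def M.a_lcomm[of c] M.r_neg)
    finally show "(X \<otimes>\<^bsub>B\<^esub> Y) m n = (f c \<oplus>\<^bsub>B\<^esub> \<xi> \<odot>\<^bsub>B\<^esub> (Y \<otimes>\<^bsub>B\<^esub> X)) m n" using L by simp
  qed (simp_all add: XB YB fB cA \<xi>K)
  then have r3: "X \<otimes>\<^bsub>B\<^esub> Y \<ominus>\<^bsub>B\<^esub> \<xi> \<odot>\<^bsub>B\<^esub> (Y \<otimes>\<^bsub>B\<^esub> X) = f c"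
    using XB YB fB[OF cA] \<xi>K(1) by (simp add: a_minus_def B.M.a_assoc B.M.r_neg)
  \<comment> \<open>The cyclic vector 1. Coefficients of an operator are those of its value at
    \<open>e\<close>; \<open>Y\<close> kills \<open>e\<close>, since \<open>e\<close> has no
    positive entries and \<omega> preserves zero.\<close>
  define e where "e = (\<lambda>n::nat. if n = 0 then \<one>\<^bsub>A\<^esub> else \<zero>\<^bsub>A\<^esub>)"
  have eN: "e \<in> carrier N" by (simp add: e_def N_def seq_simps)
  have p: "(\<lambda>u. u e n) \<in> linear_hom K B A" for n
    by (rule linear_homI) (simp_all add: ap eN mN BN, simp_all add: N_def seq_simps)
  have vals: "f r e 0 = r" "f r e 1 = \<zero>\<^bsub>A\<^esub>" "(f r \<otimes>\<^bsub>B\<^esub> X) e 0 = \<zero>\<^bsub>A\<^esub>" "(f r \<otimes>\<^bsub>B\<^esub> X) e 1 = r"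
    "(f r \<otimes>\<^bsub>B\<^esub> Y) e 1 = \<zero>\<^bsub>A\<^esub>" if "r \<in> carrier A" for r
    using that by (simp_all add: ap eN BN ncl XB YB fap Xap Yap,
      simp_all add: e_def \<tau>h(7) dA linear_hom_zero[OF \<omega>h(2) module_axioms module_axioms])
  show ?thesis
    by (intro bexI[OF _ f] bexI[OF _ XB] bexI[OF _ YB] bexI[OF _ p[of 0]] bexI[OF _ p[of 1]] conjI ballI r1 r2 r3 vals)
qed

section \<open>Hopf structures on ambiskew polynomial algebras\<close>

locale hopf_ambiskew = hopf_algebra K H \<Delta> \<epsilon> S
  for K (structure) and H (structure) and \<Delta> and \<epsilon> and S and \<tau> and \<omega> and c and \<xi> and g and h +
  assumes \<tau>_aut: "\<tau> \<in> algebra_aut K H" and \<omega>_aut: "\<omega> \<in> algebra_aut K H"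
    and commute: "r \<in> carrier H \<Longrightarrow> \<tau> (\<omega> r) = \<omega> (\<tau> r)"
    and c_central: "c \<in> sigma_center H (\<tau> \<circ> \<omega>)"
    and \<xi>_unit: "\<xi> \<in> carrier K - {\<zero>\<^bsub>K\<^esub>}"
    and g: "g \<in> grouplikes K H \<Delta>" and h: "h \<in> grouplikes K H \<Delta>"
begin

lemma \<tau>_hom: "\<tau> \<in> algebra_hom K H H" and \<omega>_hom: "\<omega> \<in> algebra_hom K H H"
  using \<tau>_aut \<omega>_aut by (auto simp: algebra_aut_def)

lemmas \<tau> = algebra_homD[OF \<tau>_hom] and \<omega> = algebra_homD[OF \<omega>_hom]
lemmas gH = grouplike_closed[OF g] and hH = grouplike_closed[OF h]

lemma cH: "c \<in> carrier H"
  using c_central by (simp add: sigma_center_def)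

lemma \<xi>K: "\<xi> \<in> carrier K" "\<xi> \<in> Units K"
  using \<xi>_unit K.field_Units by auto

sublocale amb: ambiskew_setup K H \<tau> \<omega> c \<xi>
  by unfold_locales (auto simp: \<tau>(3) \<omega>(3) cH \<xi>K)

sublocale U: tensor_triple K "ambiskew K H \<tau> \<omega> c \<xi>"
  by (rule tensor_triple.intro[OF amb.ambiskew_assoc_algebra])

lemmas \<iota> = algebra_homD[OF amb.coeff_hom]
lemmas E = amb.var_closed(1) and F = amb.var_closed(2)

abbreviation "I2 \<equiv> tensor_map K amb.A amb.A amb.\<iota> amb.\<iota>"
abbreviation "tU \<equiv> tensor K amb.A amb.A"
abbreviation "one_U \<equiv> \<one>\<^bsub>amb.A\<^esub>"
abbreviation mult_U (infixl "\<cdot>" 70) where "u \<cdot> v \<equiv> u \<otimes>\<^bsub>amb.A\<^esub> v"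
abbreviation smult_U (infixl "\<bullet>" 70) where "a \<bullet> u \<equiv> a \<odot>\<^bsub>amb.A\<^esub> u"
abbreviation mult_UU (infixl "\<star>" 70) where "u \<star> v \<equiv> u \<otimes>\<^bsub>U.AA\<^esub> v"
abbreviation add_UU (infixl "\<boxplus>" 65) where "u \<boxplus> v \<equiv> u \<oplus>\<^bsub>U.AA\<^esub> v"

abbreviation "Delta_E \<equiv> tU amb.E one_U \<boxplus> tU (amb.\<iota> g) amb.E"
abbreviation "Delta_F \<equiv> tU amb.F one_U \<boxplus> tU (amb.\<iota> h) amb.F"

abbreviation "hopf_extension \<Delta>' \<epsilon>' S' \<equiv>
  hopf_algebra K amb.A \<Delta>' \<epsilon>' S' \<and> extends_hopf K H \<Delta> \<epsilon> S amb.A amb.\<iota> \<Delta>' \<epsilon>' S' \<and>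
  \<Delta>' amb.E = Delta_E \<and> \<Delta>' amb.F = Delta_F"

text \<open>Conjugation is written with \<open>S g\<close> and \<open>S h\<close> because the
  Sweedler calculus works with the antipode; on group-likes these are the inverses that the final
  statement uses.\<close>

abbreviation "winding_data \<alpha> \<beta> \<equiv>
  (\<forall>r\<in>carrier H. convolution K \<Delta> \<alpha> \<beta> r = convolution K \<Delta> \<beta> \<alpha> r) \<and>
  (\<forall>r\<in>carrier H.
     \<tau> r = sweedler H (\<lambda>x y. \<alpha> x \<odot>\<^bsub>H\<^esub> y) r \<and>
     \<omega> r = sweedler H (\<lambda>x y. \<beta> x \<odot>\<^bsub>H\<^esub> y) r \<and>
     sweedler H (\<lambda>x y. \<alpha> x \<odot>\<^bsub>H\<^esub> y) r = sweedler H (\<lambda>x y. \<alpha> y \<odot>\<^bsub>H\<^esub> (g \<otimes>\<^bsub>H\<^esub> x \<otimes>\<^bsub>H\<^esub> S g)) r \<and>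
     sweedler H (\<lambda>x y. \<beta> x \<odot>\<^bsub>H\<^esub> y) r = sweedler H (\<lambda>x y. \<beta> y \<odot>\<^bsub>H\<^esub> (h \<otimes>\<^bsub>H\<^esub> x \<otimes>\<^bsub>H\<^esub> S h)) r) \<and>
  g \<in> grouplike_center K H \<Delta> \<and> h \<in> grouplike_center K H \<Delta> \<and>
  \<alpha> h = \<xi> \<and> inv\<^bsub>K\<^esub> (\<beta> g) = \<xi> \<and> skew_primitive K H \<Delta> (g \<otimes>\<^bsub>H\<^esub> h) \<one>\<^bsub>H\<^esub> c"

lemma I2_hom: "I2 \<in> algebra_hom K AA U.AA"
  by (rule AA.tensor_map_hom[OF amb.ambiskew_assoc_algebra amb.ambiskew_assoc_algebra amb.coeff_hom amb.coeff_hom])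

lemmas I2 = algebra_homD[OF I2_hom]

lemma I2_tensor: "x \<in> carrier H \<Longrightarrow> y \<in> carrier H \<Longrightarrow> I2 (tensor K H H x y) = tU (amb.\<iota> x) (amb.\<iota> y)"
  by (rule AA.tensor_map_linear(2)[OF amb.ambiskew_assoc_algebra amb.ambiskew_assoc_algebra \<iota>(2) \<iota>(2)])

text \<open>Kept symmetric in the two variables so that it serves \<Delta>(E)\<Delta>(F) and
  \<Delta>(F)\<Delta>(E) alike; the bracketing is the one that \<open>minus_cross\<close>
  expects.\<close>

lemma product_expansion:
  assumes "X \<in> carrier amb.A" "Y \<in> carrier amb.A" "k \<in> carrier H" "l \<in> carrier H"
  shows "(tU X one_U \<boxplus> tU (amb.\<iota> k) X) \<star> (tU Y one_U \<boxplus> tU (amb.\<iota> l) Y)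
    = tU (X \<cdot> Y) one_U \<boxplus> tU (X \<cdot> amb.\<iota> l) Y
      \<boxplus> (tU (amb.\<iota> k \<cdot> Y) X \<boxplus> tU (amb.\<iota> (k \<otimes>\<^bsub>H\<^esub> l)) (X \<cdot> Y))"
  using assms by (simp add: U.AA.T.A.l_distr U.AA.T.A.r_distr U.AA.tensor_mult \<iota>(3,6) U.AA.T.M.a_ac)

text \<open>The hypotheses say Eh = \<xi>hE and \<xi>Fg = gF, so the mixed terms Eh \<otimes> F and
  gF \<otimes> E of the two products cancel. What remains is EF - \<xi>FE = c in the left and in the
  right tensor factor. Serves both directions of the equivalence.\<close>

lemma skew_relation:
  assumes "\<tau> h = \<xi> \<odot>\<^bsub>H\<^esub> h" "\<xi> \<odot>\<^bsub>H\<^esub> \<omega> g = g" "g \<otimes>\<^bsub>H\<^esub> h = h \<otimes>\<^bsub>H\<^esub> g"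
  shows "Delta_E \<star> Delta_F \<ominus>\<^bsub>U.AA\<^esub> \<xi> \<odot>\<^bsub>U.AA\<^esub> (Delta_F \<star> Delta_E)
    = I2 (tensor K H H c \<one>\<^bsub>H\<^esub> \<oplus>\<^bsub>AA\<^esub> tensor K H H (g \<otimes>\<^bsub>H\<^esub> h) c)"
proof -
  note cl = E F gH hH cH \<iota>(3) \<tau>(3) \<omega>(3) \<xi>K(1)
  let ?EF = "amb.E \<cdot> amb.F" and ?FE = "amb.F \<cdot> amb.E"
  let ?gh = "amb.\<iota> (g \<otimes>\<^bsub>H\<^esub> h)"
  have EF: "?EF \<in> carrier amb.A" "?FE \<in> carrier amb.A" "?gh \<in> carrier amb.A" using cl by simp_all
  have sl: "\<xi> \<odot>\<^bsub>U.AA\<^esub> tU u v = tU (\<xi> \<bullet> u) v" "\<xi> \<odot>\<^bsub>U.AA\<^esub> tU u v = tU u (\<xi> \<bullet> v)"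
    if "u \<in> carrier amb.A" "v \<in> carrier amb.A" for u v
    using that linear_hom_smult[OF U.AA.tensor_left \<xi>K(1)] linear_hom_smult[OF U.AA.tensor_right \<xi>K(1)] by simp_all
  have 1: "amb.E \<cdot> amb.\<iota> h = \<xi> \<bullet> (amb.\<iota> h \<cdot> amb.E)"
    by (simp add: amb.ambiskew_relations(1) assms(1) \<iota>(5) cl U.smult_mult_left)
  have "\<xi> \<bullet> (amb.F \<cdot> amb.\<iota> g) = amb.\<iota> (\<xi> \<odot>\<^bsub>H\<^esub> \<omega> g) \<cdot> amb.F"
    by (simp add: amb.ambiskew_relations(2) \<iota>(5) cl U.smult_mult_left)
  then have 2: "\<xi> \<bullet> (amb.F \<cdot> amb.\<iota> g) = amb.\<iota> g \<cdot> amb.F"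
    using assms(2) by simp
  have FE: "\<xi> \<odot>\<^bsub>U.AA\<^esub> (Delta_F \<star> Delta_E) =
      tU (\<xi> \<bullet> ?FE) one_U \<boxplus> tU (amb.\<iota> g \<cdot> amb.F) amb.E
      \<boxplus> (tU (amb.E \<cdot> amb.\<iota> h) amb.F \<boxplus> tU ?gh (\<xi> \<bullet> ?FE))"
    unfolding product_expansion[OF F E hH gH] assms(3)[symmetric]
    using cl EF by (simp add: U.AA.T.smult_r_distr sl(1)[of ?FE] sl(1)[of "amb.F \<cdot> amb.\<iota> g"]
        sl(1)[of "amb.\<iota> h \<cdot> amb.E"] sl(2)[of ?gh] 2 1[symmetric])
  have "Delta_E \<star> Delta_F \<ominus>\<^bsub>U.AA\<^esub> \<xi> \<odot>\<^bsub>U.AA\<^esub> (Delta_F \<star> Delta_E) =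
    (tU ?EF one_U \<ominus>\<^bsub>U.AA\<^esub> tU (\<xi> \<bullet> ?FE) one_U) \<boxplus> (tU ?gh ?EF \<ominus>\<^bsub>U.AA\<^esub> tU ?gh (\<xi> \<bullet> ?FE))"
    unfolding FE product_expansion[OF E F gH hH]
    by (rule U.AA.T.M.minus_cross) (use cl EF in simp_all)
  also have "\<dots> = tU (?EF \<ominus>\<^bsub>amb.A\<^esub> \<xi> \<bullet> ?FE) one_U \<boxplus> tU ?gh (?EF \<ominus>\<^bsub>amb.A\<^esub> \<xi> \<bullet> ?FE)"
    using EF cl by (simp add: linear_hom_minus[OF U.AA.tensor_left U.module_axioms U.AA.T.module_axioms]
        linear_hom_minus[OF U.AA.tensor_right U.module_axioms U.AA.T.module_axioms])
  also have "\<dots> = I2 (tensor K H H c \<one>\<^bsub>H\<^esub> \<oplus>\<^bsub>AA\<^esub> tensor K H H (g \<otimes>\<^bsub>H\<^esub> h) c)"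
    by (simp add: amb.ambiskew_relations(3) I2(4) I2_tensor cl \<iota>(7))
  finally show ?thesis .
qed


subsection \<open>Necessity\<close>

text \<open>Each functional is a coefficient map of the representation on series, pulled back to
  \<open>A\<close>. \<open>p0\<close> splits the embedding of \<open>H\<close>, \<open>p1\<close>
  reads the coefficient of one variable, and the last value in each list keeps that coefficient
  blind to the other variable.\<close>

lemma verma_projections:
  shows "\<exists>p0\<in>linear_hom K amb.A H. \<exists>p1\<in>linear_hom K amb.A H. \<forall>r\<in>carrier H. p0 (amb.\<iota> r) = r \<and> p1 (amb.\<iota> r) = \<zero>\<^bsub>H\<^esub> \<and>
      p0 (amb.\<iota> r \<cdot> amb.E) = \<zero>\<^bsub>H\<^esub> \<and> p1 (amb.\<iota> r \<cdot> amb.E) = r \<and> p1 (amb.\<iota> r \<cdot> amb.F) = \<zero>\<^bsub>H\<^esub>"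
    (is ?E)
    and "\<exists>p0\<in>linear_hom K amb.A H. \<exists>p1\<in>linear_hom K amb.A H. \<forall>r\<in>carrier H. p0 (amb.\<iota> r) = r \<and> p1 (amb.\<iota> r) = \<zero>\<^bsub>H\<^esub> \<and>
      p0 (amb.\<iota> r \<cdot> amb.F) = \<zero>\<^bsub>H\<^esub> \<and> p1 (amb.\<iota> r \<cdot> amb.F) = r \<and> p1 (amb.\<iota> r \<cdot> amb.E) = \<zero>\<^bsub>H\<^esub>"
    (is ?F)
proof -
  let ?B = "endo_algebra K (seq_module H)"
  have aB: "assoc_algebra K ?B" by (rule module.endo_assoc_algebra[OF seq_module K.field_axioms])
  interpret B: assoc_algebra K ?B by (rule aB)
  obtain f X Y p0 p1 where f: "f \<in> algebra_hom K H ?B" and XY: "X \<in> carrier ?B" "Y \<in> carrier ?B"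
    and p: "p0 \<in> linear_hom K ?B H" "p1 \<in> linear_hom K ?B H"
    and rel: "\<And>r. r \<in> carrier H \<Longrightarrow> X \<otimes>\<^bsub>?B\<^esub> f r = f (\<tau> r) \<otimes>\<^bsub>?B\<^esub> X"
      "\<And>r. r \<in> carrier H \<Longrightarrow> Y \<otimes>\<^bsub>?B\<^esub> f r = f (\<omega> r) \<otimes>\<^bsub>?B\<^esub> Y"
      "X \<otimes>\<^bsub>?B\<^esub> Y \<ominus>\<^bsub>?B\<^esub> \<xi> \<odot>\<^bsub>?B\<^esub> (Y \<otimes>\<^bsub>?B\<^esub> X) = f c"
    and v: "\<And>r. r \<in> carrier H \<Longrightarrow> p0 (f r) = r \<and> p1 (f r) = \<zero>\<^bsub>H\<^esub> \<and> p0 (f r \<otimes>\<^bsub>?B\<^esub> X) = \<zero>\<^bsub>H\<^esub> \<and>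
      p1 (f r \<otimes>\<^bsub>?B\<^esub> X) = r \<and> p1 (f r \<otimes>\<^bsub>?B\<^esub> Y) = \<zero>\<^bsub>H\<^esub>"
    using verma_module[OF \<tau>_hom \<omega>_hom commute c_central \<xi>_unit] by blast
  from amb.ambiskew_universal[OF aB f XY rel]
  obtain \<Phi> where \<Phi>: "\<Phi> \<in> algebra_hom K amb.A ?B" and \<Phi>v: "\<And>r. r \<in> carrier H \<Longrightarrow> \<Phi> (amb.\<iota> r) = f r"
    "\<Phi> amb.E = X" "\<Phi> amb.F = Y" by blast
  note \<Phi>h = algebra_homD[OF \<Phi>]
  show ?E
    by (intro bexI[OF _ linear_hom_compose[OF \<Phi>h(2) p(1)]] bexI[OF _ linear_hom_compose[OF \<Phi>h(2) p(2)]])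
      (simp add: \<Phi>v \<Phi>h(6) v \<iota>(3) E F)
next
  let ?B = "endo_algebra K (seq_module H)"
  have aB: "assoc_algebra K ?B" by (rule module.endo_assoc_algebra[OF seq_module K.field_axioms])
  interpret B: assoc_algebra K ?B by (rule aB)
  \<comment> \<open>With E and F exchanged, the third relation divided by -\<xi> reads FE - \<xi>^-1
    EF = -\<xi>^-1 c. So the second representation is the first construction for \<omega>, \<tau>,
    -\<xi>^-1 c and \<xi>^-1.\<close>
  let ?\<xi> = "inv\<^bsub>K\<^esub> \<xi>"
  let ?c = "(\<ominus>\<^bsub>K\<^esub> ?\<xi>) \<odot>\<^bsub>H\<^esub> c"
  have \<xi>': "?\<xi> \<in> carrier K" "?\<xi> \<otimes>\<^bsub>K\<^esub> \<xi> = \<one>\<^bsub>K\<^esub>" "\<xi> \<otimes>\<^bsub>K\<^esub> ?\<xi> = \<one>\<^bsub>K\<^esub>" using \<xi>K by simp_all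
  have \<xi>'0: "?\<xi> \<in> carrier K - {\<zero>\<^bsub>K\<^esub>}"
    using R.Units_inv_Units[OF \<xi>K(2)] K.field_Units by simp
  have c': "?c \<in> sigma_center H (\<omega> \<circ> \<tau>)"
    using c_central \<xi>' by (auto simp: sigma_center_def smult_mult_left smult_mult_right commute \<tau>(3) \<omega>(3))
  obtain f X Y p0 p1 where f: "f \<in> algebra_hom K H ?B" and XY: "X \<in> carrier ?B" "Y \<in> carrier ?B"
    and p: "p0 \<in> linear_hom K ?B H" "p1 \<in> linear_hom K ?B H"
    and rel: "\<And>r. r \<in> carrier H \<Longrightarrow> X \<otimes>\<^bsub>?B\<^esub> f r = f (\<omega> r) \<otimes>\<^bsub>?B\<^esub> X"
      "\<And>r. r \<in> carrier H \<Longrightarrow> Y \<otimes>\<^bsub>?B\<^esub> f r = f (\<tau> r) \<otimes>\<^bsub>?B\<^esub> Y"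
      "X \<otimes>\<^bsub>?B\<^esub> Y \<ominus>\<^bsub>?B\<^esub> ?\<xi> \<odot>\<^bsub>?B\<^esub> (Y \<otimes>\<^bsub>?B\<^esub> X) = f ?c"
    and v: "\<And>r. r \<in> carrier H \<Longrightarrow> p0 (f r) = r \<and> p1 (f r) = \<zero>\<^bsub>H\<^esub> \<and> p0 (f r \<otimes>\<^bsub>?B\<^esub> X) = \<zero>\<^bsub>H\<^esub> \<and>
      p1 (f r \<otimes>\<^bsub>?B\<^esub> X) = r \<and> p1 (f r \<otimes>\<^bsub>?B\<^esub> Y) = \<zero>\<^bsub>H\<^esub>"
    using verma_module[OF \<omega>_hom \<tau>_hom commute[symmetric] c' \<xi>'0] by blast
  note fc = algebra_hom_closed[OF f]
  have "\<ominus>\<^bsub>K\<^esub> \<xi> \<in> carrier K" using \<xi>K by simp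
  \<comment> \<open>Multiplying by -\<xi> restores the relation in the form that the universal
    property of \<open>A\<close> asks for, with \<open>Y\<close> as the image of E and
    \<open>X\<close> as that of F.\<close>
  have "(\<ominus>\<^bsub>K\<^esub> \<xi>) \<odot>\<^bsub>?B\<^esub> f ?c = f c"
  proof -
    have "(\<ominus>\<^bsub>K\<^esub> \<xi>) \<otimes>\<^bsub>K\<^esub> (\<ominus>\<^bsub>K\<^esub> ?\<xi>) = \<one>\<^bsub>K\<^esub>" using \<xi>K \<xi>' by (simp add: R.l_minus R.r_minus)
    then show ?thesis
      using \<xi>K \<xi>' cH by (simp add: algebra_hom_smult[OF f] fc B.smult_assoc1[symmetric])
  qed
  moreover have "(\<ominus>\<^bsub>K\<^esub> \<xi>) \<odot>\<^bsub>?B\<^esub> (X \<otimes>\<^bsub>?B\<^esub> Y \<ominus>\<^bsub>?B\<^esub> ?\<xi> \<odot>\<^bsub>?B\<^esub> (Y \<otimes>\<^bsub>?B\<^esub> X)) = Y \<otimes>\<^bsub>?B\<^esub> X \<ominus>\<^bsub>?B\<^esub> \<xi> \<odot>\<^bsub>?B\<^esub> (X \<otimes>\<^bsub>?B\<^esub> Y)"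
  proof -
    have "(\<ominus>\<^bsub>K\<^esub> \<xi>) \<odot>\<^bsub>?B\<^esub> (\<ominus>\<^bsub>?B\<^esub> (?\<xi> \<odot>\<^bsub>?B\<^esub> (Y \<otimes>\<^bsub>?B\<^esub> X))) = Y \<otimes>\<^bsub>?B\<^esub> X"
      using XY \<xi>K \<xi>' by (simp add: B.smult_l_minus B.smult_r_minus B.smult_assoc1[symmetric] R.l_minus)
    then show ?thesis
      using XY \<xi>K \<xi>' by (simp add: a_minus_def B.smult_r_distr B.smult_l_minus B.M.a_comm)
  qed
  ultimately have rel3: "Y \<otimes>\<^bsub>?B\<^esub> X \<ominus>\<^bsub>?B\<^esub> \<xi> \<odot>\<^bsub>?B\<^esub> (X \<otimes>\<^bsub>?B\<^esub> Y) = f c" using rel(3) by simp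
  from amb.ambiskew_universal[OF aB f XY(2,1) rel(2,1) rel3]
  obtain \<Phi> where \<Phi>: "\<Phi> \<in> algebra_hom K amb.A ?B" and \<Phi>v: "\<And>r. r \<in> carrier H \<Longrightarrow> \<Phi> (amb.\<iota> r) = f r"
    "\<Phi> amb.E = Y" "\<Phi> amb.F = X" by blast
  note \<Phi>h = algebra_homD[OF \<Phi>]
  show ?F
    by (intro bexI[OF _ linear_hom_compose[OF \<Phi>h(2) p(1)]] bexI[OF _ linear_hom_compose[OF \<Phi>h(2) p(2)]])
      (simp add: \<Phi>v \<Phi>h(6) v \<iota>(3) E F)
qed

text \<open>p1 \<otimes> p0 keeps the part of \<open>eq\<close> that has the variable on the left
  and gives \<sigma>(r1) \<otimes> r2 = \<Delta>(\<sigma>(r)). p0 \<otimes> p1 keeps the part with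
  the variable on the right and gives k r1 \<otimes> \<sigma>(r2) = \<Delta>(\<sigma>(r))(k
  \<otimes> 1). One statement covers E with g and F with h.\<close>

lemma comult_twist:
  assumes X: "X \<in> carrier amb.A" and \<sigma>: "\<sigma> \<in> linear_hom K H H" and k: "k \<in> grouplikes K H \<Delta>"
    and X\<sigma>: "\<And>r. r \<in> carrier H \<Longrightarrow> X \<cdot> amb.\<iota> r = amb.\<iota> (\<sigma> r) \<cdot> X"
    and p: "p0 \<in> linear_hom K amb.A H" "p1 \<in> linear_hom K amb.A H"
    and v: "\<And>r. r \<in> carrier H \<Longrightarrow> p0 (amb.\<iota> r) = r \<and> p1 (amb.\<iota> r) = \<zero>\<^bsub>H\<^esub> \<and>
      p0 (amb.\<iota> r \<cdot> X) = \<zero>\<^bsub>H\<^esub> \<and> p1 (amb.\<iota> r \<cdot> X) = r"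
    and eq: "(tU X one_U \<boxplus> tU (amb.\<iota> k) X) \<star> I2 (\<Delta> r) =
      I2 (\<Delta> (\<sigma> r)) \<star> (tU X one_U \<boxplus> tU (amb.\<iota> k) X)"
    and r: "r \<in> carrier H"
  shows "\<Delta> (\<sigma> r) = tensor_map K H H \<sigma> (\<lambda>x. x) (\<Delta> r)"
    and "\<Delta> (\<sigma> r) = tensor_map K H H (\<lambda>x. k \<otimes>\<^bsub>H\<^esub> x \<otimes>\<^bsub>H\<^esub> S k) \<sigma> (\<Delta> r)"
proof -
  note kH = grouplike_closed[OF k] and SkH = antipode_closed[OF grouplike_closed[OF k]]
  note \<sigma>c = linear_hom_closed[OF \<sigma>]
  note alg = assoc_algebra_axioms assoc_algebra_axioms
  note cl = X \<iota>(3) kH \<sigma>c comult(3) r I2(3) linear_hom_closed[OF p(1)] linear_hom_closed[OF p(2)]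
  have mult_l: "(\<lambda>w. a \<star> I2 w) \<in> linear_hom K AA U.AA" and mult_r: "(\<lambda>w. I2 w \<star> a) \<in> linear_hom K AA U.AA"
    if "a \<in> carrier U.AA" for a
    by (rule U.AA.T.linear_hom_mult_left[OF that I2(2)] U.AA.T.linear_hom_mult_right[OF that I2(2)])+
  have t: "tU X one_U \<in> carrier U.AA" "tU (amb.\<iota> k) X \<in> carrier U.AA" using cl by simp_all
  note zero = AA.T.linear_hom_zero_fun[of AA]
  let ?M = "tensor_map K H H p1 p0"
  note M = U.AA.tensor_map_linear[OF alg p(2,1)]
  note Mc = linear_hom_compose[OF mult_l M(1)] linear_hom_compose[OF mult_r M(1)]
  have M1: "?M (tU X one_U \<star> I2 w) = tensor_map K H H \<sigma> (\<lambda>x. x) w" if w: "w \<in> carrier AA" for w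
    by (rule AA.linear_ext_tensor[OF w Mc(1)[OF t(1)] AA.tensor_map_linear(1)[OF alg \<sigma> linear_hom_id]])
      (simp add: I2_tensor U.AA.tensor_mult cl M(2) X\<sigma> v AA.tensor_map_linear(2)[OF alg \<sigma> linear_hom_id])
  have M2: "?M (tU (amb.\<iota> k) X \<star> I2 w) = \<zero>\<^bsub>AA\<^esub>" if w: "w \<in> carrier AA" for w
    by (rule AA.linear_ext_tensor[OF w Mc(1)[OF t(2)] zero])
      (simp add: I2_tensor U.AA.tensor_mult cl M(2) \<iota>(6)[symmetric] v AA.tensor_zero)
  have M3: "?M (I2 w \<star> tU X one_U) = w" if w: "w \<in> carrier AA" for w
    by (rule AA.linear_ext_tensor[OF w Mc(2)[OF t(1)] linear_hom_id])
      (simp add: I2_tensor U.AA.tensor_mult cl M(2) v)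
  have M4: "?M (I2 w \<star> tU (amb.\<iota> k) X) = \<zero>\<^bsub>AA\<^esub>" if w: "w \<in> carrier AA" for w
    by (rule AA.linear_ext_tensor[OF w Mc(2)[OF t(2)] zero])
      (simp add: I2_tensor U.AA.tensor_mult cl M(2) \<iota>(6)[symmetric] v AA.tensor_zero)
  have c1: "tensor_map K H H \<sigma> (\<lambda>x. x) (\<Delta> r) \<in> carrier AA"
    by (rule linear_hom_closed[OF AA.tensor_map_linear(1)[OF alg \<sigma> linear_hom_id] comult(3)[OF r]])
  show "\<Delta> (\<sigma> r) = tensor_map K H H \<sigma> (\<lambda>x. x) (\<Delta> r)"
    using arg_cong[OF eq, of ?M] c1 cl t
    by (simp add: U.AA.T.A.l_distr U.AA.T.A.r_distr linear_hom_add[OF M(1)] M1 M2 M3 M4)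
  let ?N = "tensor_map K H H p0 p1"
  note N = U.AA.tensor_map_linear[OF alg p]
  note Nc = linear_hom_compose[OF mult_l N(1)] linear_hom_compose[OF mult_r N(1)]
  have kl: "(\<lambda>x. k \<otimes>\<^bsub>H\<^esub> x) \<in> linear_hom K H H" by (rule linear_hom_mult_left[OF kH linear_hom_id])
  have N1: "?N (tU X one_U \<star> I2 w) = \<zero>\<^bsub>AA\<^esub>" if w: "w \<in> carrier AA" for w
    by (rule AA.linear_ext_tensor[OF w Nc(1)[OF t(1)] zero])
      (simp add: I2_tensor U.AA.tensor_mult cl N(2) X\<sigma> v AA.tensor_zero)
  have N2: "?N (tU (amb.\<iota> k) X \<star> I2 w) = tensor_map K H H (\<lambda>x. k \<otimes>\<^bsub>H\<^esub> x) \<sigma> w" if w: "w \<in> carrier AA" for w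
    by (rule AA.linear_ext_tensor[OF w Nc(1)[OF t(2)] AA.tensor_map_linear(1)[OF alg kl \<sigma>]])
      (simp add: I2_tensor U.AA.tensor_mult cl N(2) X\<sigma> \<iota>(6)[symmetric] v AA.tensor_map_linear(2)[OF alg kl \<sigma>])
  have N3: "?N (I2 w \<star> tU X one_U) = \<zero>\<^bsub>AA\<^esub>" if w: "w \<in> carrier AA" for w
    by (rule AA.linear_ext_tensor[OF w Nc(2)[OF t(1)] zero])
      (simp add: I2_tensor U.AA.tensor_mult cl N(2) v AA.tensor_zero)
  have N4: "?N (I2 w \<star> tU (amb.\<iota> k) X) = w \<otimes>\<^bsub>AA\<^esub> tensor K H H k \<one>\<^bsub>H\<^esub>" if w: "w \<in> carrier AA" for w
    by (rule AA.linear_ext_tensor[OF w Nc(2)[OF t(2)] AA.T.linear_hom_mult_right[OF _ linear_hom_id]])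
      (simp_all add: I2_tensor U.AA.tensor_mult cl N(2) \<iota>(6)[symmetric] v AA.tensor_mult)
  have c2: "tensor_map K H H (\<lambda>x. k \<otimes>\<^bsub>H\<^esub> x) \<sigma> (\<Delta> r) \<in> carrier AA"
    by (rule linear_hom_closed[OF AA.tensor_map_linear(1)[OF alg kl \<sigma>] comult(3)[OF r]])
  have "tensor_map K H H (\<lambda>x. k \<otimes>\<^bsub>H\<^esub> x) \<sigma> (\<Delta> r) = \<Delta> (\<sigma> r) \<otimes>\<^bsub>AA\<^esub> tensor K H H k \<one>\<^bsub>H\<^esub>"
    using arg_cong[OF eq, of ?N] c2 cl t
    by (simp add: U.AA.T.A.l_distr U.AA.T.A.r_distr linear_hom_add[OF N(1)] N1 N2 N3 N4)
  \<comment> \<open>The comparison has left a factor k \<otimes> 1 to the right of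
    \<Delta>(\<sigma>(r)); multiplying by S(k) \<otimes> 1 removes it and turns left multiplication
    by k into conjugation on the other side.\<close>
  moreover have "\<Delta> (\<sigma> r) \<otimes>\<^bsub>AA\<^esub> tensor K H H k \<one>\<^bsub>H\<^esub> \<otimes>\<^bsub>AA\<^esub> tensor K H H (S k) \<one>\<^bsub>H\<^esub> = \<Delta> (\<sigma> r)"
    using cl SkH by (simp add: AA.T.A.m_assoc AA.tensor_mult grouplike_antipode[OF k] AA.tensor_one[symmetric])
  moreover have "tensor_map K H H (\<lambda>x. k \<otimes>\<^bsub>H\<^esub> x) \<sigma> w \<otimes>\<^bsub>AA\<^esub> tensor K H H (S k) \<one>\<^bsub>H\<^esub> =
      tensor_map K H H (\<lambda>x. k \<otimes>\<^bsub>H\<^esub> x \<otimes>\<^bsub>H\<^esub> S k) \<sigma> w" if w: "w \<in> carrier AA" for w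
  proof -
    have p: "(\<lambda>x. k \<otimes>\<^bsub>H\<^esub> x \<otimes>\<^bsub>H\<^esub> S k) \<in> linear_hom K H H" by (rule linear_hom_mult_right[OF SkH kl])
    show ?thesis
      by (rule AA.linear_ext_tensor[OF w AA.T.linear_hom_mult_right[OF _ AA.tensor_map_linear(1)[OF alg kl \<sigma>]] AA.tensor_map_linear(1)[OF alg p \<sigma>]])
        (simp_all add: AA.tensor_map_linear(2)[OF alg kl \<sigma>] AA.tensor_map_linear(2)[OF alg p \<sigma>] AA.tensor_mult cl SkH)
  qed
  ultimately show "\<Delta> (\<sigma> r) = tensor_map K H H (\<lambda>x. k \<otimes>\<^bsub>H\<^esub> x \<otimes>\<^bsub>H\<^esub> S k) \<sigma> (\<Delta> r)"
    using comult(3)[OF r] by metis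
qed

text \<open>The counit laws at \<sigma>(r), with the two forms of \<Delta>(\<sigma>(r))
  inserted.\<close>

lemma winding_formulas:
  assumes \<sigma>: "\<sigma> \<in> algebra_hom K H H" and k: "k \<in> grouplikes K H \<Delta>" and r: "r \<in> carrier H"
    and 1: "\<Delta> (\<sigma> r) = tensor_map K H H \<sigma> (\<lambda>x. x) (\<Delta> r)"
    and 2: "\<Delta> (\<sigma> r) = tensor_map K H H (\<lambda>x. k \<otimes>\<^bsub>H\<^esub> x \<otimes>\<^bsub>H\<^esub> S k) \<sigma> (\<Delta> r)"
  shows "\<sigma> r = sweedler H (\<lambda>x y. \<epsilon> (\<sigma> x) \<odot>\<^bsub>H\<^esub> y) r"
    and "\<sigma> r = sweedler H (\<lambda>x y. \<epsilon> (\<sigma> y) \<odot>\<^bsub>H\<^esub> (k \<otimes>\<^bsub>H\<^esub> x \<otimes>\<^bsub>H\<^esub> S k)) r"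
proof -
  note \<sigma>h = algebra_homD[OF \<sigma>]
  note alg = assoc_algebra_axioms assoc_algebra_axioms
  have p: "(\<lambda>x. k \<otimes>\<^bsub>H\<^esub> x \<otimes>\<^bsub>H\<^esub> S k) \<in> linear_hom K H H"
    by (intro linear_hom_mult_right linear_hom_mult_left linear_hom_id grouplike_closed[OF k] antipode_closed)
  have "\<sigma> r = sweedler H (\<lambda>x y. \<epsilon> x \<odot>\<^bsub>H\<^esub> y) (\<sigma> r)" using counit_left[OF \<sigma>h(3)[OF r]] by simp
  then show "\<sigma> r = sweedler H (\<lambda>x y. \<epsilon> (\<sigma> x) \<odot>\<^bsub>H\<^esub> y) r"
    using AA.tensor_lift_map[OF alg \<sigma>h(2) linear_hom_id scalar_bilinear(1)[OF counit(2) linear_hom_id] module_axioms comult(3)[OF r]]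
    by (simp add: 1)
  have "\<sigma> r = sweedler H (\<lambda>x y. \<epsilon> y \<odot>\<^bsub>H\<^esub> x) (\<sigma> r)" using counit_right[OF \<sigma>h(3)[OF r]] by simp
  then show "\<sigma> r = sweedler H (\<lambda>x y. \<epsilon> (\<sigma> y) \<odot>\<^bsub>H\<^esub> (k \<otimes>\<^bsub>H\<^esub> x \<otimes>\<^bsub>H\<^esub> S k)) r"
    using AA.tensor_lift_map[OF alg p \<sigma>h(2) scalar_bilinear(2)[OF counit(2) linear_hom_id] module_axioms comult(3)[OF r]]
    by (simp add: 2)
qed


text \<open>At a group-like x each Sweedler sum is a single term, so the hypothesis reads
  \<alpha>(x) x = \<alpha>(x) k x S(k); a character takes invertible values on group-likes, hence x
  = k x S(k).\<close>

lemma grouplikes_commute: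
  assumes "\<alpha> \<in> characters K H" "k \<in> grouplikes K H \<Delta>" "x \<in> grouplikes K H \<Delta>"
    and "sweedler H (\<lambda>x y. \<alpha> x \<odot>\<^bsub>H\<^esub> y) x = sweedler H (\<lambda>x y. \<alpha> y \<odot>\<^bsub>H\<^esub> (k \<otimes>\<^bsub>H\<^esub> x \<otimes>\<^bsub>H\<^esub> S k)) x"
  shows "k \<otimes>\<^bsub>H\<^esub> x = x \<otimes>\<^bsub>H\<^esub> k"
proof -
  note \<alpha> = algebra_homD[OF assms(1)[unfolded characters_def], simplified]
  note \<alpha>l = algebra_hom_linear[OF assms(1)[unfolded characters_def]]
  note kH = grouplike_closed[OF assms(2)] and xH = grouplike_closed[OF assms(3)]
  note SkH = antipode_closed[OF kH]
  have p: "(\<lambda>x. k \<otimes>\<^bsub>H\<^esub> x \<otimes>\<^bsub>H\<^esub> S k) \<in> linear_hom K H H"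
    by (intro linear_hom_mult_right linear_hom_mult_left linear_hom_id kH SkH)
  have U: "\<alpha> x \<in> Units K" using character_grouplike[OF assms(1,3)] K.field_Units by simp
  have "\<alpha> x \<odot>\<^bsub>H\<^esub> x = \<alpha> x \<odot>\<^bsub>H\<^esub> (k \<otimes>\<^bsub>H\<^esub> x \<otimes>\<^bsub>H\<^esub> S k)"
    using assms(4) by (simp add: grouplike_sweedler[OF assms(3) _ module_axioms] scalar_bilinear[OF \<alpha>l] linear_hom_id p)
  moreover have "inv\<^bsub>K\<^esub> \<alpha> x \<odot>\<^bsub>H\<^esub> (\<alpha> x \<odot>\<^bsub>H\<^esub> y) = y" if "y \<in> carrier H" for y
    using U that R.Units_closed[OF U] by (simp add: smult_assoc1[symmetric])
  ultimately have eq: "x = k \<otimes>\<^bsub>H\<^esub> x \<otimes>\<^bsub>H\<^esub> S k"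
    using kH xH SkH A.m_closed by metis
  have "k \<otimes>\<^bsub>H\<^esub> x \<otimes>\<^bsub>H\<^esub> S k \<otimes>\<^bsub>H\<^esub> k = k \<otimes>\<^bsub>H\<^esub> x"
    using kH xH SkH by (simp add: A.m_assoc grouplike_antipode[OF assms(2)])
  then show ?thesis by (simp only: eq[symmetric])
qed

lemma sweedler_grouplike_scalar:
  assumes "\<alpha> \<in> characters K H" "k \<in> grouplikes K H \<Delta>"
  shows "sweedler H (\<lambda>x y. \<alpha> x \<odot>\<^bsub>H\<^esub> y) k = \<alpha> k \<odot>\<^bsub>H\<^esub> k"
  by (rule grouplike_sweedler[OF assms(2) scalar_bilinear(1)[OF algebra_hom_linear[OF assms(1)[unfolded characters_def]] linear_hom_id] module_axioms])

text \<open>p0 \<otimes> p0 is a left inverse. It brings an identity for \<Delta>(c) in A \<otimes>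
  A back to H \<otimes> H.\<close>

lemma I2_injective:
  assumes "w \<in> carrier AA" "w' \<in> carrier AA" "I2 w = I2 w'"
  shows "w = w'"
proof -
  obtain p0 where p0: "p0 \<in> linear_hom K amb.A H" and v: "\<And>r. r \<in> carrier H \<Longrightarrow> p0 (amb.\<iota> r) = r"
    using verma_projections(1) by blast
  note alg = assoc_algebra_axioms assoc_algebra_axioms
  note M = U.AA.tensor_map_linear[OF alg p0 p0]
  have "tensor_map K H H p0 p0 (I2 w) = w" if "w \<in> carrier AA" for w
    by (rule AA.linear_ext_tensor[OF that linear_hom_compose[OF I2(2) M(1)] linear_hom_id])
      (simp add: I2_tensor M(2) v \<iota>(3))
  with assms show ?thesis by metis
qed

text \<open>p1 \<otimes> q1 isolates E \<otimes> F and q1 \<otimes> p1 isolates F \<otimes> E. The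
  terms with EF or FE on one side die through the other side, where 1 or a coefficient stands, and
  so does the whole of \<open>I2 w\<close>. What is left is \<tau>(h) \<otimes> 1 = \<xi> h
  \<otimes> 1 and g \<otimes> 1 = \<xi> \<omega>(g) \<otimes> 1, from which \<epsilon> \<otimes>
  \<epsilon> extracts the scalars.\<close>

lemma coefficient_relations:
  assumes rel: "Delta_E \<star> Delta_F \<ominus>\<^bsub>U.AA\<^esub> \<xi> \<odot>\<^bsub>U.AA\<^esub> (Delta_F \<star> Delta_E) = I2 w" and w: "w \<in> carrier AA"
  shows "\<epsilon> (\<tau> h) = \<xi>" and "\<xi> \<otimes>\<^bsub>K\<^esub> \<epsilon> (\<omega> g) = \<one>\<^bsub>K\<^esub>"
proof -
  obtain p1 where p1: "p1 \<in> linear_hom K amb.A H" and pv: "\<And>r. r \<in> carrier H \<Longrightarrow> p1 (amb.\<iota> r) = \<zero>\<^bsub>H\<^esub> \<and>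
      p1 (amb.\<iota> r \<cdot> amb.E) = r \<and> p1 (amb.\<iota> r \<cdot> amb.F) = \<zero>\<^bsub>H\<^esub>"
    using verma_projections(1) by blast
  obtain q1 where q1: "q1 \<in> linear_hom K amb.A H" and qv: "\<And>r. r \<in> carrier H \<Longrightarrow> q1 (amb.\<iota> r) = \<zero>\<^bsub>H\<^esub> \<and>
      q1 (amb.\<iota> r \<cdot> amb.F) = r \<and> q1 (amb.\<iota> r \<cdot> amb.E) = \<zero>\<^bsub>H\<^esub>"
    using verma_projections(2) by blast
  note alg = assoc_algebra_axioms assoc_algebra_axioms
  note cl = E F gH hH \<iota>(3) \<tau>(3) \<omega>(3) \<xi>K(1) linear_hom_closed[OF p1] linear_hom_closed[OF q1]
  have one: "p1 one_U = \<zero>\<^bsub>H\<^esub>" "q1 one_U = \<zero>\<^bsub>H\<^esub>" "p1 amb.E = \<one>\<^bsub>H\<^esub>" "q1 amb.F = \<one>\<^bsub>H\<^esub>"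
    using pv[OF A.one_closed] qv[OF A.one_closed] E F by (simp_all add: \<iota>(7))
  have DD: "Delta_E \<star> Delta_F \<in> carrier U.AA" "\<xi> \<odot>\<^bsub>U.AA\<^esub> (Delta_F \<star> Delta_E) \<in> carrier U.AA"
    "Delta_F \<star> Delta_E \<in> carrier U.AA"
    using cl by simp_all
  let ?ee = "tensor_lift K (ground_algebra K) (\<lambda>x y. \<epsilon> x \<otimes>\<^bsub>K\<^esub> \<epsilon> y)"
  interpret G: assoc_algebra K "ground_algebra K" by (rule K.ground_assoc_algebra)
  have b: "bilinear_map K H H (ground_algebra K) (\<lambda>x y. \<epsilon> x \<otimes>\<^bsub>K\<^esub> \<epsilon> y)"
    using bilinear_precompose[OF G.mult_bilinear counit(2) counit(2)] by simp
  note ee = AA.tensor_lift_linear[OF b ground_module] and eet = AA.tensor_lift_tensor[OF b ground_module]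
  have cancel: "\<epsilon> a = \<xi> \<otimes>\<^bsub>K\<^esub> \<epsilon> a'" if "tensor K H H a \<one>\<^bsub>H\<^esub> \<ominus>\<^bsub>AA\<^esub> \<xi> \<odot>\<^bsub>AA\<^esub> tensor K H H a' \<one>\<^bsub>H\<^esub> = \<zero>\<^bsub>AA\<^esub>"
    "a \<in> carrier H" "a' \<in> carrier H" for a a'
  proof -
    have "tensor K H H a \<one>\<^bsub>H\<^esub> = \<xi> \<odot>\<^bsub>AA\<^esub> tensor K H H a' \<one>\<^bsub>H\<^esub>"
      using that \<xi>K(1) by (simp add: AA.T.M.minus_zero_iff)
    then have "?ee (tensor K H H a \<one>\<^bsub>H\<^esub>) = ?ee (\<xi> \<odot>\<^bsub>AA\<^esub> tensor K H H a' \<one>\<^bsub>H\<^esub>)" by simp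
    then show ?thesis
      using that(2,3) \<xi>K(1) by (simp add: linear_hom_smult[OF ee] eet counit(3,7))
  qed
  have I0: "tensor_map K H H p q (I2 w) = \<zero>\<^bsub>AA\<^esub>"
    if p: "p \<in> linear_hom K amb.A H" "\<And>r. r \<in> carrier H \<Longrightarrow> p (amb.\<iota> r) = \<zero>\<^bsub>H\<^esub>"
      and q: "q \<in> linear_hom K amb.A H" for p q
    by (rule AA.linear_ext_tensor[OF w linear_hom_compose[OF I2(2) U.AA.tensor_map_linear(1)[OF alg p(1) q]] AA.T.linear_hom_zero_fun])
      (simp add: I2_tensor U.AA.tensor_map_linear(2)[OF alg p(1) q] p(2) AA.tensor_zero \<iota>(3) linear_hom_closed[OF q])
  let ?M = "tensor_map K H H p1 q1"
  note M = U.AA.tensor_map_linear[OF alg p1 q1]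
  have "?M (Delta_E \<star> Delta_F) = tensor K H H (\<tau> h) \<one>\<^bsub>H\<^esub>"
    unfolding product_expansion[OF E F gH hH]
    using cl by (simp add: linear_hom_add[OF M(1)] M(2) amb.ambiskew_relations(1) pv qv one AA.tensor_zero)
  moreover have "?M (Delta_F \<star> Delta_E) = tensor K H H h \<one>\<^bsub>H\<^esub>"
    unfolding product_expansion[OF F E hH gH]
    using cl by (simp add: linear_hom_add[OF M(1)] M(2) amb.ambiskew_relations(2) pv qv one AA.tensor_zero)
  ultimately have "tensor K H H (\<tau> h) \<one>\<^bsub>H\<^esub> \<ominus>\<^bsub>AA\<^esub> \<xi> \<odot>\<^bsub>AA\<^esub> tensor K H H h \<one>\<^bsub>H\<^esub> = \<zero>\<^bsub>AA\<^esub>"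
    using arg_cong[OF rel, of ?M] DD \<xi>K(1) I0[OF p1 _ q1] pv
    by (simp add: linear_hom_minus[OF M(1) U.AA.T.module_axioms AA.T.module_axioms] linear_hom_smult[OF M(1)])
  from cancel[OF this \<tau>(3)[OF hH] hH] show "\<epsilon> (\<tau> h) = \<xi>"
    using \<xi>K(1) by (simp add: grouplike_counit[OF h])
  let ?N = "tensor_map K H H q1 p1"
  note N = U.AA.tensor_map_linear[OF alg q1 p1]
  have "?N (Delta_E \<star> Delta_F) = tensor K H H g \<one>\<^bsub>H\<^esub>"
    unfolding product_expansion[OF E F gH hH]
    using cl by (simp add: linear_hom_add[OF N(1)] N(2) amb.ambiskew_relations(1) pv qv one AA.tensor_zero)
  moreover have "?N (Delta_F \<star> Delta_E) = tensor K H H (\<omega> g) \<one>\<^bsub>H\<^esub>"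
    unfolding product_expansion[OF F E hH gH]
    using cl by (simp add: linear_hom_add[OF N(1)] N(2) amb.ambiskew_relations(2) pv qv one AA.tensor_zero)
  ultimately have "tensor K H H g \<one>\<^bsub>H\<^esub> \<ominus>\<^bsub>AA\<^esub> \<xi> \<odot>\<^bsub>AA\<^esub> tensor K H H (\<omega> g) \<one>\<^bsub>H\<^esub> = \<zero>\<^bsub>AA\<^esub>"
    using arg_cong[OF rel, of ?N] DD \<xi>K(1) I0[OF q1 _ p1] qv
    by (simp add: linear_hom_minus[OF N(1) U.AA.T.module_axioms AA.T.module_axioms] linear_hom_smult[OF N(1)])
  from cancel[OF this gH \<omega>(3)[OF gH]] show "\<xi> \<otimes>\<^bsub>K\<^esub> \<epsilon> (\<omega> g) = \<one>\<^bsub>K\<^esub>"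
    by (simp add: grouplike_counit[OF g])
qed

lemma necessity:
  assumes "hopf_extension \<Delta>' \<epsilon>' S'"
  shows "\<exists>\<alpha>\<in>characters K H. \<exists>\<beta>\<in>characters K H. winding_data \<alpha> \<beta>"
proof -
  have hopf: "hopf_algebra K amb.A \<Delta>' \<epsilon>' S'" and ext: "extends_hopf K H \<Delta> \<epsilon> S amb.A amb.\<iota> \<Delta>' \<epsilon>' S'"
    and DE: "\<Delta>' amb.E = Delta_E" and DF: "\<Delta>' amb.F = Delta_F"
    using assms by auto
  note D = algebra_homD[OF hopf_algebra.comult_hom[OF hopf]]
  have D\<iota>: "\<Delta>' (amb.\<iota> r) = I2 (\<Delta> r)" if "r \<in> carrier H" for r
    using ext that by (simp add: extends_hopf_def)
  have eqE: "Delta_E \<star> I2 (\<Delta> r) = I2 (\<Delta> (\<tau> r)) \<star> Delta_E" if "r \<in> carrier H" for r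
    using arg_cong[OF amb.ambiskew_relations(1)[OF that], of \<Delta>'] that
    by (simp add: D(6) E \<iota>(3) \<tau>(3) D\<iota> DE)
  have eqF: "Delta_F \<star> I2 (\<Delta> r) = I2 (\<Delta> (\<omega> r)) \<star> Delta_F" if "r \<in> carrier H" for r
    using arg_cong[OF amb.ambiskew_relations(2)[OF that], of \<Delta>'] that
    by (simp add: D(6) F \<iota>(3) \<omega>(3) D\<iota> DF)
  have eqc: "Delta_E \<star> Delta_F \<ominus>\<^bsub>U.AA\<^esub> \<xi> \<odot>\<^bsub>U.AA\<^esub> (Delta_F \<star> Delta_E) = I2 (\<Delta> c)"
    using arg_cong[OF amb.ambiskew_relations(3), of \<Delta>'] E F \<xi>K(1)
    by (simp add: linear_hom_minus[OF D(2) U.module_axioms U.AA.T.module_axioms] D(5,6) DE DF D\<iota> cH)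
  obtain p0 p1 where p: "p0 \<in> linear_hom K amb.A H" "p1 \<in> linear_hom K amb.A H"
    and pv: "\<And>r. r \<in> carrier H \<Longrightarrow> p0 (amb.\<iota> r) = r \<and> p1 (amb.\<iota> r) = \<zero>\<^bsub>H\<^esub> \<and>
      p0 (amb.\<iota> r \<cdot> amb.E) = \<zero>\<^bsub>H\<^esub> \<and> p1 (amb.\<iota> r \<cdot> amb.E) = r"
    using verma_projections(1) by blast
  obtain q0 q1 where q: "q0 \<in> linear_hom K amb.A H" "q1 \<in> linear_hom K amb.A H"
    and qv: "\<And>r. r \<in> carrier H \<Longrightarrow> q0 (amb.\<iota> r) = r \<and> q1 (amb.\<iota> r) = \<zero>\<^bsub>H\<^esub> \<and>
      q0 (amb.\<iota> r \<cdot> amb.F) = \<zero>\<^bsub>H\<^esub> \<and> q1 (amb.\<iota> r \<cdot> amb.F) = r"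
    using verma_projections(2) by blast
  note tE = comult_twist[OF E \<tau>(2) g amb.ambiskew_relations(1) p pv eqE]
  note tF = comult_twist[OF F \<omega>(2) h amb.ambiskew_relations(2) q qv eqF]
  \<comment> \<open>The only possible choice: \<epsilon> applied to \<tau>(r) = \<alpha>(r1) r2
    gives \<epsilon>(\<tau>(r)) = \<alpha>(r). Likewise for \<beta>.\<close>
  define \<alpha> where "\<alpha> = (\<lambda>r. \<epsilon> (\<tau> r))"
  define \<beta> where "\<beta> = (\<lambda>r. \<epsilon> (\<omega> r))"
  have \<alpha>: "\<alpha> \<in> characters K H" and \<beta>: "\<beta> \<in> characters K H"
    unfolding characters_def \<alpha>_def \<beta>_def
    by (rule algebra_hom_compose[OF \<tau>_hom counit_hom] algebra_hom_compose[OF \<omega>_hom counit_hom])+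
  note \<alpha>h = algebra_homD[OF \<alpha>[unfolded characters_def]] and \<beta>h = algebra_homD[OF \<beta>[unfolded characters_def]]
  have wE: "\<tau> r = sweedler H (\<lambda>x y. \<alpha> x \<odot>\<^bsub>H\<^esub> y) r" "\<tau> r = sweedler H (\<lambda>x y. \<alpha> y \<odot>\<^bsub>H\<^esub> (g \<otimes>\<^bsub>H\<^esub> x \<otimes>\<^bsub>H\<^esub> S g)) r"
    if "r \<in> carrier H" for r
    unfolding \<alpha>_def by (rule winding_formulas[OF \<tau>_hom g that tE[OF _ _ that]]; simp add: that)+
  have wF: "\<omega> r = sweedler H (\<lambda>x y. \<beta> x \<odot>\<^bsub>H\<^esub> y) r" "\<omega> r = sweedler H (\<lambda>x y. \<beta> y \<odot>\<^bsub>H\<^esub> (h \<otimes>\<^bsub>H\<^esub> x \<otimes>\<^bsub>H\<^esub> S h)) r"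
    if "r \<in> carrier H" for r
    unfolding \<beta>_def by (rule winding_formulas[OF \<omega>_hom h that tF[OF _ _ that]]; simp add: that)+
  \<comment> \<open>The winding formulas give \<beta> * \<alpha> = \<alpha> \<circ> \<omega> and
    \<alpha> * \<beta> = \<beta> \<circ> \<tau>. Both are \<epsilon> after the composite of \<tau>
    and \<omega>, so commuting automorphisms yield commuting characters.\<close>
  have conv: "convolution K \<Delta> \<alpha> \<beta> r = convolution K \<Delta> \<beta> \<alpha> r" if r: "r \<in> carrier H" for r
  proof -
    have "\<alpha> (\<omega> r) = convolution K \<Delta> \<beta> \<alpha> r"
      unfolding convolution_def wF(1)[OF r]
        sweedler_compose[OF scalar_bilinear(1)[OF \<beta>h(2) linear_hom_id] module_axioms ground_module \<alpha>h(2) r]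
      by (rule sweedler_cong[OF bilinear_compose[OF scalar_bilinear(1)[OF \<beta>h(2) linear_hom_id] \<alpha>h(2)] ground_module r])
        (use \<alpha>h(5) \<beta>h(3) in simp)
    moreover have "\<beta> (\<tau> r) = convolution K \<Delta> \<alpha> \<beta> r"
      unfolding convolution_def wE(1)[OF r]
        sweedler_compose[OF scalar_bilinear(1)[OF \<alpha>h(2) linear_hom_id] module_axioms ground_module \<beta>h(2) r]
      by (rule sweedler_cong[OF bilinear_compose[OF scalar_bilinear(1)[OF \<alpha>h(2) linear_hom_id] \<beta>h(2)] ground_module r])
        (use \<beta>h(5) \<alpha>h(3) in simp)
    ultimately show ?thesis using commute[OF r] by (simp add: \<alpha>_def \<beta>_def)
  qed
  have gc: "g \<otimes>\<^bsub>H\<^esub> x = x \<otimes>\<^bsub>H\<^esub> g" "h \<otimes>\<^bsub>H\<^esub> x = x \<otimes>\<^bsub>H\<^esub> h" if "x \<in> grouplikes K H \<Delta>" for x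
    using grouplikes_commute[OF \<alpha> g that] grouplikes_commute[OF \<beta> h that] wE wF grouplike_closed[OF that] by metis+
  note sc = coefficient_relations[OF eqc comult(3)[OF cH]]
  have \<alpha>h\<xi>: "\<alpha> h = \<xi>" using sc(1) by (simp add: \<alpha>_def)
  have \<beta>g: "\<xi> \<otimes>\<^bsub>K\<^esub> \<beta> g = \<one>\<^bsub>K\<^esub>" "\<beta> g \<in> carrier K" using sc(2) \<beta>h(3) gH by (simp_all add: \<beta>_def)
  then have inv: "inv\<^bsub>K\<^esub> (\<beta> g) = \<xi>"
    using \<xi>K(1) by (intro R.inv_unique'[symmetric]) (simp_all add: R.m_comm)
  \<comment> \<open>Back from scalars to elements: on a group-like a winding map is multiplication
    by the value of its character. This supplies the hypotheses of
    \<open>skew_relation\<close>.\<close>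
  have "\<tau> h = \<xi> \<odot>\<^bsub>H\<^esub> h"
    using wE(1)[OF hH] by (simp add: sweedler_grouplike_scalar[OF \<alpha> h] \<alpha>h\<xi>)
  moreover have "\<xi> \<odot>\<^bsub>H\<^esub> \<omega> g = g"
    using wF(1)[OF gH] \<beta>g \<xi>K(1) gH by (simp add: sweedler_grouplike_scalar[OF \<beta> g] smult_assoc1[symmetric])
  \<comment> \<open>One element evaluated twice: \<open>eqc\<close> uses that \<Delta>' is a
    homomorphism, \<open>skew_relation\<close> is the direct computation.\<close>
  ultimately have "I2 (\<Delta> c) = I2 (tensor K H H c \<one>\<^bsub>H\<^esub> \<oplus>\<^bsub>AA\<^esub> tensor K H H (g \<otimes>\<^bsub>H\<^esub> h) c)"
    using skew_relation[OF _ _ gc(1)[OF h]] eqc by simp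
  then have "\<Delta> c = tensor K H H c \<one>\<^bsub>H\<^esub> \<oplus>\<^bsub>AA\<^esub> tensor K H H (g \<otimes>\<^bsub>H\<^esub> h) c"
    by (intro I2_injective) (simp_all add: comult(3) cH gH hH)
  then have sp: "skew_primitive K H \<Delta> (g \<otimes>\<^bsub>H\<^esub> h) \<one>\<^bsub>H\<^esub> c" by (simp add: skew_primitive_def)
  have cen: "g \<in> grouplike_center K H \<Delta>" "h \<in> grouplike_center K H \<Delta>"
    using gc g h by (auto simp: grouplike_center_def)
  show ?thesis
    by (intro bexI[OF _ \<alpha>] bexI[OF _ \<beta>] conjI ballI conv wE(1) wF(1) cen \<alpha>h\<xi> inv sp)
      (simp_all flip: wE wF)
qed


subsection \<open>Sufficiency\<close>

text \<open>Converse of \<open>comult_twist\<close>: the summand X \<otimes> 1 is moved across by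
  the first form of \<Delta>(\<sigma>(r)), the summand k \<otimes> X by the second, where the
  conjugation absorbs the factor k.\<close>

lemma comult_var_commute:
  assumes X: "X \<in> carrier amb.A" and \<sigma>: "\<sigma> \<in> linear_hom K H H" and k: "k \<in> grouplikes K H \<Delta>"
    and X\<sigma>: "\<And>r. r \<in> carrier H \<Longrightarrow> X \<cdot> amb.\<iota> r = amb.\<iota> (\<sigma> r) \<cdot> X"
    and tw1: "\<Delta> (\<sigma> r) = tensor_map K H H \<sigma> (\<lambda>x. x) (\<Delta> r)"
    and tw2: "\<Delta> (\<sigma> r) = tensor_map K H H (\<lambda>x. k \<otimes>\<^bsub>H\<^esub> x \<otimes>\<^bsub>H\<^esub> S k) \<sigma> (\<Delta> r)"
    and r: "r \<in> carrier H"
  shows "(tU X one_U \<boxplus> tU (amb.\<iota> k) X) \<star> I2 (\<Delta> r) =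
      I2 (\<Delta> (\<sigma> r)) \<star> (tU X one_U \<boxplus> tU (amb.\<iota> k) X)"
proof -
  note kH = grouplike_closed[OF k] and SkH = antipode_closed[OF grouplike_closed[OF k]]
  note \<sigma>c = linear_hom_closed[OF \<sigma>]
  note alg = assoc_algebra_axioms assoc_algebra_axioms
  note cl = X \<iota>(3) kH \<sigma>c comult(3) r I2(3) SkH
  have p: "(\<lambda>x. k \<otimes>\<^bsub>H\<^esub> x \<otimes>\<^bsub>H\<^esub> S k) \<in> linear_hom K H H"
    by (intro linear_hom_mult_left linear_hom_mult_right linear_hom_id kH SkH)
  have t: "tU X one_U \<in> carrier U.AA" "tU (amb.\<iota> k) X \<in> carrier U.AA" using cl by simp_all
  note m1 = AA.tensor_map_linear[OF alg \<sigma> linear_hom_id] and m2 = AA.tensor_map_linear[OF alg p \<sigma>]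
  have 1: "tU X one_U \<star> I2 w = I2 (tensor_map K H H \<sigma> (\<lambda>x. x) w) \<star> tU X one_U" if w: "w \<in> carrier AA" for w
    by (rule AA.linear_ext_tensor[OF w U.AA.T.linear_hom_mult_left[OF t(1) I2(2)]
          U.AA.T.linear_hom_mult_right[OF t(1) linear_hom_compose[OF m1(1) I2(2)]]])
      (simp add: I2_tensor U.AA.tensor_mult cl m1(2) X\<sigma>)
  have k': "amb.\<iota> (k \<otimes>\<^bsub>H\<^esub> x \<otimes>\<^bsub>H\<^esub> S k) \<cdot> amb.\<iota> k = amb.\<iota> k \<cdot> amb.\<iota> x" if "x \<in> carrier H" for x
    using that cl by (simp add: \<iota>(6)[symmetric] A.m_assoc grouplike_antipode[OF k])
  have 2: "tU (amb.\<iota> k) X \<star> I2 w = I2 (tensor_map K H H (\<lambda>x. k \<otimes>\<^bsub>H\<^esub> x \<otimes>\<^bsub>H\<^esub> S k) \<sigma> w) \<star> tU (amb.\<iota> k) X"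
    if w: "w \<in> carrier AA" for w
    by (rule AA.linear_ext_tensor[OF w U.AA.T.linear_hom_mult_left[OF t(2) I2(2)]
          U.AA.T.linear_hom_mult_right[OF t(2) linear_hom_compose[OF m2(1) I2(2)]]])
      (simp add: I2_tensor U.AA.tensor_mult cl m2(2) X\<sigma> k')
  have "(tU X one_U \<boxplus> tU (amb.\<iota> k) X) \<star> I2 (\<Delta> r) =
    tU X one_U \<star> I2 (\<Delta> r) \<boxplus> tU (amb.\<iota> k) X \<star> I2 (\<Delta> r)"
    using t cl by (simp add: U.AA.T.A.l_distr)
  also have "\<dots> = I2 (\<Delta> (\<sigma> r)) \<star> tU X one_U \<boxplus> I2 (\<Delta> (\<sigma> r)) \<star> tU (amb.\<iota> k) X"
    unfolding 1[OF comult(3)[OF r]] 2[OF comult(3)[OF r]] tw1[symmetric] tw2[symmetric] ..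
  also have "\<dots> = I2 (\<Delta> (\<sigma> r)) \<star> (tU X one_U \<boxplus> tU (amb.\<iota> k) X)"
    using t cl by (simp add: U.AA.T.A.r_distr)
  finally show ?thesis .
qed

text \<open>Transports the counit and antipode laws from \<open>H\<close> to the coefficients in
  \<open>A\<close>: there the comultiplication is the image of that of \<open>H\<close>, so a sum
  over it is the image of a sum in \<open>H\<close>.\<close>

lemma lift_coeff:
  assumes \<phi>: "bilinear_map K amb.A amb.A amb.A \<phi>" and \<psi>: "bilinear_map K H H H \<psi>" and r: "r \<in> carrier H"
    and eq: "\<And>x y. x \<in> carrier H \<Longrightarrow> y \<in> carrier H \<Longrightarrow> \<phi> (amb.\<iota> x) (amb.\<iota> y) = amb.\<iota> (\<psi> x y)"
  shows "tensor_lift K amb.A \<phi> (I2 (\<Delta> r)) = amb.\<iota> (sweedler H \<psi> r)"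
  using AA.tensor_lift_map[OF amb.ambiskew_assoc_algebra amb.ambiskew_assoc_algebra \<iota>(2) \<iota>(2) \<phi> U.module_axioms comult(3)[OF r]]
    sweedler_cong[OF bilinear_precompose[OF \<phi> \<iota>(2) \<iota>(2)] U.module_axioms r eq]
    sweedler_compose[OF \<psi> module_axioms U.module_axioms \<iota>(2) r]
  by simp

lemma lift_var:
  assumes \<phi>: "bilinear_map K amb.A amb.A amb.A \<phi>" and "X \<in> carrier amb.A" "k \<in> carrier H"
  shows "tensor_lift K amb.A \<phi> (tU X one_U \<boxplus> tU (amb.\<iota> k) X) = \<phi> X one_U \<oplus>\<^bsub>amb.A\<^esub> \<phi> (amb.\<iota> k) X"
  using assms(2,3) by (simp add: linear_hom_add[OF U.AA.tensor_lift_linear[OF \<phi> U.module_axioms]]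
      U.AA.tensor_lift_tensor[OF \<phi> U.module_axioms] \<iota>(3))

text \<open>Naturality: both iterated comultiplications and the reassociation commute with the maps
  that \<iota> induces on threefold tensors, so the coassociativity of \<open>H\<close> is carried
  over.\<close>

lemma coassoc_coeff:
  assumes D: "D \<in> algebra_hom K amb.A U.AA" and D\<iota>: "\<And>r. r \<in> carrier H \<Longrightarrow> D (amb.\<iota> r) = I2 (\<Delta> r)"
    and r: "r \<in> carrier H"
  shows "tensor_assoc K amb.A (tensor_map K U.AA amb.A D (\<lambda>x. x) (D (amb.\<iota> r))) =
    tensor_map K amb.A U.AA (\<lambda>x. x) D (D (amb.\<iota> r))"
proof -
  note Dh = algebra_homD[OF D]
  note aU = amb.ambiskew_assoc_algebra and aUU = U.AA.tensor_assoc_algebra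
  note aH = assoc_algebra_axioms and aHH = AA.tensor_assoc_algebra
  note l = U.AA.tensor_map_linear[OF aUU aU Dh(2) linear_hom_id]
  note rr = U.AA.tensor_map_linear[OF aU aUU linear_hom_id Dh(2)]
  note l' = AA.tensor_map_linear[OF aHH aH comult(2) linear_hom_id]
  note rr' = AA.tensor_map_linear[OF aH aHH linear_hom_id comult(2)]
  note I2l = AAl.tensor_map_linear[OF aUU aU I2(2) \<iota>(2)]
  note I2r = AAr.tensor_map_linear[OF aU aUU \<iota>(2) I2(2)]
  let ?L = "tensor_map K U.AA amb.A D (\<lambda>x. x)" and ?R = "tensor_map K amb.A U.AA (\<lambda>x. x) D"
  let ?L' = "tensor_map K AA H \<Delta> (\<lambda>x. x)" and ?R' = "tensor_map K H AA (\<lambda>x. x) \<Delta>"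
  let ?Il = "tensor_map K U.AA amb.A I2 amb.\<iota>" and ?Ir = "tensor_map K amb.A U.AA amb.\<iota> I2"
  have 1: "?L (I2 w) = ?Il (?L' w)" if w: "w \<in> carrier AA" for w
    by (rule AA.linear_ext_tensor[OF w linear_hom_compose[OF I2(2) l(1)] linear_hom_compose[OF l'(1) I2l(1)]])
      (simp add: I2_tensor l(2) l'(2) I2l(2) \<iota>(3) D\<iota> comult(3))
  have 2: "?R (I2 w) = ?Ir (?R' w)" if w: "w \<in> carrier AA" for w
    by (rule AA.linear_ext_tensor[OF w linear_hom_compose[OF I2(2) rr(1)] linear_hom_compose[OF rr'(1) I2r(1)]])
      (simp add: I2_tensor rr(2) rr'(2) I2r(2) \<iota>(3) D\<iota> comult(3))
  note as = linear_hom_compose[OF I2l(1) U.tensor_assoc_linear] and sa = linear_hom_compose[OF tensor_assoc_linear I2r(1)]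
  have 3: "tensor_assoc K amb.A (?Il (tensor K AA H w z)) = ?Ir (tensor_assoc K H (tensor K AA H w z))"
    if w: "w \<in> carrier AA" and z: "z \<in> carrier H" for w z
    by (rule AA.linear_ext_tensor[OF w linear_hom_compose[OF AAl.tensor_left[OF z] as] linear_hom_compose[OF AAl.tensor_left[OF z] sa]])
      (use z in \<open>simp add: I2l(2) I2r(2) I2_tensor tensor_assoc_tensor U.tensor_assoc_tensor \<iota>(3)\<close>)
  have 4: "tensor_assoc K amb.A (?Il z) = ?Ir (tensor_assoc K H z)" if z: "z \<in> carrier A3l" for z
    by (rule AAl.linear_ext_tensor[OF z as sa]) (simp add: 3)
  have "tensor_assoc K amb.A (?L (D (amb.\<iota> r))) = ?Ir (tensor_assoc K H (?L' (\<Delta> r)))"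
    using linear_hom_closed[OF l'(1) comult(3)[OF r]] by (simp add: D\<iota> r 1 comult(3) 4)
  also have "\<dots> = ?R (D (amb.\<iota> r))"
    using coassoc[OF r] by (simp add: D\<iota> r 2 comult(3))
  finally show ?thesis .
qed

text \<open>Since \<Delta>(k) = k \<otimes> k, both sides are X \<otimes> 1 \<otimes> 1 + k
  \<otimes> X \<otimes> 1 + k \<otimes> k \<otimes> X.\<close>

lemma coassoc_var:
  assumes D: "D \<in> algebra_hom K amb.A U.AA" and D\<iota>: "\<And>r. r \<in> carrier H \<Longrightarrow> D (amb.\<iota> r) = I2 (\<Delta> r)"
    and X: "X \<in> carrier amb.A" and k: "k \<in> grouplikes K H \<Delta>"
    and DX: "D X = tU X one_U \<boxplus> tU (amb.\<iota> k) X"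
  shows "tensor_assoc K amb.A (tensor_map K U.AA amb.A D (\<lambda>x. x) (D X)) = tensor_map K amb.A U.AA (\<lambda>x. x) D (D X)"
proof -
  note Dh = algebra_homD[OF D]
  note aU = amb.ambiskew_assoc_algebra and aUU = U.AA.tensor_assoc_algebra
  note l = U.AA.tensor_map_linear[OF aUU aU Dh(2) linear_hom_id]
  note rr = U.AA.tensor_map_linear[OF aU aUU linear_hom_id Dh(2)]
  note cl = X \<iota>(3)[OF grouplike_closed[OF k]] Dh(3)
  have Dk: "D (amb.\<iota> k) = tU (amb.\<iota> k) (amb.\<iota> k)"
    by (simp add: D\<iota> grouplike_closed[OF k] grouplike_comult[OF k] I2_tensor)
  have D1: "D one_U = tU one_U one_U" by (simp add: Dh(7) U.AA.tensor_one)
  have add3: "tensor K amb.A U.AA x (u \<boxplus> v) = tensor K amb.A U.AA x u \<oplus>\<^bsub>U.A3r\<^esub> tensor K amb.A U.AA x v"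
    if "x \<in> carrier amb.A" "u \<in> carrier U.AA" "v \<in> carrier U.AA" for x u v
    by (rule linear_hom_add[OF U.AAr.tensor_right[OF that(1)] that(2,3)])
  have add3': "tensor K U.AA amb.A (u \<boxplus> v) x = tensor K U.AA amb.A u x \<oplus>\<^bsub>U.A3l\<^esub> tensor K U.AA amb.A v x"
    if "x \<in> carrier amb.A" "u \<in> carrier U.AA" "v \<in> carrier U.AA" for x u v
    by (rule linear_hom_add[OF U.AAl.tensor_left[OF that(1)] that(2,3)])
  have "tensor_map K U.AA amb.A D (\<lambda>x. x) (D X) =
    tensor K U.AA amb.A (D X) one_U \<oplus>\<^bsub>U.A3l\<^esub> tensor K U.AA amb.A (D (amb.\<iota> k)) X"
    using cl by (simp add: DX linear_hom_add[OF l(1)] l(2))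
  also have "\<dots> = tensor K U.AA amb.A (tU X one_U) one_U \<oplus>\<^bsub>U.A3l\<^esub> tensor K U.AA amb.A (tU (amb.\<iota> k) X) one_U
     \<oplus>\<^bsub>U.A3l\<^esub> tensor K U.AA amb.A (tU (amb.\<iota> k) (amb.\<iota> k)) X"
    using cl by (simp add: DX Dk add3')
  finally have L: "tensor_assoc K amb.A (tensor_map K U.AA amb.A D (\<lambda>x. x) (D X)) =
     tensor K amb.A U.AA X (tU one_U one_U) \<oplus>\<^bsub>U.A3r\<^esub> tensor K amb.A U.AA (amb.\<iota> k) (tU X one_U)
     \<oplus>\<^bsub>U.A3r\<^esub> tensor K amb.A U.AA (amb.\<iota> k) (tU (amb.\<iota> k) X)"
    using cl by (simp add: linear_hom_add[OF U.tensor_assoc_linear] U.tensor_assoc_tensor)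
  have "tensor_map K amb.A U.AA (\<lambda>x. x) D (D X) =
    tensor K amb.A U.AA X (D one_U) \<oplus>\<^bsub>U.A3r\<^esub> tensor K amb.A U.AA (amb.\<iota> k) (D X)"
    using cl by (simp add: DX linear_hom_add[OF rr(1)] rr(2))
  also have "\<dots> = tensor K amb.A U.AA X (tU one_U one_U) \<oplus>\<^bsub>U.A3r\<^esub> (tensor K amb.A U.AA (amb.\<iota> k) (tU X one_U)
     \<oplus>\<^bsub>U.A3r\<^esub> tensor K amb.A U.AA (amb.\<iota> k) (tU (amb.\<iota> k) X))"
    using cl by (simp add: DX D1 add3)
  finally show ?thesis
    using cl unfolding L by (simp add: U.AAr.T.M.a_assoc)
qed

lemma hopf_structure:
  assumes D: "D \<in> algebra_hom K amb.A U.AA" and D\<iota>: "\<And>r. r \<in> carrier H \<Longrightarrow> D (amb.\<iota> r) = I2 (\<Delta> r)"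
    and DE: "D amb.E = Delta_E" and DF: "D amb.F = Delta_F"
    and e: "e \<in> algebra_hom K amb.A (ground_algebra K)" and e\<iota>: "\<And>r. r \<in> carrier H \<Longrightarrow> e (amb.\<iota> r) = \<epsilon> r"
    and eE: "e amb.E = \<zero>\<^bsub>K\<^esub>" and eF: "e amb.F = \<zero>\<^bsub>K\<^esub>"
    and T: "T \<in> algebra_hom K amb.A (opposite_algebra amb.A)" and T\<iota>: "\<And>r. r \<in> carrier H \<Longrightarrow> T (amb.\<iota> r) = amb.\<iota> (S r)"
    and TE: "T amb.E = \<ominus>\<^bsub>amb.A\<^esub> (amb.\<iota> (S g) \<cdot> amb.E)" and TF: "T amb.F = \<ominus>\<^bsub>amb.A\<^esub> (amb.\<iota> (S h) \<cdot> amb.F)"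
  shows "hopf_algebra K amb.A D e T"
proof -
  note aU = amb.ambiskew_assoc_algebra and aUU = U.AA.tensor_assoc_algebra
  note cl = E F gH hH antipode_closed \<iota>(3)
  note Dh = algebra_homD[OF D] and eh = algebra_homD[OF e, simplified] and Th = algebra_homD[OF T, simplified]
  note el = algebra_hom_linear[OF e]
  have Tl: "T \<in> linear_hom K amb.A amb.A"
    using algebra_hom_linear[OF T] by (simp add: linear_hom_def)
  show ?thesis
  proof (intro hopf_algebra.intro hopf_algebra_axioms.intro aU D e Tl)
    fix u assume u: "u \<in> carrier amb.A"
    note l = U.AA.tensor_map_hom[OF aUU aU D algebra_hom_id]
    note rr = U.AA.tensor_map_hom[OF aU aUU algebra_hom_id D]
    show "tensor_assoc K amb.A (tensor_map K U.AA amb.A D (\<lambda>x. x) (D u)) = tensor_map K amb.A U.AA (\<lambda>x. x) D (D u)"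
      by (rule amb.ambiskew_hom_ext[OF U.AAr.tensor_assoc_algebra algebra_hom_compose[OF algebra_hom_compose[OF D l] U.tensor_assoc_hom]
            algebra_hom_compose[OF D rr] u])
        (rule coassoc_coeff[OF D D\<iota>] coassoc_var[OF D D\<iota> E g DE] coassoc_var[OF D D\<iota> F h DF]; assumption)+
  next
    fix u assume u: "u \<in> carrier amb.A"
    note sl = U.scalar_bilinear(1)[OF el linear_hom_id] and sr = U.scalar_bilinear(2)[OF el linear_hom_id]
    note L = algebra_hom_scalar[OF aU aU aU e algebra_hom_id]
    have X: "tensor_lift K amb.A (\<lambda>x y. e x \<bullet> y) (tU X one_U \<boxplus> tU (amb.\<iota> k) X) = X"
      "tensor_lift K amb.A (\<lambda>x y. e y \<bullet> x) (tU X one_U \<boxplus> tU (amb.\<iota> k) X) = X"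
      if "X \<in> carrier amb.A" "e X = \<zero>\<^bsub>K\<^esub>" "k \<in> grouplikes K H \<Delta>" for X k
      using that grouplike_closed[OF that(3)]
      by (simp_all add: lift_var sl sr \<iota>(3) e\<iota> grouplike_counit eh(7))
    show "tensor_lift K amb.A (\<lambda>x y. e x \<bullet> y) (D u) = u"
    proof (rule amb.ambiskew_hom_ext[OF aU algebra_hom_compose[OF D L(1)] algebra_hom_id u])
      fix r assume r: "r \<in> carrier H"
      show "tensor_lift K amb.A (\<lambda>x y. e x \<bullet> y) (D (amb.\<iota> r)) = amb.\<iota> r"
        using lift_coeff[OF sl scalar_bilinear(1)[OF counit(2) linear_hom_id] r]
        by (simp add: D\<iota> r e\<iota> \<iota>(5) counit(3) counit_left)
    qed (simp_all add: DE DF X E F eE eF g h)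
    show "tensor_lift K amb.A (\<lambda>x y. e y \<bullet> x) (D u) = u"
    proof (rule amb.ambiskew_hom_ext[OF aU algebra_hom_compose[OF D L(2)] algebra_hom_id u])
      fix r assume r: "r \<in> carrier H"
      show "tensor_lift K amb.A (\<lambda>x y. e y \<bullet> x) (D (amb.\<iota> r)) = amb.\<iota> r"
        using lift_coeff[OF sr scalar_bilinear(2)[OF counit(2) linear_hom_id] r]
        by (simp add: D\<iota> r e\<iota> \<iota>(5) counit(3) counit_right)
    qed (simp_all add: DE DF X E F eE eF g h)
  next
    have bl: "bilinear_map K amb.A amb.A amb.A (\<lambda>x y. T x \<cdot> y)"
      by (rule bilinear_precompose[OF U.mult_bilinear Tl linear_hom_id])
    have br: "bilinear_map K amb.A amb.A amb.A (\<lambda>x y. x \<cdot> T y)"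
      by (rule bilinear_precompose[OF U.mult_bilinear linear_hom_id Tl])
    let ?l = "tensor_lift K amb.A (\<lambda>x y. T x \<cdot> y)" and ?r = "tensor_lift K amb.A (\<lambda>x y. x \<cdot> T y)"
    note l = U.AA.tensor_lift_linear[OF bl U.module_axioms] and lt = U.AA.tensor_lift_tensor[OF bl U.module_axioms]
    note rl = U.AA.tensor_lift_linear[OF br U.module_axioms] and rt = U.AA.tensor_lift_tensor[OF br U.module_axioms]
    have sX: "\<ominus>\<^bsub>amb.A\<^esub> (amb.\<iota> (S k) \<cdot> X) \<oplus>\<^bsub>amb.A\<^esub> amb.\<iota> (S k) \<cdot> X = \<zero>\<^bsub>amb.A\<^esub>"
      "X \<oplus>\<^bsub>amb.A\<^esub> amb.\<iota> k \<cdot> (\<ominus>\<^bsub>amb.A\<^esub> (amb.\<iota> (S k) \<cdot> X)) = \<zero>\<^bsub>amb.A\<^esub>"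
      if k: "k \<in> grouplikes K H \<Delta>" and X: "X \<in> carrier amb.A" for k X
    proof -
      note kc = grouplike_closed[OF k] antipode_closed[OF grouplike_closed[OF k]]
      show "\<ominus>\<^bsub>amb.A\<^esub> (amb.\<iota> (S k) \<cdot> X) \<oplus>\<^bsub>amb.A\<^esub> amb.\<iota> (S k) \<cdot> X = \<zero>\<^bsub>amb.A\<^esub>"
        using kc X by (simp add: \<iota>(3) U.M.l_neg)
      have "amb.\<iota> k \<cdot> amb.\<iota> (S k) = one_U"
        using kc by (simp add: \<iota>(6)[symmetric] grouplike_antipode[OF k] \<iota>(7))
      then show "X \<oplus>\<^bsub>amb.A\<^esub> amb.\<iota> k \<cdot> (\<ominus>\<^bsub>amb.A\<^esub> (amb.\<iota> (S k) \<cdot> X)) = \<zero>\<^bsub>amb.A\<^esub>"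
        using kc X by (simp add: \<iota>(3) U.A.r_minus U.A.m_assoc[symmetric] U.M.r_neg)
    qed
    have l_coeff: "?l (D (amb.\<iota> r)) = e (amb.\<iota> r) \<bullet> one_U" if r: "r \<in> carrier H" for r
      using lift_coeff[OF bl conv_bilinear[OF antipode_linear linear_hom_id] r]
      by (simp add: D\<iota> r T\<iota> \<iota>(5,6,7) antipode_closed e\<iota> counit(3) antipode_left)
    have r_coeff: "?r (D (amb.\<iota> r)) = e (amb.\<iota> r) \<bullet> one_U" if r: "r \<in> carrier H" for r
      using lift_coeff[OF br conv_bilinear[OF linear_hom_id antipode_linear] r]
      by (simp add: D\<iota> r T\<iota> \<iota>(5,6,7) antipode_closed e\<iota> counit(3) antipode_right)
    \<comment> \<open>T reverses products, so multiplying \<open>w\<close> by x \<otimes> y on the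
      right turns its antipode sum into T(x) (?l w) y. A scalar value of the inner sum can be pulled
      out, which gives closure of the left antipode law under products.\<close>
    have l_mult: "?l (w \<star> v) = a \<bullet> ?l v"
      if w: "w \<in> carrier U.AA" and v: "v \<in> carrier U.AA" and a: "a \<in> carrier K" and lw: "?l w = a \<bullet> one_U" for w v a
    proof (rule U.AA.linear_ext_tensor[OF v linear_hom_compose[OF U.AA.T.linear_hom_mult_left[OF w linear_hom_id] l]
            U.linear_hom_smult_fun[OF a l]])
      fix x y assume x: "x \<in> carrier amb.A" and y: "y \<in> carrier amb.A"
      have "?l (w \<star> tU x y) = T x \<cdot> ?l w \<cdot> y"
        by (rule U.AA.linear_ext_tensor[OF w linear_hom_compose[OF U.AA.T.linear_hom_mult_right[OF _ linear_hom_id] l]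
              U.linear_hom_mult_right[OF y U.linear_hom_mult_left[OF Th(3)[OF x] l]]])
          (use x y in \<open>simp_all add: U.AA.tensor_mult lt Th(3,6) U.A.m_assoc\<close>)
      then show "?l (w \<star> tU x y) = a \<bullet> ?l (tU x y)"
        using x y a by (simp add: lw lt Th(3) U.smult_mult_left U.smult_mult_right)
    qed
    \<comment> \<open>Mirrored: now the sum for the right factor is the inner one, so in the
      induction \<open>u\<close> and \<open>v\<close> exchange their roles.\<close>
    have r_mult: "?r (v \<star> w) = a \<bullet> ?r v"
      if w: "w \<in> carrier U.AA" and v: "v \<in> carrier U.AA" and a: "a \<in> carrier K" and rw: "?r w = a \<bullet> one_U" for w v a
    proof (rule U.AA.linear_ext_tensor[OF v linear_hom_compose[OF U.AA.T.linear_hom_mult_right[OF w linear_hom_id] rl]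
            U.linear_hom_smult_fun[OF a rl]])
      fix x y assume x: "x \<in> carrier amb.A" and y: "y \<in> carrier amb.A"
      have "?r (tU x y \<star> w) = x \<cdot> ?r w \<cdot> T y"
        by (rule U.AA.linear_ext_tensor[OF w linear_hom_compose[OF U.AA.T.linear_hom_mult_left[OF _ linear_hom_id] rl]
              U.linear_hom_mult_right[OF Th(3)[OF y] U.linear_hom_mult_left[OF x rl]]])
          (use x y in \<open>simp_all add: U.AA.tensor_mult rt Th(3,6) U.A.m_assoc\<close>)
      then show "?r (tU x y \<star> w) = a \<bullet> ?r (tU x y)"
        using x y a by (simp add: rw rt Th(3) U.smult_mult_left U.smult_mult_right)
    qed
    fix u assume u: "u \<in> carrier amb.A"
    show "?l (D u) = e u \<bullet> one_U" using u
    proof (induction rule: amb.ambiskew_induct)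
      case E
      show ?case using cl by (simp add: DE lift_var[OF bl] TE T\<iota> eE sX g)
    next
      case F
      show ?case using cl by (simp add: DF lift_var[OF bl] TF T\<iota> eF sX h)
    next
      case (add u v)
      then show ?case by (simp add: Dh(3,4) linear_hom_add[OF l] eh(3,4) U.smult_l_distr)
    next
      case (mult u v)
      then show ?case by (simp add: Dh(3,6) l_mult[of "D u" "D v" "e u"] eh(3,6) U.smult_assoc1)
    qed (rule l_coeff)
    show "?r (D u) = e u \<bullet> one_U" using u
    proof (induction rule: amb.ambiskew_induct)
      case E
      show ?case using cl by (simp add: DE lift_var[OF br] TE eE sX g Th(7))
    next
      case F
      show ?case using cl by (simp add: DF lift_var[OF br] TF eF sX h Th(7))
    next
      case (add u v)
      then show ?case by (simp add: Dh(3,4) linear_hom_add[OF rl] eh(3,4) U.smult_l_distr)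
    next
      case (mult u v)
      then show ?case by (simp add: Dh(3,6) r_mult[of "D v" "D u" "e v"] eh(3,6) U.smult_assoc1[symmetric] R.m_comm)
    qed (rule r_coeff)
  qed
qed

lemma sufficiency:
  assumes \<alpha>: "\<alpha> \<in> characters K H" and \<beta>: "\<beta> \<in> characters K H" and data: "winding_data \<alpha> \<beta>"
  shows "\<exists>\<Delta>' \<epsilon>' S'. hopf_extension \<Delta>' \<epsilon>' S'"
proof -
  have wE: "\<tau> r = sweedler H (\<lambda>x y. \<alpha> x \<odot>\<^bsub>H\<^esub> y) r"
      "\<tau> r = sweedler H (\<lambda>x y. \<alpha> y \<odot>\<^bsub>H\<^esub> (g \<otimes>\<^bsub>H\<^esub> x \<otimes>\<^bsub>H\<^esub> S g)) r"
    and wF: "\<omega> r = sweedler H (\<lambda>x y. \<beta> x \<odot>\<^bsub>H\<^esub> y) r"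
      "\<omega> r = sweedler H (\<lambda>x y. \<beta> y \<odot>\<^bsub>H\<^esub> (h \<otimes>\<^bsub>H\<^esub> x \<otimes>\<^bsub>H\<^esub> S h)) r" if "r \<in> carrier H" for r
    using bspec[OF conjunct1[OF conjunct2[OF data]] that] by simp_all
  have gh: "g \<otimes>\<^bsub>H\<^esub> h = h \<otimes>\<^bsub>H\<^esub> g" and \<alpha>h: "\<alpha> h = \<xi>" and \<beta>g: "inv\<^bsub>K\<^esub> (\<beta> g) = \<xi>"
    and sp: "skew_primitive K H \<Delta> (g \<otimes>\<^bsub>H\<^esub> h) \<one>\<^bsub>H\<^esub> c"
    using data h unfolding grouplike_center_def by blast+
  note SgH = antipode_closed[OF gH] and ShH = antipode_closed[OF hH]
  note cl = E F gH hH SgH ShH cH \<iota>(3) \<tau>(3) \<omega>(3) \<xi>K(1) antipode_closed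
  note tE = left_winding_comult[OF \<alpha> wE(1)] right_winding_comult[OF \<alpha> g wE(2)]
  note tF = left_winding_comult[OF \<beta> wF(1)] right_winding_comult[OF \<beta> h wF(2)]
  have Sgg: "S g \<in> grouplikes K H \<Delta>" and Shg: "S h \<in> grouplikes K H \<Delta>"
    using grouplike_antipode_grouplike g h by auto
  have \<beta>U: "\<beta> g \<in> Units K" using character_grouplike[OF \<beta> g] K.field_Units by simp
  have \<xi>\<beta>: "\<xi> \<otimes>\<^bsub>K\<^esub> \<beta> g = \<one>\<^bsub>K\<^esub>" using \<beta>U \<beta>g R.Units_l_inv by metis
  have \<beta>Sg: "\<beta> (S g) = \<xi>"
    by (rule R.inv_unique[OF character_grouplike(2)[OF \<beta> g] _ character_grouplike(1)[OF \<beta> g] character_grouplike(1)[OF \<beta> Sgg] \<xi>K(1)])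
      (use \<xi>\<beta> character_grouplike(1)[OF \<beta> g] \<xi>K(1) in \<open>simp add: R.m_comm\<close>)
  have \<alpha>Sh: "\<alpha> (S h) \<in> carrier K" "\<xi> \<otimes>\<^bsub>K\<^esub> \<alpha> (S h) = \<one>\<^bsub>K\<^esub>"
    using character_grouplike(1)[OF \<alpha> Shg] character_grouplike(2)[OF \<alpha> h] \<alpha>h \<xi>K(1) by (simp_all add: R.m_comm)
  have \<tau>h: "\<tau> h = \<xi> \<odot>\<^bsub>H\<^esub> h" "\<tau> (S h) = \<alpha> (S h) \<odot>\<^bsub>H\<^esub> S h"
    using wE(1)[OF hH] wE(1)[OF ShH] by (simp_all add: sweedler_grouplike_scalar[OF \<alpha>] h Shg \<alpha>h)
  have \<omega>g: "\<xi> \<odot>\<^bsub>H\<^esub> \<omega> g = g" "\<omega> (S g) = \<xi> \<odot>\<^bsub>H\<^esub> S g"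
    using wF(1)[OF gH] wF(1)[OF SgH] \<xi>\<beta> character_grouplike(1)[OF \<beta> g] cl
    by (simp_all add: sweedler_grouplike_scalar[OF \<beta>] g Sgg \<beta>Sg smult_assoc1[symmetric])
  have \<Delta>c: "\<Delta> c = tensor K H H c \<one>\<^bsub>H\<^esub> \<oplus>\<^bsub>AA\<^esub> tensor K H H (g \<otimes>\<^bsub>H\<^esub> h) c"
    using sp by (simp add: skew_primitive_def)
  have \<epsilon>c: "\<epsilon> c = \<zero>\<^bsub>K\<^esub>"
  proof -
    note b = scalar_bilinear(1)[OF counit(2) linear_hom_id]
    \<comment> \<open>The left counit law applied to \<Delta>(c) = c \<otimes> 1 + gh \<otimes> c;
      cancelling c and applying \<epsilon> once more gives \<epsilon>(c) = 0.\<close>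
    have "c = \<epsilon> c \<odot>\<^bsub>H\<^esub> \<one>\<^bsub>H\<^esub> \<oplus>\<^bsub>H\<^esub> c"
      using counit_left[OF cH] cl
      by (simp add: \<Delta>c linear_hom_add[OF AA.tensor_lift_linear[OF b module_axioms]] AA.tensor_lift_tensor[OF b module_axioms]
          counit(6) grouplike_counit[OF g] grouplike_counit[OF h])
    then have "\<epsilon> c \<odot>\<^bsub>H\<^esub> \<one>\<^bsub>H\<^esub> = \<zero>\<^bsub>H\<^esub>"
      using M.add.r_cancel_one'[of c "\<epsilon> c \<odot>\<^bsub>H\<^esub> \<one>\<^bsub>H\<^esub>"] cH counit(3)[OF cH] by simp
    then have "\<epsilon> (\<epsilon> c \<odot>\<^bsub>H\<^esub> \<one>\<^bsub>H\<^esub>) = \<epsilon> \<zero>\<^bsub>H\<^esub>" by simp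
    then show ?thesis
      using linear_hom_zero[OF counit(2) module_axioms ground_module] counit(3)[OF cH] by (simp add: counit(5,7))
  qed
  have Sc: "S c = \<ominus>\<^bsub>H\<^esub> (S h \<otimes>\<^bsub>H\<^esub> S g \<otimes>\<^bsub>H\<^esub> c)"
  proof -
    note b = conv_bilinear[OF antipode_linear linear_hom_id]
    \<comment> \<open>The left antipode law at c reads S(c) + S(gh) c = \<epsilon>(c) 1, and
      \<epsilon>(c) = 0.\<close>
    have "S c \<oplus>\<^bsub>H\<^esub> S h \<otimes>\<^bsub>H\<^esub> S g \<otimes>\<^bsub>H\<^esub> c = \<zero>\<^bsub>H\<^esub>"
      using antipode_left[OF cH] cl
      by (simp add: \<Delta>c linear_hom_add[OF AA.tensor_lift_linear[OF b module_axioms]] AA.tensor_lift_tensor[OF b module_axioms]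
          antipode_mult \<epsilon>c)
    then show ?thesis using cl by (simp add: M.minus_equality)
  qed
  have SS: "S h \<otimes>\<^bsub>H\<^esub> S g = S g \<otimes>\<^bsub>H\<^esub> S h"
    using arg_cong[OF gh, of S] gH hH by (simp add: antipode_mult)
  \<comment> \<open>\<open>antipode_twist\<close> multiplied by S(g) on the left. In this shape it
    is what the image of E \<iota>(r) = \<iota>(\<tau>(r)) E requires in the opposite
    algebra.\<close>
  have twE: "S r \<otimes>\<^bsub>H\<^esub> S g = S g \<otimes>\<^bsub>H\<^esub> \<tau> (S (\<tau> r))" if r: "r \<in> carrier H" for r
    using cl r antipode_twist[OF \<tau>_hom g r tE]
    by (simp add: A.m_assoc[symmetric] grouplike_antipode[OF g])
  have twF: "S r \<otimes>\<^bsub>H\<^esub> S h = S h \<otimes>\<^bsub>H\<^esub> \<omega> (S (\<omega> r))" if r: "r \<in> carrier H" for r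
    using cl r antipode_twist[OF \<omega>_hom h r tF]
    by (simp add: A.m_assoc[symmetric] grouplike_antipode[OF h])

  have DD: "Delta_E \<in> carrier U.AA" "Delta_F \<in> carrier U.AA" using cl by simp_all
  \<comment> \<open>Folding \<open>\<Delta>c\<close> turns the right side of
    \<open>skew_relation\<close> into \<open>I2 (\<Delta> c)\<close>, the required image of c; here
    the skew primitivity of c enters.\<close>
  obtain D where D: "D \<in> algebra_hom K amb.A U.AA" and D\<iota>: "\<And>r. r \<in> carrier H \<Longrightarrow> D (amb.\<iota> r) = I2 (\<Delta> r)"
    and DE: "D amb.E = Delta_E" and DF: "D amb.F = Delta_F"
    using amb.ambiskew_universal[OF U.AA.tensor_assoc_algebra algebra_hom_compose[OF comult_hom I2_hom] DD
        comult_var_commute[OF E \<tau>(2) g amb.ambiskew_relations(1) tE]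
        comult_var_commute[OF F \<omega>(2) h amb.ambiskew_relations(2) tF]
        skew_relation[OF \<tau>h(1) \<omega>g(1) gh, folded \<Delta>c]] by blast

  interpret G: assoc_algebra K "ground_algebra K" by (rule K.ground_assoc_algebra)
  have z: "\<zero>\<^bsub>K\<^esub> \<in> carrier (ground_algebra K)" by simp
  obtain e where e: "e \<in> algebra_hom K amb.A (ground_algebra K)" and e\<iota>: "\<And>r. r \<in> carrier H \<Longrightarrow> e (amb.\<iota> r) = \<epsilon> r"
    and eE: "e amb.E = \<zero>\<^bsub>K\<^esub>" and eF: "e amb.F = \<zero>\<^bsub>K\<^esub>"
  proof -
    \<comment> \<open>With both variables sent to 0 the third relation reduces to \<epsilon>(c) =
      0.\<close>
    have "\<zero>\<^bsub>ground_algebra K\<^esub> \<otimes>\<^bsub>ground_algebra K\<^esub> \<zero>\<^bsub>ground_algebra K\<^esub> \<ominus>\<^bsub>ground_algebra K\<^esub>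
      \<xi> \<odot>\<^bsub>ground_algebra K\<^esub> (\<zero>\<^bsub>ground_algebra K\<^esub> \<otimes>\<^bsub>ground_algebra K\<^esub> \<zero>\<^bsub>ground_algebra K\<^esub>) = \<epsilon> c"
      using G.M.r_neg[OF G.M.zero_closed] \<xi>K(1) by (simp add: a_minus_def \<epsilon>c)
    with amb.ambiskew_universal[OF K.ground_assoc_algebra counit_hom z z] that show thesis
      using counit(3) \<tau>(3) \<omega>(3) by (force simp: counit(3))
  qed

  let ?op = "opposite_algebra amb.A"
  \<comment> \<open>Values dictated by the left antipode law at the variables, S(E) + S(g) E = 0 and
    S(F) + S(h) F = 0.\<close>
  let ?sE = "\<ominus>\<^bsub>amb.A\<^esub> (amb.\<iota> (S g) \<cdot> amb.E)" and ?sF = "\<ominus>\<^bsub>amb.A\<^esub> (amb.\<iota> (S h) \<cdot> amb.F)"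
  obtain T where T: "T \<in> algebra_hom K amb.A ?op" and T\<iota>: "\<And>r. r \<in> carrier H \<Longrightarrow> T (amb.\<iota> r) = amb.\<iota> (S r)"
    and TE: "T amb.E = ?sE" and TF: "T amb.F = ?sF"
  proof -
    have f: "(\<lambda>r. amb.\<iota> (S r)) \<in> algebra_hom K H ?op"
      by (rule algebra_homI[OF linear_homI])
        (simp_all add: cl linear_homD[OF antipode_linear] \<iota>(4,5,6,7) antipode_mult antipode_one)
    have s: "?sE \<in> carrier ?op" "?sF \<in> carrier ?op" using cl by simp_all
    have r1: "?sE \<otimes>\<^bsub>?op\<^esub> amb.\<iota> (S r) = amb.\<iota> (S (\<tau> r)) \<otimes>\<^bsub>?op\<^esub> ?sE" if r: "r \<in> carrier H" for r
    proof -
      have "amb.\<iota> (S g) \<cdot> amb.E \<cdot> amb.\<iota> (S (\<tau> r)) = amb.\<iota> (S g \<otimes>\<^bsub>H\<^esub> \<tau> (S (\<tau> r))) \<cdot> amb.E"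
        using cl r by (simp add: U.A.m_assoc amb.ambiskew_relations(1) \<iota>(6))
      then show ?thesis
        using cl r by (simp add: U.A.l_minus U.A.r_minus twE[symmetric] \<iota>(6) U.A.m_assoc)
    qed
    have r2: "?sF \<otimes>\<^bsub>?op\<^esub> amb.\<iota> (S r) = amb.\<iota> (S (\<omega> r)) \<otimes>\<^bsub>?op\<^esub> ?sF" if r: "r \<in> carrier H" for r
    proof -
      have "amb.\<iota> (S h) \<cdot> amb.F \<cdot> amb.\<iota> (S (\<omega> r)) = amb.\<iota> (S h \<otimes>\<^bsub>H\<^esub> \<omega> (S (\<omega> r))) \<cdot> amb.F"
        using cl r by (simp add: U.A.m_assoc amb.ambiskew_relations(2) \<iota>(6))
      then show ?thesis
        using cl r by (simp add: U.A.l_minus U.A.r_minus twF[symmetric] \<iota>(6) U.A.m_assoc)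
    qed
    let ?k = "S h \<otimes>\<^bsub>H\<^esub> S g"
    let ?EF = "amb.E \<cdot> amb.F" and ?FE = "amb.F \<cdot> amb.E"
    have swap: "amb.\<iota> a \<cdot> X \<cdot> (amb.\<iota> b \<cdot> Y) = amb.\<iota> (a \<otimes>\<^bsub>H\<^esub> b') \<cdot> (X \<cdot> Y)"
      if "X \<cdot> amb.\<iota> b = amb.\<iota> b' \<cdot> X" "a \<in> carrier H" "b \<in> carrier H" "b' \<in> carrier H"
        "X \<in> carrier amb.A" "Y \<in> carrier amb.A" for a b b' X Y
    proof -
      have "amb.\<iota> a \<cdot> X \<cdot> (amb.\<iota> b \<cdot> Y) = amb.\<iota> a \<cdot> (X \<cdot> amb.\<iota> b) \<cdot> Y"
        using that(2-) \<iota>(3) by (simp add: U.A.m_assoc)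
      then show ?thesis using that(2-) \<iota>(3) by (simp add: that(1) U.A.m_assoc \<iota>(6))
    qed
    \<comment> \<open>In the opposite algebra the image of EF is \<open>?sF \<cdot> ?sE\<close>.
      Moving the group-like coefficients to the left costs \<omega>(S(g)) = \<xi> S(g) here and
      \<tau>(S(h)) = \<alpha>(S(h)) S(h) in \<open>2\<close>, where the explicit factor \<xi>
      cancels \<alpha>(S(h)).\<close>
    have 1: "?sF \<cdot> ?sE = \<xi> \<bullet> (amb.\<iota> ?k \<cdot> ?FE)"
      using cl swap[OF amb.ambiskew_relations(2)[OF SgH] ShH SgH _ F E]
      by (simp add: U.A.l_minus U.A.r_minus \<omega>g(2) smult_mult_right \<iota>(5) U.smult_mult_left)
    have 2: "\<xi> \<bullet> (?sE \<cdot> ?sF) = amb.\<iota> ?k \<cdot> ?EF"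
      using cl \<alpha>Sh swap[OF amb.ambiskew_relations(1)[OF ShH] SgH ShH _ E F]
      by (simp add: U.A.l_minus U.A.r_minus \<tau>h(2) smult_mult_right \<iota>(5) U.smult_mult_left U.smult_assoc1[symmetric] SS)
    \<comment> \<open>The products now appear as \<xi>FE - EF, the negative of the third relation;
      this sign and the factor S(h)S(g) are those of S(c) in \<open>Sc\<close>.\<close>
    have "?sF \<cdot> ?sE \<ominus>\<^bsub>amb.A\<^esub> \<xi> \<bullet> (?sE \<cdot> ?sF) = amb.\<iota> ?k \<cdot> (\<xi> \<bullet> ?FE \<ominus>\<^bsub>amb.A\<^esub> ?EF)"
      unfolding 1 2 using cl by (simp add: a_minus_def U.A.r_distr U.A.r_minus U.smult_mult_right)
    also have "\<xi> \<bullet> ?FE \<ominus>\<^bsub>amb.A\<^esub> ?EF = \<ominus>\<^bsub>amb.A\<^esub> amb.\<iota> c"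
      unfolding amb.ambiskew_relations(3)[symmetric] using cl
      by (simp add: a_minus_def U.M.minus_add U.M.a_comm)
    also have "amb.\<iota> ?k \<cdot> (\<ominus>\<^bsub>amb.A\<^esub> amb.\<iota> c) = amb.\<iota> (S c)"
      using cl by (simp add: Sc U.A.r_minus \<iota>(6) linear_hom_a_inv[OF \<iota>(2) module_axioms U.module_axioms])
    finally have r3: "?sE \<otimes>\<^bsub>?op\<^esub> ?sF \<ominus>\<^bsub>?op\<^esub> \<xi> \<odot>\<^bsub>?op\<^esub> (?sF \<otimes>\<^bsub>?op\<^esub> ?sE) = amb.\<iota> (S c)" by simp
    from amb.ambiskew_universal[OF U.opposite_assoc_algebra f s r1 r2 r3] that show thesis by blast
  qed
  have "hopf_algebra K amb.A D e T"
    by (rule hopf_structure[OF D D\<iota> DE DF e e\<iota> eE eF T T\<iota> TE TF])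
  moreover have "extends_hopf K H \<Delta> \<epsilon> S amb.A amb.\<iota> D e T"
    by (simp add: extends_hopf_def D\<iota> e\<iota> T\<iota>)
  ultimately show ?thesis using DE DF by blast
qed

end


theorem theorem3p1:
  fixes K :: "'k ring" and H :: "('k, 'h) module"
    and \<Delta> :: "'h \<Rightarrow> ('h \<times> 'h \<Rightarrow> 'k) set" and \<epsilon> :: "'h \<Rightarrow> 'k" and S :: "'h \<Rightarrow> 'h"
    and \<tau> \<omega> :: "'h \<Rightarrow> 'h" and c :: 'h and \<xi> :: 'k and g h :: 'h
  assumes "hopf_algebra K H \<Delta> \<epsilon> S"
    and "\<tau> \<in> algebra_aut K H" and "\<omega> \<in> algebra_aut K H"
    and "\<forall>r\<in>carrier H. \<tau> (\<omega> r) = \<omega> (\<tau> r)"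
    and "c \<in> sigma_center H (\<tau> \<circ> \<omega>)"
    and "\<xi> \<in> carrier K - {\<zero>\<^bsub>K\<^esub>}"
    and "g \<in> grouplikes K H \<Delta>" and "h \<in> grouplikes K H \<Delta>"
  shows "(let A = ambiskew K H \<tau> \<omega> c \<xi>; \<iota> = ambiskew_coeff K H \<tau> \<omega> c \<xi>;
              E = ambiskew_var K H \<tau> \<omega> c \<xi> VarX; F = ambiskew_var K H \<tau> \<omega> c \<xi> VarY
          in \<exists>\<Delta>' \<epsilon>' S'. hopf_algebra K A \<Delta>' \<epsilon>' S' \<and> extends_hopf K H \<Delta> \<epsilon> S A \<iota> \<Delta>' \<epsilon>' S' \<and>
               \<Delta>' E = tensor K A A E \<one>\<^bsub>A\<^esub> \<oplus>\<^bsub>tensor_algebra K A A\<^esub> tensor K A A (\<iota> g) E \<and>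
               \<Delta>' F = tensor K A A F \<one>\<^bsub>A\<^esub> \<oplus>\<^bsub>tensor_algebra K A A\<^esub> tensor K A A (\<iota> h) F)
     \<longleftrightarrow>
     (\<exists>\<alpha>\<in>characters K H. \<exists>\<beta>\<in>characters K H.
        (\<forall>r\<in>carrier H. convolution K \<Delta> \<alpha> \<beta> r = convolution K \<Delta> \<beta> \<alpha> r) \<and>
        (\<forall>r\<in>carrier H.
           \<tau> r = tensor_lift K H (\<lambda>x y. \<alpha> x \<odot>\<^bsub>H\<^esub> y) (\<Delta> r) \<and>
           \<omega> r = tensor_lift K H (\<lambda>x y. \<beta> x \<odot>\<^bsub>H\<^esub> y) (\<Delta> r) \<and>
           tensor_lift K H (\<lambda>x y. \<alpha> x \<odot>\<^bsub>H\<^esub> y) (\<Delta> r) =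
             tensor_lift K H (\<lambda>x y. \<alpha> y \<odot>\<^bsub>H\<^esub> (g \<otimes>\<^bsub>H\<^esub> x \<otimes>\<^bsub>H\<^esub> inv\<^bsub>H\<^esub> g)) (\<Delta> r) \<and>
           tensor_lift K H (\<lambda>x y. \<beta> x \<odot>\<^bsub>H\<^esub> y) (\<Delta> r) =
             tensor_lift K H (\<lambda>x y. \<beta> y \<odot>\<^bsub>H\<^esub> (h \<otimes>\<^bsub>H\<^esub> x \<otimes>\<^bsub>H\<^esub> inv\<^bsub>H\<^esub> h)) (\<Delta> r)) \<and>
        g \<in> grouplike_center K H \<Delta> \<and> h \<in> grouplike_center K H \<Delta> \<and>
        \<alpha> h = \<xi> \<and> inv\<^bsub>K\<^esub> (\<beta> g) = \<xi> \<and>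
        skew_primitive K H \<Delta> (g \<otimes>\<^bsub>H\<^esub> h) \<one>\<^bsub>H\<^esub> c)"
proof -
  interpret hopf_ambiskew K H \<Delta> \<epsilon> S \<tau> \<omega> c \<xi> g h
    using assms by (intro hopf_ambiskew.intro hopf_ambiskew_axioms.intro) auto
  show ?thesis
    \<comment> \<open>For group-likes the inverse is the antipode, which brings the goal into the
      form of \<open>necessity\<close> and \<open>sufficiency\<close>.\<close>
    unfolding Let_def grouplike_antipode(3)[OF g] grouplike_antipode(3)[OF h]
    by (rule iffI; elim exE bexE) (rule necessity sufficiency; assumption)+
qed

end
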